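(* Let $\mathcal{L}$ be a finite relational language and $T_\forall$ a universal $\mathcal{L}$-theory such that the class of finite models of $T_\forall$ is a Fraïssé class with the Strong Amalgamation Property. Let $T$ be the model completion of $T_\forall$ and let $T^*$ be the theory of the Fraïssé limit of the class of finite models of $T^*_\forall$ (as defined in the context). Suppose that $M\models T^*$. Then for any $c\in M$, $M_c\models T$. In fact, let $T_{oc}$ be the $\mathcal{L}^*$-theory saying that the set of open cones of any center, with the induced $\mathcal{L}$-structure, is a model of $T$ (including the axioms (WD) and (OC) of the context, which make this structure well defined), and let $T_0$ be the following axiom scheme: for all $x<y$ and for each isomorphism type of a model $A$ of $T_\forall$ with $|A|=1$, there is some $z$ with $x<z<y$ such that $\{y/E_z\}\cong A$ (i.e. the open cone of $y$ of center $z$, with the induced $\mathcal{L}$-structure, is isomorphic to $A$). Then $T^*=DT+T_{oc}+T_0$ (equality of deductive closures).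
   Context: A Fraïssé class is a class of finitely generated structures with the hereditary property (HP), joint embedding property (JEP) and amalgamation property (AP). It has the Strong Amalgamation Property (SAP) if in AP, for embeddings $f_1:A\to B$, $f_2:A\to C$ the amalgamating embeddings $g_1:B\to D$, $g_2:C\to D$ ($g_1f_1=g_2f_2$) can be chosen with $\mathrm{Im}(g_1)\cap\mathrm{Im}(g_2)=\mathrm{Im}(g_2 f_2)$, and in JEP the images of the two structures can be chosen disjoint. Trees: $\mathcal{L}_{Tr}=\{\leq,\wedge\}$, and $Tr$ is the theory of meet-trees: $\leq$ is a partial order such that $\{y : y\leq x\}$ is linearly ordered for every $x$, and $x\wedge y$ is the greatest element of $\{z : z\leq x,y\}$. For $a,b>c$ put $a\mathrel{E_c}b$ iff $a\wedge b>c$ (an equivalence relation on $\{a : a>c\}$); the $E_c$-classes are the open cones of center $c$. $DT$ is the theory of dense trees: $\leq$ defines a tree with meet operator $\wedge$; for every $x$ the set $\{y : y\leq x\}$ is a dense linear order with a maximal element but no minimal one; and for every $x$ there are infinitely many open cones of center $x$. The theory $T^*_\forall$: for each $n$-place relation symbol $R\in\mathcal{L}$ let $R^*$ be an $(n+1)$-place relation symbol, and let $\mathcal{L}^*=\mathcal{L}_{Tr}\cup\{R^* : R\in\mathcal{L}\}$. Let $=^*(x,y,y')$ stand for $x<y\wedge y'$. For a quantifier-free $\mathcal{L}$-formula $\psi(y)$ ($y$ a tuple), $\psi^*(x,y)$ is obtained from $\psi$ by replacing each atomic formula $R(\dots)$ (including equality) by $R^*(x,\dots)$. $T^*_\forall$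 consists of the axioms of $Tr$; for each $n$-place $R\in\mathcal{L}$ the axioms (WD) $\forall x,y_0,\dots,y_{n-1},y'_0,\dots,y'_{n-1}\,\big(R^*(x,y_0,\dots,y_{n-1})\ \&\ x<y_i\wedge y'_i \text{ for all } i<n\big)\to R^*(x,y'_0,\dots,y'_{n-1})$, and (OC) $\forall x,y_0,\dots,y_{n-1}\, R^*(x,y_0,\dots,y_{n-1})\to x<y_i$ for all $i<n$; and for each axiom $\forall y\,\psi(y)$ of $T_\forall$ the axiom $\forall x,y\,(x<y\to\psi^*(x,y))$, where $x<y$ means that $x$ is smaller than every variable in $y$. The finite models of $T^*_\forall$ form a uniformly locally finite Fraïssé class, and $T^*$ is the theory of its Fraïssé limit (equivalently, the model completion of $T^*_\forall$). Likewise $T$ is the theory of the Fraïssé limit of the class of finite models of $T_\forall$. The structure $M_c$: for $M\models Tr$ satisfying (WD) and (OC) and $c\in M$, $M_c=\{a/E_c : a\in M, a>c\}$ is the $\mathcal{L}$-structure with $R^{M_c}(a_0/E_c,\dots,a_{n-1}/E_c)$ iff $M\models R^*(c,a_0,\dots,a_{n-1})$, for each $n$-place $R\in\mathcal{L}$ and $a_0,\dots,a_{n-1}>c$. *)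

theory Defs
  imports Main
begin

section \<open>First-order logic\<close>

datatype 'f tm = Var nat | Fun 'f "'f tm list"

datatype ('f, 'r) fm =
    Bot
  | Eq "'f tm" "'f tm"
  | Rel 'r "'f tm list"
  | Imp "('f, 'r) fm" "('f, 'r) fm"
  | All nat "('f, 'r) fm"

abbreviation Neg :: "('f, 'r) fm \<Rightarrow> ('f, 'r) fm" where
  "Neg p \<equiv> Imp p Bot"

abbreviation And :: "('f, 'r) fm \<Rightarrow> ('f, 'r) fm \<Rightarrow> ('f, 'r) fm" where
  "And p q \<equiv> Neg (Imp p (Neg q))"

abbreviation Or :: "('f, 'r) fm \<Rightarrow> ('f, 'r) fm \<Rightarrow> ('f, 'r) fm" where
  "Or p q \<equiv> Imp (Neg p) q"

abbreviation Ex :: "nat \<Rightarrow> ('f, 'r) fm \<Rightarrow> ('f, 'r) fm" where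
  "Ex n p \<equiv> Neg (All n (Neg p))"

definition conj_list :: "('f, 'r) fm list \<Rightarrow> ('f, 'r) fm" where
  "conj_list ps = foldr And ps (Neg Bot)"

definition foralls :: "nat list \<Rightarrow> ('f, 'r) fm \<Rightarrow> ('f, 'r) fm" where
  "foralls xs p = foldr All xs p"

definition exs :: "nat list \<Rightarrow> ('f, 'r) fm \<Rightarrow> ('f, 'r) fm" where
  "exs xs p = foldr Ex xs p"

primrec tm_vars :: "'f tm \<Rightarrow> nat set" where
  "tm_vars (Var n) = {n}"
| "tm_vars (Fun f ts) = \<Union> (set (map tm_vars ts))"

primrec free_vars :: "('f, 'r) fm \<Rightarrow> nat set" where
  "free_vars Bot = {}"
| "free_vars (Eq s t) = tm_vars s \<union> tm_vars t"
| "free_vars (Rel r ts) = \<Union> (set (map tm_vars ts))"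
| "free_vars (Imp p q) = free_vars p \<union> free_vars q"
| "free_vars (All n p) = free_vars p - {n}"

text \<open>All variables, free or bound.\<close>

primrec all_vars :: "('f, 'r) fm \<Rightarrow> nat set" where
  "all_vars Bot = {}"
| "all_vars (Eq s t) = tm_vars s \<union> tm_vars t"
| "all_vars (Rel r ts) = \<Union> (set (map tm_vars ts))"
| "all_vars (Imp p q) = all_vars p \<union> all_vars q"
| "all_vars (All n p) = insert n (all_vars p)"

primrec quantifier_free :: "('f, 'r) fm \<Rightarrow> bool" where
  "quantifier_free Bot = True"
| "quantifier_free (Eq s t) = True"
| "quantifier_free (Rel r ts) = True"
| "quantifier_free (Imp p q) = (quantifier_free p \<and> quantifier_free q)"
| "quantifier_free (All n p) = False"

text \<open>A language is given by sets of symbols (rather than whole types), so that the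
  empty language and the absence of function symbols are covered.\<close>

record ('f, 'r) lang =
  funs :: "'f set"
  farity :: "'f \<Rightarrow> nat"
  rels :: "'r set"
  rarity :: "'r \<Rightarrow> nat"

primrec wf_tm :: "('f, 'r) lang \<Rightarrow> 'f tm \<Rightarrow> bool" where
  "wf_tm L (Var n) = True"
| "wf_tm L (Fun f ts) = (f \<in> funs L \<and> length ts = farity L f \<and> list_all (wf_tm L) ts)"

primrec wf_fm :: "('f, 'r) lang \<Rightarrow> ('f, 'r) fm \<Rightarrow> bool" where
  "wf_fm L Bot = True"
| "wf_fm L (Eq s t) = (wf_tm L s \<and> wf_tm L t)"
| "wf_fm L (Rel r ts) = (r \<in> rels L \<and> length ts = rarity L r \<and> list_all (wf_tm L) ts)"
| "wf_fm L (Imp p q) = (wf_fm L p \<and> wf_fm L q)"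
| "wf_fm L (All n p) = wf_fm L p"

definition sentence :: "('f, 'r) lang \<Rightarrow> ('f, 'r) fm \<Rightarrow> bool" where
  "sentence L p \<longleftrightarrow> wf_fm L p \<and> free_vars p = {}"

record ('f, 'r, 'a) struct =
  univ :: "'a set"
  func :: "'f \<Rightarrow> 'a list \<Rightarrow> 'a"
  relation :: "'r \<Rightarrow> 'a list \<Rightarrow> bool"

definition closed_under :: "('f, 'r) lang \<Rightarrow> ('f, 'r, 'a) struct \<Rightarrow> 'a set \<Rightarrow> bool" where
  "closed_under L M S \<longleftrightarrow>
     (\<forall>f\<in>funs L. \<forall>xs. length xs = farity L f \<and> set xs \<subseteq> S \<longrightarrow> func M f xs \<in> S)"

text \<open>Structures are nonempty, as usual in first-order logic. The values of \<open>func\<close> and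
  \<open>relation\<close> outside the universe and the language are irrelevant.\<close>

definition is_struct :: "('f, 'r) lang \<Rightarrow> ('f, 'r, 'a) struct \<Rightarrow> bool" where
  "is_struct L M \<longleftrightarrow> univ M \<noteq> {} \<and> closed_under L M (univ M)"

primrec eval_tm :: "('f, 'r, 'a) struct \<Rightarrow> (nat \<Rightarrow> 'a) \<Rightarrow> 'f tm \<Rightarrow> 'a" where
  "eval_tm M e (Var n) = e n"
| "eval_tm M e (Fun f ts) = func M f (map (eval_tm M e) ts)"

primrec eval_fm :: "('f, 'r, 'a) struct \<Rightarrow> (nat \<Rightarrow> 'a) \<Rightarrow> ('f, 'r) fm \<Rightarrow> bool" where
  "eval_fm M e Bot = False"
| "eval_fm M e (Eq s t) = (eval_tm M e s = eval_tm M e t)"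
| "eval_fm M e (Rel r ts) = relation M r (map (eval_tm M e) ts)"
| "eval_fm M e (Imp p q) = (eval_fm M e p \<longrightarrow> eval_fm M e q)"
| "eval_fm M e (All n p) = (\<forall>a\<in>univ M. eval_fm M (e(n := a)) p)"

definition sat :: "('f, 'r, 'a) struct \<Rightarrow> ('f, 'r) fm \<Rightarrow> bool" where
  "sat M p \<longleftrightarrow> (\<forall>e. (\<forall>n. e n \<in> univ M) \<longrightarrow> eval_fm M e p)"

definition model_of ::
  "('f, 'r) lang \<Rightarrow> ('f, 'r, 'a) struct \<Rightarrow> ('f, 'r) fm set \<Rightarrow> bool" where
  "model_of L M T \<longleftrightarrow> is_struct L M \<and> (\<forall>p\<in>T. sat M p)"

text \<open>Deductive closure, as semantic consequence over the structures whose universe is a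
  subset of the type \<open>'a\<close>. For a countable language and infinite \<open>'a\<close> (e.g. \<open>nat\<close>)
  this is the usual notion, by the completeness and downward Loewenheim-Skolem theorems.\<close>

definition deductive_closure ::
  "'a itself \<Rightarrow> ('f, 'r) lang \<Rightarrow> ('f, 'r) fm set \<Rightarrow> ('f, 'r) fm set" where
  "deductive_closure TYPE('a) L T =
     {p. sentence L p \<and> (\<forall>M :: ('f, 'r, 'a) struct. model_of L M T \<longrightarrow> sat M p)}"

definition universal_theory :: "('f, 'r) lang \<Rightarrow> ('f, 'r) fm set \<Rightarrow> bool" where
  "universal_theory L T \<longleftrightarrow>
     (\<forall>p\<in>T. \<exists>ys q. p = foralls ys q \<and> quantifier_free q \<and> wf_fm L q \<and> free_vars q \<subseteq> set ys)"

text \<open>Relation symbols have positive arity, as is customary. With a 0-place symbol \<open>R\<close>,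
  the unary \<open>R*\<close> would not be controlled by the axioms below at maximal elements.\<close>

definition finite_relational :: "('f, 'r) lang \<Rightarrow> bool" where
  "finite_relational L \<longleftrightarrow> funs L = {} \<and> finite (rels L) \<and> (\<forall>r\<in>rels L. rarity L r \<ge> 1)"


section \<open>Embeddings, Fraisse classes and model completions\<close>

definition embedding ::
  "('f, 'r) lang \<Rightarrow> ('f, 'r, 'a) struct \<Rightarrow> ('f, 'r, 'b) struct \<Rightarrow> ('a \<Rightarrow> 'b) \<Rightarrow> bool" where
  "embedding L A B h \<longleftrightarrow>
     h ` univ A \<subseteq> univ B \<and> inj_on h (univ A) \<and>
     (\<forall>f\<in>funs L. \<forall>xs. length xs = farity L f \<and> set xs \<subseteq> univ A \<longrightarrow>
        h (func A f xs) = func B f (map h xs)) \<and>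
     (\<forall>r\<in>rels L. \<forall>xs. length xs = rarity L r \<and> set xs \<subseteq> univ A \<longrightarrow>
        (relation A r xs \<longleftrightarrow> relation B r (map h xs)))"

definition isomorphism ::
  "('f, 'r) lang \<Rightarrow> ('f, 'r, 'a) struct \<Rightarrow> ('f, 'r, 'b) struct \<Rightarrow> ('a \<Rightarrow> 'b) \<Rightarrow> bool" where
  "isomorphism L A B h \<longleftrightarrow> embedding L A B h \<and> h ` univ A = univ B"

definition fin_generated :: "('f, 'r) lang \<Rightarrow> ('f, 'r, 'a) struct \<Rightarrow> bool" where
  "fin_generated L A \<longleftrightarrow>
     (\<exists>X. finite X \<and> X \<subseteq> univ A \<and>
        (\<forall>S. X \<subseteq> S \<and> S \<subseteq> univ A \<and> closed_under L A S \<longrightarrow> S = univ A))"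

text \<open>A class of finitely generated (hence, in the countable languages considered here,
  countable) structures is represented by its members with universe a set of natural numbers.\<close>

definition hereditary :: "('f, 'r) lang \<Rightarrow> ('f, 'r, nat) struct set \<Rightarrow> bool" where
  "hereditary L K \<longleftrightarrow>
     (\<forall>A\<in>K. \<forall>B h. is_struct L B \<and> fin_generated L B \<and> embedding L B A h \<longrightarrow> B \<in> K)"

definition joint_embedding :: "('f, 'r) lang \<Rightarrow> ('f, 'r, nat) struct set \<Rightarrow> bool" where
  "joint_embedding L K \<longleftrightarrow>
     (\<forall>A\<in>K. \<forall>B\<in>K. \<exists>D\<in>K. \<exists>f g. embedding L A D f \<and> embedding L B D g)"

definition amalgamation :: "('f, 'r) lang \<Rightarrow> ('f, 'r, nat) struct set \<Rightarrow> bool" where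
  "amalgamation L K \<longleftrightarrow>
     (\<forall>A\<in>K. \<forall>B\<in>K. \<forall>C\<in>K. \<forall>f1 f2. embedding L A B f1 \<and> embedding L A C f2 \<longrightarrow>
        (\<exists>D\<in>K. \<exists>g1 g2. embedding L B D g1 \<and> embedding L C D g2 \<and>
           (\<forall>a\<in>univ A. g1 (f1 a) = g2 (f2 a))))"

definition fraisse_class :: "('f, 'r) lang \<Rightarrow> ('f, 'r, nat) struct set \<Rightarrow> bool" where
  "fraisse_class L K \<longleftrightarrow>
     K \<noteq> {} \<and> (\<forall>A\<in>K. is_struct L A \<and> fin_generated L A) \<and>
     hereditary L K \<and> joint_embedding L K \<and> amalgamation L K"

definition strong_amalgamation :: "('f, 'r) lang \<Rightarrow> ('f, 'r, nat) struct set \<Rightarrow> bool" where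
  "strong_amalgamation L K \<longleftrightarrow>
     (\<forall>A\<in>K. \<forall>B\<in>K. \<forall>C\<in>K. \<forall>f1 f2. embedding L A B f1 \<and> embedding L A C f2 \<longrightarrow>
        (\<exists>D\<in>K. \<exists>g1 g2. embedding L B D g1 \<and> embedding L C D g2 \<and>
           (\<forall>a\<in>univ A. g1 (f1 a) = g2 (f2 a)) \<and>
           g1 ` univ B \<inter> g2 ` univ C = (g2 \<circ> f2) ` univ A)) \<and>
     (\<forall>A\<in>K. \<forall>B\<in>K. \<exists>D\<in>K. \<exists>f g. embedding L A D f \<and> embedding L B D g \<and>
        f ` univ A \<inter> g ` univ B = {})"

definition finite_models :: "('f, 'r) lang \<Rightarrow> ('f, 'r) fm set \<Rightarrow> ('f, 'r, nat) struct set" where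
  "finite_models L T = {A. model_of L A T \<and> finite (univ A)}"

definition age :: "('f, 'r) lang \<Rightarrow> ('f, 'r, 'a) struct \<Rightarrow> ('f, 'r, nat) struct set" where
  "age L M = {A. is_struct L A \<and> fin_generated L A \<and> (\<exists>h. embedding L A M h)}"

definition homogeneous :: "('f, 'r) lang \<Rightarrow> ('f, 'r, 'a) struct \<Rightarrow> bool" where
  "homogeneous L M \<longleftrightarrow>
     (\<forall>S S' h. S \<subseteq> univ M \<and> S' \<subseteq> univ M \<and>
        is_struct L (M\<lparr>univ := S\<rparr>) \<and> is_struct L (M\<lparr>univ := S'\<rparr>) \<and>
        fin_generated L (M\<lparr>univ := S\<rparr>) \<and>
        isomorphism L (M\<lparr>univ := S\<rparr>) (M\<lparr>univ := S'\<rparr>) h \<longrightarrow>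
        (\<exists>g. isomorphism L M M g \<and> (\<forall>x\<in>S. g x = h x)))"

text \<open>Countability is built in: the universe is a set of natural numbers.\<close>

definition fraisse_limit ::
  "('f, 'r) lang \<Rightarrow> ('f, 'r, nat) struct set \<Rightarrow> ('f, 'r, nat) struct \<Rightarrow> bool" where
  "fraisse_limit L K F \<longleftrightarrow> is_struct L F \<and> homogeneous L F \<and> age L F = K"

text \<open>By Fraisse's theorem the limit of a Fraisse class exists and is unique up to isomorphism,
  so that quantifying over all limits just avoids choosing one.\<close>

definition fraisse_limit_theory ::
  "('f, 'r) lang \<Rightarrow> ('f, 'r, nat) struct set \<Rightarrow> ('f, 'r) fm set" where
  "fraisse_limit_theory L K = {p. sentence L p \<and> (\<forall>F. fraisse_limit L K F \<longrightarrow> sat F p)}"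

text \<open>\<open>T\<close> is a model completion of \<open>T0\<close>: \<open>T\<close> implies \<open>T0\<close>, every model of \<open>T0\<close> embeds into a
  model of \<open>T\<close>, and for every model \<open>A\<close> of \<open>T0\<close> the theory \<open>T\<close> together with the diagram of
  \<open>A\<close> is complete. A model of the latter is a model \<open>M\<close> of \<open>T\<close> with an embedding \<open>f\<close> of
  \<open>A\<close> into \<open>M\<close>, and sentences with constants from \<open>A\<close> are formulas evaluated at \<open>f \<circ> e\<close> for
  \<open>e\<close> a valuation in \<open>A\<close>. For countable languages countable structures suffice, by the
  downward Loewenheim-Skolem theorem.\<close>

definition model_completion ::
  "('f, 'r) lang \<Rightarrow> ('f, 'r) fm set \<Rightarrow> ('f, 'r) fm set \<Rightarrow> bool" where
  "model_completion L T T0 \<longleftrightarrow>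
     (\<forall>p\<in>T. sentence L p) \<and>
     (\<forall>M :: ('f, 'r, nat) struct. model_of L M T \<longrightarrow> model_of L M T0) \<and>
     (\<forall>A :: ('f, 'r, nat) struct. model_of L A T0 \<longrightarrow>
        (\<exists>M :: ('f, 'r, nat) struct. model_of L M T \<and> (\<exists>f. embedding L A M f))) \<and>
     (\<forall>(A :: ('f, 'r, nat) struct) (M :: ('f, 'r, nat) struct) (N :: ('f, 'r, nat) struct) f g.
        model_of L A T0 \<and> model_of L M T \<and> model_of L N T \<and>
        embedding L A M f \<and> embedding L A N g \<longrightarrow>
        (\<forall>p e. wf_fm L p \<and> (\<forall>n. e n \<in> univ A) \<longrightarrow>
           (eval_fm M (f \<circ> e) p \<longleftrightarrow> eval_fm N (g \<circ> e) p)))"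


section \<open>Trees\<close>

datatype tree_fun = Meet

datatype 'r tree_rel = Leq | Star 'r

definition star_lang :: "('f, 'r) lang \<Rightarrow> (tree_fun, 'r tree_rel) lang" where
  "star_lang L = \<lparr>funs = {Meet}, farity = (\<lambda>_. 2),
     rels = insert Leq (Star ` rels L),
     rarity = (\<lambda>R. case R of Leq \<Rightarrow> 2 | Star r \<Rightarrow> Suc (rarity L r))\<rparr>"

abbreviation meet :: "tree_fun tm \<Rightarrow> tree_fun tm \<Rightarrow> tree_fun tm" where
  "meet s t \<equiv> Fun Meet [s, t]"

abbreviation leq :: "tree_fun tm \<Rightarrow> tree_fun tm \<Rightarrow> (tree_fun, 'r tree_rel) fm" where
  "leq s t \<equiv> Rel Leq [s, t]"

abbreviation lt :: "tree_fun tm \<Rightarrow> tree_fun tm \<Rightarrow> (tree_fun, 'r tree_rel) fm" where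
  "lt s t \<equiv> And (leq s t) (Neg (Eq s t))"

definition Tr :: "(tree_fun, 'r tree_rel) fm set" where
  "Tr = (let x = Var 0; y = Var 1; z = Var 2 in
    {foralls [0] (leq x x),
     foralls [0, 1] (Imp (And (leq x y) (leq y x)) (Eq x y)),
     foralls [0, 1, 2] (Imp (And (leq x y) (leq y z)) (leq x z)),
     foralls [0, 1, 2] (Imp (And (leq y x) (leq z x)) (Or (leq y z) (leq z y))),
     foralls [0, 1] (And (leq (meet x y) x) (leq (meet x y) y)),
     foralls [0, 1, 2] (Imp (And (leq z x) (leq z y)) (leq z (meet x y)))})"

text \<open>There are at least \<open>n\<close> open cones of any center: \<open>x\<close> is the variable \<open>0\<close>, and the
  variables \<open>1, \<dots>, n\<close> are pairwise inequivalent elements above it.\<close>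

definition many_cones :: "nat \<Rightarrow> (tree_fun, 'r tree_rel) fm" where
  "many_cones n = All 0 (exs [1..<n + 1] (conj_list
     (map (\<lambda>i. lt (Var 0) (Var i)) [1..<n + 1] @
      [Neg (lt (Var 0) (meet (Var i) (Var j))). i \<leftarrow> [1..<n + 1], j \<leftarrow> [1..<i]])))"

definition DT :: "(tree_fun, 'r tree_rel) fm set" where
  "DT = Tr \<union> (let x = Var 0; y = Var 1; z = Var 2; w = Var 3 in
    {foralls [0, 1, 2] (Imp (And (And (leq y x) (leq z x)) (lt y z))
       (Ex 3 (And (leq w x) (And (lt y w) (lt w z))))),
     All 0 (Ex 1 (And (leq y x) (All 2 (Imp (leq z x) (leq z y))))),
     foralls [0, 1] (Imp (leq y x) (Ex 2 (And (leq z x) (lt z y))))}) \<union>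
    range many_cones"


section \<open>The starred theories\<close>

text \<open>In a relational language every term is a variable; the value for \<open>Fun\<close> is a dummy.\<close>

definition star_tm :: "'f tm \<Rightarrow> tree_fun tm" where
  "star_tm t = (case t of Var n \<Rightarrow> Var n | Fun f ts \<Rightarrow> Var 0)"

text \<open>\<open>star x p\<close> says that \<open>p\<close> holds in the structure of open cones of center \<open>x\<close>. On
  quantifier-free formulas it only replaces the atomic formulas \<open>R(\<dots>)\<close> by \<open>R*(x, \<dots>)\<close>,
  where \<open>y =* y'\<close> is \<open>x < y \<and> y'\<close>; quantifiers are relativized to the elements above \<open>x\<close>.
  It is only meaningful if \<open>x\<close> does not occur in \<open>p\<close>, free or bound.\<close>

primrec star :: "nat \<Rightarrow> ('f, 'r) fm \<Rightarrow> (tree_fun, 'r tree_rel) fm" where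
  "star x Bot = Bot"
| "star x (Eq s t) = lt (Var x) (meet (star_tm s) (star_tm t))"
| "star x (Rel r ts) = Rel (Star r) (Var x # map star_tm ts)"
| "star x (Imp p q) = Imp (star x p) (star x q)"
| "star x (All y p) = All y (Imp (lt (Var x) (Var y)) (star x p))"

text \<open>In (WD), with \<open>n\<close> the arity of \<open>R\<close>, the variables \<open>x\<close>, \<open>y_i\<close> and \<open>y'_i\<close> are \<open>0\<close>,
  \<open>1 + i\<close> and \<open>1 + n + i\<close>.\<close>

definition WD :: "('f, 'r) lang \<Rightarrow> (tree_fun, 'r tree_rel) fm set" where
  "WD L = (\<lambda>r. let n = rarity L r in
     foralls [0..<2 * n + 1] (Imp
       (And (Rel (Star r) (map Var (0 # [1..<n + 1])))
            (conj_list (map (\<lambda>i. lt (Var 0) (meet (Var (1 + i)) (Var (1 + n + i)))) [0..<n])))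
       (Rel (Star r) (map Var (0 # [1 + n..<2 * n + 1]))))) ` rels L"

definition OC :: "('f, 'r) lang \<Rightarrow> (tree_fun, 'r tree_rel) fm set" where
  "OC L = (\<lambda>r. let n = rarity L r in
     foralls [0..<n + 1] (Imp
       (Rel (Star r) (map Var (0 # [1..<n + 1])))
       (conj_list (map (\<lambda>i. lt (Var 0) (Var (1 + i))) [0..<n])))) ` rels L"

definition star_axioms ::
  "('f, 'r) lang \<Rightarrow> ('f, 'r) fm set \<Rightarrow> (tree_fun, 'r tree_rel) fm set" where
  "star_axioms L TA =
     {foralls (x # ys) (Imp (conj_list (map (\<lambda>y. lt (Var x) (Var y)) ys)) (star x p)) | x ys p.
        foralls ys p \<in> TA \<and> quantifier_free p \<and> free_vars p \<subseteq> set ys \<and> x \<notin> set ys}"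

definition T_star_forall ::
  "('f, 'r) lang \<Rightarrow> ('f, 'r) fm set \<Rightarrow> (tree_fun, 'r tree_rel) fm set" where
  "T_star_forall L TA = Tr \<union> WD L \<union> OC L \<union> star_axioms L TA"

definition T_star ::
  "('f, 'r) lang \<Rightarrow> ('f, 'r) fm set \<Rightarrow> (tree_fun, 'r tree_rel) fm set" where
  "T_star L TA =
     fraisse_limit_theory (star_lang L) (finite_models (star_lang L) (T_star_forall L TA))"

definition T_oc ::
  "('f, 'r) lang \<Rightarrow> ('f, 'r) fm set \<Rightarrow> (tree_fun, 'r tree_rel) fm set" where
  "T_oc L T = WD L \<union> OC L \<union> {All x (star x p) | x p. p \<in> T \<and> x \<notin> all_vars p}"

text \<open>The quantifier-free formula saying that \<open>{y/E_z}\<close>, with the structure induced from the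
  open cones of center \<open>z\<close>, is isomorphic to the one-element structure \<open>A\<close>; \<open>rs\<close>
  enumerates the relation symbols.\<close>

definition cone_type ::
  "('f, 'r) lang \<Rightarrow> 'r list \<Rightarrow> ('f, 'r, nat) struct \<Rightarrow> nat \<Rightarrow> nat \<Rightarrow> (tree_fun, 'r tree_rel) fm"
where
  "cone_type L rs A z y = conj_list (map
     (\<lambda>r. let p = Rel (Star r) (Var z # replicate (rarity L r) (Var y)) in
        if \<exists>a\<in>univ A. relation A r (replicate (rarity L r) a) then p else Neg p) rs)"

definition T_zero ::
  "('f, 'r) lang \<Rightarrow> ('f, 'r) fm set \<Rightarrow> (tree_fun, 'r tree_rel) fm set" where
  "T_zero L TA =
     {foralls [0, 1] (Imp (lt (Var 0) (Var 1))
        (Ex 2 (And (And (lt (Var 0) (Var 2)) (lt (Var 2) (Var 1))) (cone_type L rs A 2 1)))) |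
      rs A. set rs = rels L \<and> distinct rs \<and> model_of L A TA \<and> card (univ A) = 1}"


section \<open>The structure of open cones\<close>

definition above :: "(tree_fun, 'r tree_rel, 'a) struct \<Rightarrow> 'a \<Rightarrow> 'a set" where
  "above M c = {a \<in> univ M. relation M Leq [c, a] \<and> c \<noteq> a}"

definition cone_rel :: "(tree_fun, 'r tree_rel, 'a) struct \<Rightarrow> 'a \<Rightarrow> ('a \<times> 'a) set" where
  "cone_rel M c = {(a, b). a \<in> above M c \<and> b \<in> above M c \<and> func M Meet [a, b] \<in> above M c}"

text \<open>The relations of \<open>M_c\<close> do not depend on the representatives, by (WD).\<close>

definition cone_struct ::
  "(tree_fun, 'r tree_rel, 'a) struct \<Rightarrow> 'a \<Rightarrow> ('f, 'r, 'a set) struct" where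
  "cone_struct M c = \<lparr>univ = above M c // cone_rel M c,
     func = (\<lambda>_ _. {}),
     relation = (\<lambda>r Xs. \<exists>as. set as \<subseteq> above M c \<and> Xs = map (\<lambda>a. cone_rel M c `` {a}) as \<and>
        relation M (Star r) (c # as))\<rparr>"

text \<open>This justifies the axioms \<open>star x p\<close> of \<open>T_oc\<close>: they express that \<open>p\<close> holds in \<open>M_c\<close>.\<close>

lemma star_tm_Var: "wf_tm L t \<Longrightarrow> funs L = {} \<Longrightarrow> \<exists>n. t = Var n \<and> star_tm t = Var n"
  by (cases t) (auto simp: star_tm_def)

lemma eval_star:
  fixes M :: "(tree_fun, 'r tree_rel, 'a) struct" and L :: "('f,'r) lang"
  assumes fl: "funs L = {}" and cM: "c \<in> univ M"
   and eq: "equiv (above M c) (cone_rel M c)"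
   and mt: "\<And>a b. a \<in> above M c \<Longrightarrow> b \<in> above M c \<Longrightarrow> func M Meet [a,b] \<in> univ M"
   and wd: "\<And>r as bs. r \<in> rels L \<Longrightarrow> length as = rarity L r \<Longrightarrow> length bs = rarity L r \<Longrightarrow> relation M (Star r) (c#as) \<Longrightarrow>
      (\<forall>i<length as. (as!i, bs!i) \<in> cone_rel M c) \<Longrightarrow> relation M (Star r) (c#bs)"
   and "wf_fm L p" "x \<notin> all_vars p" "e x = c" "\<forall>n. n \<noteq> x \<longrightarrow> e n \<in> above M c"
  shows "eval_fm M e (star x p) = eval_fm (cone_struct M c :: ('f,'r,'a set) struct) (\<lambda>n. cone_rel M c `` {e n}) p"
  using assms(6-)
proof (induction p arbitrary: e)
  case (Eq s t)
  obtain m n where mn: "s = Var m" "t = Var n" using star_tm_Var[OF _ fl] Eq by (metis wf_fm.simps(2))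
  with Eq have "e m \<in> above M c" "e n \<in> above M c" by auto
  then show ?case using mn Eq eq_equiv_class_iff[OF eq, of "e m" "e n"] mt[of "e m" "e n"]
    by (auto simp: star_tm_def cone_rel_def above_def)
next
  case (Rel r ts)
  have "\<forall>t\<in>set ts. \<exists>n. t = Var n" using star_tm_Var[OF _ fl] Rel by (fastforce simp: list_all_iff)
  then obtain ns where ns: "ts = map Var ns" by (metis ex_map_conv)
  have st: "map star_tm ts = map Var ns" by (simp add: ns star_tm_def)
  have ab: "set (map e ns) \<subseteq> above M c" using Rel ns by auto
  let ?R = "cone_rel M c"
  have "relation M (Star r) (c # map e ns) \<longleftrightarrow> (\<exists>as. set as \<subseteq> above M c \<and> map (\<lambda>n. ?R `` {e n}) ns = map (\<lambda>a. ?R `` {a}) as \<and>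
        relation M (Star r) (c # as))" (is "?A \<longleftrightarrow> ?B")
  proof
    assume ?A then show ?B using ab by (intro exI[of _ "map e ns"]) auto
  next
    assume ?B
    then obtain as where as: "set as \<subseteq> above M c" "map (\<lambda>n. ?R `` {e n}) ns = map (\<lambda>a. ?R `` {a}) as" "relation M (Star r) (c # as)" by blast
    have l: "length as = length ns" using as(2) by (metis length_map)
    have "(as!i, map e ns!i) \<in> ?R" if "i < length as" for i
    proof -
      have "?R `` {e (ns!i)} = ?R `` {as!i}" using as(2) that l by (metis nth_map)
      moreover have "as!i \<in> above M c" "e (ns!i) \<in> above M c" using as(1) ab that l nth_mem[of i as] nth_mem[of i ns] by auto
      ultimately show ?thesis using eq_equiv_class_iff[OF eq] that l by (metis length_map nth_map)
    qed
    then show ?A using wd[of r as "map e ns"] as(3) l Rel ns by simp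
  qed
  then show ?case using Rel by (simp add: cone_struct_def ns star_tm_def comp_def)
next
  case (All y p)
  have "eval_fm M e (star x (All y p)) \<longleftrightarrow> (\<forall>a\<in>above M c. eval_fm M (e(y:=a)) (star x p))"
    using All.prems by (auto simp: above_def)
  also have "\<dots> \<longleftrightarrow> (\<forall>a\<in>above M c. eval_fm (cone_struct M c :: ('f,'r,'a set) struct) (\<lambda>n. cone_rel M c `` {(e(y:=a)) n}) p)"
  proof (intro ball_cong refl)
    fix a assume "a \<in> above M c"
    then show "eval_fm M (e(y:=a)) (star x p) = eval_fm (cone_struct M c :: ('f,'r,'a set) struct) (\<lambda>n. cone_rel M c `` {(e(y:=a)) n}) p"
      by (intro All.IH) (use All.prems in auto)
  qed
  also have "\<dots> \<longleftrightarrow> (\<forall>a\<in>above M c. eval_fm (cone_struct M c :: ('f,'r,'a set) struct) ((\<lambda>n. cone_rel M c `` {e n})(y := cone_rel M c `` {a})) p)"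
  proof -
    have "(\<lambda>n. cone_rel M c `` {(e(y:=a)) n}) = (\<lambda>n. cone_rel M c `` {e n})(y := cone_rel M c `` {a})" for a
      by (rule ext) simp
    then show ?thesis by simp
  qed
  also have "\<dots> \<longleftrightarrow> (\<forall>X\<in>above M c // cone_rel M c. eval_fm (cone_struct M c :: ('f,'r,'a set) struct) ((\<lambda>n. cone_rel M c `` {e n})(y:=X)) p)"
    by (auto simp: quotient_def)
  finally show ?case by (simp add: cone_struct_def)
qed auto

end

theory Submission
  imports Defs "HOL-Library.Countable_Set"
begin

text \<open>Call a structure \<open>M\<close> rich for a class of finite structures if every embedding of a finite
  substructure of \<open>M\<close> into a member \<open>B\<close> of the class is inverted by an embedding of \<open>B\<close> into
  \<open>M\<close>. Two countable rich structures that are locally in the class are isomorphic, by an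
  isomorphism that extends any given finite partial one (\<open>back_and_forth\<close>). So a countable
  structure that is rich for a class and locally in it is a Fraisse limit of the class, and
  conversely a Fraisse limit is rich (\<open>rich_fraisse_limit\<close>). The theorem compares two kinds
  of richness: that of a tree with its relations \<open>R*\<close> for the finite models of
  \<open>T_star_forall\<close>, and that of the structures \<open>M_c\<close> of its open cones for the finite models
  of \<open>TA\<close>. For the latter class, the countable rich models of \<open>TA\<close> are just the countable
  models of the model completion \<open>T\<close> (\<open>rich_of_model_completion\<close> and \<open>model_of_rich\<close>): the
  completeness of \<open>T\<close> over a diagram transfers the existential formula that describes a
  one-point extension, and back and forth gives the converse.

  From the axioms to \<open>T*\<close>: let \<open>M\<close> satisfy DT, \<open>T_oc\<close> and \<open>T_zero\<close>. By the downward
  Loewenheim-Skolem theorem \<open>M\<close> may be taken countable. A finite tree grows by adding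
  minimal new points one at a time, and a new point that is not the only one has two
  possible positions. Either it lies below an old point; then it sits in an interval or
  below the root, it has a single old cone above it, and the isomorphism type of that cone
  is all the new information, so that \<open>T_zero\<close> provides a copy (\<open>extend_below\<close>). Or it is
  maximal; then it adds a cone at the greatest old point \<open>c\<close> below it, and the richness of
  \<open>M_c\<close>, a model of \<open>T\<close>, provides a copy (\<open>extend_above\<close>). So \<open>M\<close> is rich, hence it is a
  Fraisse limit of the finite models of \<open>T_star_forall\<close>, and \<open>T*\<close> holds in it by definition.

  From \<open>T*\<close> to the axioms: let \<open>F\<close> be a Fraisse limit. Richness for a three-element chain
  whose middle point has a prescribed cone gives density and \<open>T_zero\<close> (\<open>insert_point_F\<close>);
  richness for a two-element chain gives that there is no minimum (\<open>no_minimum_F\<close>); richness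
  for fans, which are trees of height two whose leaves carry a finite model of \<open>TA\<close>, says
  that \<open>F_c\<close> is rich for the finite models of \<open>TA\<close>, so that \<open>F_c\<close> is a model of \<open>T\<close>
  (\<open>cone_extension_F\<close> and \<open>cone_struct_F\<close>). Disjoint joint embedding makes the finite models
  of \<open>TA\<close> arbitrarily large, so there are infinitely many cones (\<open>many_cones_F\<close>).

  Hence the two theories have the same models, countable or not (\<open>model_of_T_star_iff\<close>), which
  gives the equality of the deductive closures, and the axioms \<open>T_oc\<close> say that the
  structures \<open>M_c\<close> are models of \<open>T\<close>.\<close>

section \<open>Satisfaction, embeddings and universal theories\<close>

lemma conj_list_simps [simp]:
  "conj_list [] = Neg Bot" "conj_list (p # ps) = And p (conj_list ps)"
  by (simp_all add: conj_list_def)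

lemma foralls_simps [simp]:
  "foralls [] p = p" "foralls (x # xs) p = All x (foralls xs p)"
  by (simp_all add: foralls_def)

lemma exs_simps [simp]:
  "exs [] p = p" "exs (x # xs) p = Ex x (exs xs p)"
  by (simp_all add: exs_def)

lemma eval_conj_list [simp]: "eval_fm M e (conj_list ps) \<longleftrightarrow> (\<forall>p\<in>set ps. eval_fm M e p)"
  by (induction ps) auto

lemma wf_conj_list [simp]: "wf_fm L (conj_list ps) \<longleftrightarrow> (\<forall>p\<in>set ps. wf_fm L p)"
  by (induction ps) auto

lemma quantifier_free_conj_list [simp]:
  "quantifier_free (conj_list ps) \<longleftrightarrow> (\<forall>p\<in>set ps. quantifier_free p)"
  by (induction ps) auto

lemma free_vars_conj_list [simp]: "free_vars (conj_list ps) = (\<Union>p\<in>set ps. free_vars p)"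
  by (induction ps) auto

lemma wf_foralls [simp]: "wf_fm L (foralls xs p) \<longleftrightarrow> wf_fm L p"
  by (induction xs) auto

lemma free_vars_foralls [simp]: "free_vars (foralls xs p) = free_vars p - set xs"
  by (induction xs) auto

lemma wf_exs [simp]: "wf_fm L (exs xs p) \<longleftrightarrow> wf_fm L p"
  by (induction xs) auto

lemma free_vars_exs [simp]: "free_vars (exs xs p) = free_vars p - set xs"
  by (induction xs) auto

text \<open>Satisfaction quantifies over all valuations, so that leading universal quantifiers can be
  dropped.\<close>
lemma sat_All [simp]: "sat M (All n p) \<longleftrightarrow> sat M p"
proof
  assume a: "sat M (All n p)"
  show "sat M p" unfolding sat_def
  proof (intro allI impI)
    fix e :: "nat \<Rightarrow> 'c" assume "\<forall>n. e n \<in> univ M"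
    moreover from this a have "eval_fm M (e(n := e n)) p" unfolding sat_def by (simp del: fun_upd_triv)
    ultimately show "eval_fm M e p" by simp
  qed
qed (simp add: sat_def)

lemma sat_foralls [simp]: "sat M (foralls xs p) \<longleftrightarrow> sat M p"
  by (induction xs) auto

lemma eval_exsI:
  assumes "eval_fm M e' p" "\<And>n. n \<notin> set xs \<Longrightarrow> e' n = e n" "\<And>n. n \<in> set xs \<Longrightarrow> e' n \<in> univ M"
  shows "eval_fm M e (exs xs p)"
  using assms(2-)
proof (induction xs arbitrary: e)
  case Nil
  then have "e' = e" by auto
  then show ?case using assms(1) by simp
next
  case (Cons x xs)
  have "eval_fm M (e(x := e' x)) (exs xs p)" by (rule Cons.IH) (use Cons.prems in auto)
  then show ?case using Cons.prems by auto
qed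

lemma finite_tm_vars: "finite (tm_vars t)"
  by (induction t) auto

lemma finite_all_vars: "finite (all_vars p)"
  by (induction p) (auto simp: finite_tm_vars)

lemma free_vars_subset_all_vars: "free_vars p \<subseteq> all_vars p"
  by (induction p) auto

lemma finite_free_vars: "finite (free_vars p)"
  by (rule finite_subset[OF free_vars_subset_all_vars finite_all_vars])

lemma eval_tm_cong: "(\<And>n. n \<in> tm_vars t \<Longrightarrow> e n = e' n) \<Longrightarrow> eval_tm M e t = eval_tm M e' t"
proof (induction t)
  case (Fun f ts)
  then have "map (eval_tm M e) ts = map (eval_tm M e') ts" by force
  then show ?case by (metis eval_tm.simps(2))
qed simp

lemma eval_fm_cong: "(\<And>n. n \<in> free_vars p \<Longrightarrow> e n = e' n) \<Longrightarrow> eval_fm M e p = eval_fm M e' p"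
proof (induction p arbitrary: e e')
  case (Eq s t)
  then show ?case using eval_tm_cong[of s e e' M] eval_tm_cong[of t e e' M] by auto
next
  case (Rel r ts)
  have "map (eval_tm M e) ts = map (eval_tm M e') ts"
    using Rel by (auto intro!: eval_tm_cong)
  then show ?case by (metis eval_fm.simps(3))
next
  case (Imp p q)
  then show ?case by (metis UnI1 UnI2 eval_fm.simps(4) free_vars.simps(4))
next
  case (All n p)
  have "eval_fm M (e(n := a)) p = eval_fm M (e'(n := a)) p" for a
    by (rule All.IH) (use All.prems in auto)
  then show ?case by simp
qed simp

lemma sat_sentence_iff:
  assumes "free_vars p = {}" "\<forall>n. e n \<in> univ M"
  shows "sat M p \<longleftrightarrow> eval_fm M e p"
  using assms eval_fm_cong[of p] unfolding sat_def by blast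

lemma embedding_eval_tm:
  assumes "embedding L A B h" "closed_under L A (univ A)" "wf_tm L t" "\<forall>n\<in>tm_vars t. e n \<in> univ A"
  shows "eval_tm A e t \<in> univ A \<and> eval_tm B (h \<circ> e) t = h (eval_tm A e t)"
  using assms(3,4)
proof (induction t)
  case (Fun f ts)
  have IH: "eval_tm A e t \<in> univ A \<and> eval_tm B (h \<circ> e) t = h (eval_tm A e t)" if "t \<in> set ts" for t
    using Fun.IH[OF that] Fun.prems that by (simp add: list_all_iff comp_def)
  have f: "f \<in> funs L" "length (map (eval_tm A e) ts) = farity L f" using Fun by auto
  have "set (map (eval_tm A e) ts) \<subseteq> univ A" using IH by auto
  moreover have "map (eval_tm B (h \<circ> e)) ts = map h (map (eval_tm A e) ts)" using IH by auto
  ultimately show ?case using assms(1,2) f unfolding embedding_def closed_under_def eval_tm.simps comp_def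
    by (simp del: set_map map_map length_map)
qed simp

lemma embedding_eval_quantifier_free:
  assumes em: "embedding L A B h" and cl: "closed_under L A (univ A)"
    and "quantifier_free p" "wf_fm L p" "\<forall>n\<in>free_vars p. e n \<in> univ A"
  shows "eval_fm B (h \<circ> e) p = eval_fm A e p"
  using assms(3-)
proof (induction p)
  case (Eq s t)
  then have "eval_tm A e s \<in> univ A" "eval_tm A e t \<in> univ A"
    "eval_tm B (h \<circ> e) s = h (eval_tm A e s)" "eval_tm B (h \<circ> e) t = h (eval_tm A e t)"
    using embedding_eval_tm[OF em cl, of s e] embedding_eval_tm[OF em cl, of t e] by auto
  moreover have "inj_on h (univ A)" using em by (simp add: embedding_def)
  ultimately show ?case by (metis eval_fm.simps(2) inj_on_eq_iff)
next
  case (Rel r ts)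
  have IH: "eval_tm A e t \<in> univ A \<and> eval_tm B (h \<circ> e) t = h (eval_tm A e t)" if "t \<in> set ts" for t
    using Rel that embedding_eval_tm[OF em cl, of t e] by (auto simp: list_all_iff)
  have r: "r \<in> rels L" "length (map (eval_tm A e) ts) = rarity L r" using Rel by auto
  have "set (map (eval_tm A e) ts) \<subseteq> univ A" using IH by auto
  moreover have "map (eval_tm B (h \<circ> e)) ts = map h (map (eval_tm A e) ts)" using IH by auto
  ultimately show ?case using em r unfolding embedding_def eval_fm.simps
    by (simp del: set_map map_map length_map)
qed auto

lemma isomorphism_eval:
  assumes iso: "isomorphism L A B h" and cl: "closed_under L A (univ A)"
    and "wf_fm L p" "\<forall>n. e n \<in> univ A"
  shows "eval_fm B (h \<circ> e) p = eval_fm A e p"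
  using assms(3-)
proof (induction p arbitrary: e)
  case (All n p)
  have "eval_fm B ((h \<circ> e)(n := h a)) p = eval_fm A (e(n := a)) p" if "a \<in> univ A" for a
  proof -
    have "(h \<circ> e)(n := h a) = h \<circ> (e(n := a))" by auto
    moreover have "\<forall>m. (e(n := a)) m \<in> univ A" using All.prems that by simp
    ultimately show ?thesis using All.IH[of "e(n := a)"] All.prems by (metis wf_fm.simps(5))
  qed
  moreover have "univ B = h ` univ A" using iso by (simp add: isomorphism_def)
  ultimately show ?case by (simp add: comp_def)
next
  case (Eq s t)
  then show ?case using iso cl embedding_eval_quantifier_free[of L A B h "Eq s t" e] 
    by (simp add: isomorphism_def comp_def)
next
  case (Rel r ts)
  then show ?case using iso cl embedding_eval_quantifier_free[of L A B h "Rel r ts" e] 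
    by (simp add: isomorphism_def comp_def)
qed auto

lemma isomorphism_sat:
  assumes iso: "isomorphism L A B h" and st: "is_struct L A" and p: "sentence L p"
  shows "sat B p \<longleftrightarrow> sat A p"
proof -
  obtain a where "a \<in> univ A" using st by (auto simp: is_struct_def)
  moreover have "h a \<in> univ B" using calculation iso by (auto simp: isomorphism_def)
  ultimately show ?thesis
    using p isomorphism_eval[OF iso, of p "\<lambda>_. a"] st sat_sentence_iff[of p "\<lambda>_. a" A]
      sat_sentence_iff[of p "h \<circ> (\<lambda>_. a)" B]
    by (simp add: sentence_def is_struct_def)
qed

text \<open>Relations and functions act on lists, so elements of an image are pulled back a list at a
  time.\<close>
lemma list_in_image:
  assumes "set ys \<subseteq> h ` A"
  obtains xs where "set xs \<subseteq> A" "ys = map h xs"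
proof -
  have "ys \<in> lists (h ` A)" using assms by auto
  then show ?thesis using that by (auto simp: lists_image)
qed

lemma isomorphism_is_struct:
  assumes iso: "isomorphism L A B h" and st: "is_struct L A"
  shows "is_struct L B"
proof -
  have "func B f ys \<in> univ B" if f: "f \<in> funs L" "length ys = farity L f" "set ys \<subseteq> univ B" for f ys
  proof -
    have "set ys \<subseteq> h ` univ A" using iso that by (simp add: isomorphism_def)
    then obtain xs where xs: "set xs \<subseteq> univ A" "ys = map h xs"
      by (rule list_in_image)
    have "length xs = farity L f" using f(2) xs(2) by simp
    then have "func A f xs \<in> univ A" "h (func A f xs) = func B f ys"
      using iso st f(1) xs by (auto simp: isomorphism_def embedding_def is_struct_def closed_under_def)
    then show ?thesis using iso by (metis imageI isomorphism_def)
  qed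
  moreover have "univ B \<noteq> {}" using iso st by (auto simp: isomorphism_def is_struct_def)
  ultimately show ?thesis by (auto simp: is_struct_def closed_under_def)
qed

lemma isomorphism_model_of:
  assumes iso: "isomorphism L A B h" and m: "model_of L A T" and T: "\<forall>p\<in>T. sentence L p"
  shows "model_of L B T"
  using isomorphism_is_struct[OF iso] isomorphism_sat[OF iso] m T by (auto simp: model_of_def)

text \<open>A failure of a quantifier-free formula in \<open>A\<close> is a failure at the image point in \<open>B\<close>.\<close>
lemma embedding_model_of_universal:
  assumes em: "embedding L A B h" and st: "is_struct L A" and m: "model_of L B T" 
    and u: "universal_theory L T"
  shows "model_of L A T"
proof -
  have "sat A p" if "p \<in> T" for p
  proof -
    obtain ys q where q: "p = foralls ys q" "quantifier_free q" "wf_fm L q"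
      using u \<open>p \<in> T\<close> unfolding universal_theory_def by blast
    have sB: "sat B q" using m that q(1) by (auto simp: model_of_def)
    have "eval_fm A e q" if e: "\<forall>n. e n \<in> univ A" for e
    proof -
      have "\<forall>n. (h \<circ> e) n \<in> univ B" using em e by (auto simp: embedding_def)
      then have "eval_fm B (h \<circ> e) q" using sB unfolding sat_def by blast
      then show ?thesis
        using embedding_eval_quantifier_free[OF em _ q(2,3), of e] st e by (auto simp: is_struct_def)
    qed
    then have "sat A q" by (simp add: sat_def)
    then show ?thesis by (simp add: q(1))
  qed
  then show ?thesis using st by (simp add: model_of_def)
qed

lemma embedding_comp:
  assumes "embedding L A B g" "embedding L B C h"
  shows "embedding L A C (h \<circ> g)"
proof -
  have im: "g ` univ A \<subseteq> univ B" "h ` univ B \<subseteq> univ C" using assms by (auto simp: embedding_def)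
  have sub: "set (map g xs) \<subseteq> univ B" if "set xs \<subseteq> univ A" for xs using that im by auto
  show ?thesis unfolding embedding_def
  proof (intro conjI ballI allI impI)
    show "(h \<circ> g) ` univ A \<subseteq> univ C" using im by auto
    have "inj_on h (g ` univ A)" using assms(2) im(1) by (auto simp: embedding_def intro: inj_on_subset)
    then show "inj_on (h \<circ> g) (univ A)" using assms(1) by (simp add: embedding_def comp_inj_on)
  next
    fix f xs assume "f \<in> funs L" "length xs = farity L f \<and> set xs \<subseteq> univ A"
    then show "(h \<circ> g) (func A f xs) = func C f (map (h \<circ> g) xs)"
      using assms sub[of xs] by (simp add: embedding_def del: set_map)
  next
    fix r xs assume "r \<in> rels L" "length xs = rarity L r \<and> set xs \<subseteq> univ A"
    then show "relation A r xs = relation C r (map (h \<circ> g) xs)"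
      using assms sub[of xs] by (simp add: embedding_def del: set_map)
  qed
qed

lemma embedding_inclusion: "S \<subseteq> univ M \<Longrightarrow> embedding L (M\<lparr>univ := S\<rparr>) M id"
  by (auto simp: embedding_def)

lemma embedding_closed_image:
  assumes "embedding L A B h" "closed_under L A (univ A)"
  shows "closed_under L B (h ` univ A)"
  unfolding closed_under_def
proof (intro ballI allI impI)
  fix f ys assume f: "f \<in> funs L" "length ys = farity L f \<and> set ys \<subseteq> h ` univ A"
  then have "set ys \<subseteq> h ` univ A" by simp
  then obtain xs where xs: "set xs \<subseteq> univ A" "ys = map h xs"
    by (rule list_in_image)
  then have "func A f xs \<in> univ A" "h (func A f xs) = func B f ys"
    using assms f by (auto simp: embedding_def closed_under_def)
  then show "func B f ys \<in> h ` univ A" by (metis imageI)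
qed

lemma embedding_inverse:
  assumes em: "embedding L A B h" and cl: "closed_under L A (univ A)"
  shows "embedding L (B\<lparr>univ := h ` univ A\<rparr>) A (inv_into (univ A) h)"
proof -
  have inj: "inj_on h (univ A)" using em by (simp add: embedding_def)
  have inv: "inv_into (univ A) h (h x) = x" if "x \<in> univ A" for x using inj that by simp
  have list: "\<exists>xs. set xs \<subseteq> univ A \<and> ys = map h xs" if "set ys \<subseteq> h ` univ A" for ys
    using that list_in_image by metis
  have minv: "map (inv_into (univ A) h) (map h xs) = xs" if "set xs \<subseteq> univ A" for xs
    using that inv by (simp add: map_idI subset_iff)
  show ?thesis unfolding embedding_def
  proof (intro conjI ballI allI impI)
    show "inv_into (univ A) h ` univ (B\<lparr>univ := h ` univ A\<rparr>) \<subseteq> univ A" using inv by auto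
    show "inj_on (inv_into (univ A) h) (univ (B\<lparr>univ := h ` univ A\<rparr>))" by (simp add: inj_on_inv_into)
  next
    fix f ys assume f: "f \<in> funs L" "length ys = farity L f \<and> set ys \<subseteq> univ (B\<lparr>univ := h ` univ A\<rparr>)"
    then obtain xs where xs: "set xs \<subseteq> univ A" "ys = map h xs" using list by auto
    then have "func A f xs \<in> univ A" "h (func A f xs) = func B f ys"
      using em cl f by (auto simp: embedding_def closed_under_def)
    then show "inv_into (univ A) h (func (B\<lparr>univ := h ` univ A\<rparr>) f ys)
      = func A f (map (inv_into (univ A) h) ys)"
      using minv[OF xs(1)] xs(2) inv by (simp del: map_map) (metis inv)
  next
    fix r ys assume r: "r \<in> rels L" "length ys = rarity L r \<and> set ys \<subseteq> univ (B\<lparr>univ := h ` univ A\<rparr>)"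
    then obtain xs where xs: "set xs \<subseteq> univ A" "ys = map h xs" using list by auto
    then show "relation (B\<lparr>univ := h ` univ A\<rparr>) r ys = relation A r (map (inv_into (univ A) h) ys)"
      using minv[OF xs(1)] em r by (simp add: embedding_def del: map_map)
  qed
qed

section \<open>The downward Loewenheim-Skolem theorem\<close>

instance tm :: (countable) countable by countable_datatype
instance fm :: (countable, countable) countable by countable_datatype

lemma set_tm_wf: "wf_tm L t \<Longrightarrow> set_tm t \<subseteq> funs L"
  by (induction t) (auto simp: list_all_iff)

lemma set_fm_wf: "wf_fm L p \<Longrightarrow> set1_fm p \<subseteq> funs L \<and> set2_fm p \<subseteq> rels L"
  by (induction p) (fastforce simp: list_all_iff dest: set_tm_wf)+

text \<open>Only the symbols of the language are countably many, not the whole types of symbols;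
  injections of the former into the natural numbers reduce the claim to formulas over
  countable types.\<close>
lemma countable_wf_fm:
  assumes "countable (funs L)" "countable (rels L)"
  shows "countable {p. wf_fm L p}"
proof -
  let ?h = "map_fm (to_nat_on (funs L)) (to_nat_on (rels L))"
  have "inj_on ?h {p. wf_fm L p}"
  proof (rule inj_onI)
    fix p q assume "p \<in> {p. wf_fm L p}" "q \<in> {p. wf_fm L p}" "?h p = ?h q"
    moreover have "inj_on (to_nat_on (funs L)) (funs L)" "inj_on (to_nat_on (rels L)) (rels L)"
      using assms by auto
    ultimately show "p = q" using set_fm_wf[of L p] set_fm_wf[of L q]
      by (intro fm.inj_map_strong[of p q "to_nat_on (funs L)" "to_nat_on (funs L)"
            "to_nat_on (rels L)" "to_nat_on (rels L)"]) (auto dest: inj_onD)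
  qed
  then show ?thesis by (rule countableI')
qed

lemma countable_copy:
  fixes A :: "('f, 'r, 'a) struct"
  assumes "countable (univ A)" and st: "closed_under L A (univ A)"
  shows "\<exists>(B :: ('f, 'r, nat) struct) h. isomorphism L A B h"
proof -
  let ?h = "to_nat_on (univ A)" let ?g = "from_nat_into (univ A)"
  let ?B = "\<lparr>univ = ?h ` univ A, func = (\<lambda>f xs. ?h (func A f (map ?g xs))),
    relation = (\<lambda>r xs. relation A r (map ?g xs))\<rparr>"
  have inv: "map ?g (map ?h xs) = xs" if "set xs \<subseteq> univ A" for xs
    using that assms(1) by (induction xs) auto
  have "embedding L A ?B ?h"
    using assms(1) inv unfolding embedding_def by (auto simp del: map_map)
  then have "isomorphism L A ?B ?h" by (simp add: isomorphism_def)
  then show ?thesis by blast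
qed

text \<open>The closure of a point under witnesses for the true existential formulas. Since a formula
  has finitely many free variables, its parameters can be given by a finite list, which
  keeps the closure countable. By the Tarski-Vaught criterion it is elementary.\<close>
lemma countable_elementary_substructure:
  fixes M :: "('f, 'r, 'a) struct"
  assumes st: "is_struct L M" and c: "countable (funs L)" "countable (rels L)"
  obtains S where "countable S" "S \<noteq> {}" "S \<subseteq> univ M" "closed_under L M S"
    "\<And>p e. wf_fm L p \<Longrightarrow> (\<And>n. e n \<in> S) \<Longrightarrow> eval_fm (M\<lparr>univ := S\<rparr>) e p = eval_fm M e p"
proof -
  obtain m0 where m0: "m0 \<in> univ M" using st by (auto simp: is_struct_def)
  \<comment> \<open>the default \<open>m0\<close> fills up the valuation at the variables that are not parameters\<close>
  define val where "val xs i = (if i < length xs then xs ! i else m0)" for xs and i :: nat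
  define wit where "wit = (\<lambda>(p, n, xs). if \<exists>a\<in>univ M. eval_fm M ((val xs)(n := a)) p
    then SOME a. a \<in> univ M \<and> eval_fm M ((val xs)(n := a)) p else m0)"
  have wit: "wit (p, n, xs) \<in> univ M" 
    "(\<exists>a\<in>univ M. eval_fm M ((val xs)(n := a)) p) \<Longrightarrow> eval_fm M ((val xs)(n := wit (p, n, xs))) p" for p n xs
    using m0 unfolding wit_def by (auto intro: someI2_ex)
  define C where "C = rec_nat {m0} (\<lambda>_ S. S \<union> wit ` ({p. wf_fm L p} \<times> UNIV \<times> lists S))"
  have C0: "C 0 = {m0}" and CS: "C (Suc k) = C k \<union> wit ` ({p. wf_fm L p} \<times> UNIV \<times> lists (C k))" for k
    by (simp_all add: C_def)
  define S where "S = (\<Union>k. C k)"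
  have cC: "countable (C k)" for k
    by (induction k) (use countable_wf_fm[OF c] in \<open>auto simp: C0 CS intro!: countable_lists\<close>)
  have sC: "C k \<subseteq> univ M" for k
    by (induction k) (use m0 wit(1) in \<open>auto simp: C0 CS\<close>)
  have mono: "C i \<subseteq> C j" if "i \<le> j" for i j
    using lift_Suc_mono_le[of C i j] that CS by blast
  have listS: "\<exists>k. set xs \<subseteq> C k" if "set xs \<subseteq> S" for xs
    using that
  proof (induction xs)
    case (Cons x xs)
    then obtain i j where "set xs \<subseteq> C i" "x \<in> C j" by (auto simp: S_def)
    then have "set (x # xs) \<subseteq> C (max i j)" using mono[of i "max i j"] mono[of j "max i j"] by auto
    then show ?case by blast
  qed simp
  have witS: "wit (p, n, xs) \<in> S" if "wf_fm L p" "set xs \<subseteq> S" for p n xs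
  proof -
    obtain k where "set xs \<subseteq> C k" using listS \<open>set xs \<subseteq> S\<close> by blast
    then have "wit (p, n, xs) \<in> C (Suc k)" using that by (auto simp: CS)
    then show ?thesis by (auto simp: S_def)
  qed
  have tv: "\<exists>a\<in>S. eval_fm M (e(n := a)) p"
    if p: "wf_fm L p" and e: "\<forall>n. e n \<in> S" and ex: "\<exists>a\<in>univ M. eval_fm M (e(n := a)) p" for p e n
  proof -
    obtain k where k: "\<forall>i\<in>free_vars p. i < k"
      using finite_nat_set_iff_bounded finite_free_vars by blast
    define xs where "xs = map e [0..<k]"
    have eq: "eval_fm M ((val xs)(n := a)) p = eval_fm M (e(n := a)) p" for a
      by (rule eval_fm_cong) (use k in \<open>auto simp: val_def xs_def\<close>)
    have "wit (p, n, xs) \<in> S" by (rule witS) (use p e in \<open>auto simp: xs_def\<close>)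
    moreover have "eval_fm M ((val xs)(n := wit (p, n, xs))) p" 
      by (rule wit(2)) (use ex eq in blast)
    ultimately show ?thesis using eq by blast
  qed
  have cl: "closed_under L M S" unfolding closed_under_def
  proof (intro ballI allI impI)
    fix f xs assume f: "f \<in> funs L" "length xs = farity L f \<and> set xs \<subseteq> S"
    let ?k = "length xs"
    \<comment> \<open>the only witness of this formula is the value of \<open>f\<close>\<close>
    let ?p = "Eq (Var ?k) (Fun f (map Var [0..<?k]))"
    have "map (eval_tm M ((val xs)(?k := a))) (map Var [0..<?k]) = xs" for a
      by (rule nth_equalityI) (simp_all add: val_def)
    then have ev: "eval_fm M ((val xs)(?k := a)) ?p \<longleftrightarrow> a = func M f xs" for a
      by (simp del: map_map)
    have "set xs \<subseteq> univ M" using f sC by (force simp: S_def)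
    then have "func M f xs \<in> univ M" using f st by (simp add: is_struct_def closed_under_def)
    then have "\<exists>a\<in>univ M. eval_fm M ((val xs)(?k := a)) ?p" unfolding ev by blast
    then have "eval_fm M ((val xs)(?k := wit (?p, ?k, xs))) ?p" by (rule wit(2))
    then have "wit (?p, ?k, xs) = func M f xs" by (simp only: ev)
    moreover have "wit (?p, ?k, xs) \<in> S" by (rule witS) (use f in \<open>auto simp: list_all_iff\<close>)
    ultimately show "func M f xs \<in> S" by simp
  qed
  have tm: "eval_tm (M\<lparr>univ := S\<rparr>) e = eval_tm M e" for e
  proof
    show "eval_tm (M\<lparr>univ := S\<rparr>) e u = eval_tm M e u" for u by (induction u) (simp_all cong: map_cong)
  qed
  have el: "eval_fm (M\<lparr>univ := S\<rparr>) e p = eval_fm M e p" if "wf_fm L p" "\<forall>n. e n \<in> S" for p e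
    using that
  proof (induction p arbitrary: e)
    case (All n p)
    have "S \<subseteq> univ M" using sC by (auto simp: S_def)
    moreover have "eval_fm (M\<lparr>univ := S\<rparr>) (e(n := a)) p = eval_fm M (e(n := a)) p" if "a \<in> S" for a
      by (rule All.IH) (use All.prems that in simp_all)
    moreover have "\<exists>a\<in>S. eval_fm M (e(n := a)) (Neg p)" if "\<exists>a\<in>univ M. eval_fm M (e(n := a)) (Neg p)"
      by (rule tv) (use All.prems that in simp_all)
    ultimately show ?case unfolding eval_fm.simps by (simp del: fun_upd_apply) (meson subsetD)
  next
    case (Eq s t)
    show ?case by (simp add: tm)
  next
    case (Rel r ts)
    show ?case by (simp add: tm)
  qed auto
  show ?thesis
  proof (rule that[of S])
    show "countable S" using cC by (auto simp: S_def)
    show "S \<noteq> {}" using C0 by (auto simp: S_def)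
    show "S \<subseteq> univ M" using sC by (auto simp: S_def)
    show "closed_under L M S" by (rule cl)
    show "eval_fm (M\<lparr>univ := S\<rparr>) e p = eval_fm M e p" if "wf_fm L p" "\<And>n. e n \<in> S" for p e
      by (rule el) (use that in blast)+
  qed
qed

lemma downward_Loewenheim_Skolem:
  fixes M :: "('f, 'r, 'a) struct"
  assumes st: "is_struct L M" and c: "countable (funs L)" "countable (rels L)"
  obtains N :: "('f, 'r, nat) struct"
  where "is_struct L N" "\<And>p. sentence L p \<Longrightarrow> sat N p = sat M p"
proof -
  obtain S where S: "countable S" "S \<noteq> {}" "S \<subseteq> univ M" "closed_under L M S"
    "\<And>p e. wf_fm L p \<Longrightarrow> (\<And>n. e n \<in> S) \<Longrightarrow> eval_fm (M\<lparr>univ := S\<rparr>) e p = eval_fm M e p"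
    by (rule countable_elementary_substructure[OF assms]) (assumption | blast)
  let ?S = "M\<lparr>univ := S\<rparr>"
  have stS: "is_struct L ?S" using S(2,4) by (auto simp: is_struct_def closed_under_def)
  obtain N :: "('f, 'r, nat) struct" and h where N: "isomorphism L ?S N h"
    using countable_copy[of ?S L] S(1) stS by (auto simp: is_struct_def)
  obtain a where a: "a \<in> S" using S(2) by blast
  have "sat ?S p = sat M p" if "sentence L p" for p
    using that sat_sentence_iff[of p "\<lambda>_. a" M] sat_sentence_iff[of p "\<lambda>_. a" ?S] S(3) S(5)[of p "\<lambda>_. a"] a
    by (auto simp: sentence_def)
  then show ?thesis using that isomorphism_is_struct[OF N stS] isomorphism_sat[OF N stS] by blast
qed

section \<open>Back and forth between rich structures\<close>

text \<open>The extension property that characterizes countable Fraisse limits without mentioning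
  automorphisms. The finite set \<open>S\<close> may be empty, so that all members of \<open>K\<close> embed into a
  rich structure.\<close>
definition rich ::
  "('f, 'r) lang \<Rightarrow> ('f, 'r, nat) struct set \<Rightarrow> ('f, 'r, 'a) struct \<Rightarrow> bool" where
  "rich L K M \<longleftrightarrow> (\<forall>B\<in>K. \<forall>S h. finite S \<and> S \<subseteq> univ M \<and> closed_under L M S \<and>
     embedding L (M\<lparr>univ := S\<rparr>) B h \<longrightarrow> (\<exists>g. embedding L B M g \<and> (\<forall>x\<in>S. g (h x) = x)))"

text \<open>In a relational language \<open>S\<close> can be \<open>X\<close> itself; in a tree, \<open>X\<close> has to be closed under meets
  first.\<close>
definition locally_in ::
  "('f, 'r) lang \<Rightarrow> ('f, 'r, 'a) struct set \<Rightarrow> ('f, 'r, 'a) struct \<Rightarrow> bool" where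
  "locally_in L K M \<longleftrightarrow> (\<forall>X. finite X \<and> X \<noteq> {} \<and> X \<subseteq> univ M \<longrightarrow>
     (\<exists>S. X \<subseteq> S \<and> S \<subseteq> univ M \<and> finite S \<and> closed_under L M S \<and> M\<lparr>univ := S\<rparr> \<in> K))"

lemma closed_under_update [simp]: "closed_under L (M\<lparr>univ := U\<rparr>) S = closed_under L M S"
  by (simp add: closed_under_def)

lemma richE:
  assumes "rich L K M" "B \<in> K" "finite S" "S \<subseteq> univ M" "closed_under L M S"
    "embedding L (M\<lparr>univ := S\<rparr>) B h"
  obtains g where "embedding L B M g" "\<And>x. x \<in> S \<Longrightarrow> g (h x) = x"
proof -
  have "\<exists>g. embedding L B M g \<and> (\<forall>x\<in>S. g (h x) = x)"
    using assms(1-6) by (simp add: rich_def)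
  then show ?thesis using that by blast
qed

lemma locally_inE:
  assumes "locally_in L K M" "finite X" "X \<noteq> {}" "X \<subseteq> univ M"
  obtains S where "X \<subseteq> S" "S \<subseteq> univ M" "finite S" "closed_under L M S" "M\<lparr>univ := S\<rparr> \<in> K"
proof -
  have "\<exists>S. X \<subseteq> S \<and> S \<subseteq> univ M \<and> finite S \<and> closed_under L M S \<and> M\<lparr>univ := S\<rparr> \<in> K"
    using assms(1-4) by (simp add: locally_in_def)
  then show ?thesis using that by blast
qed

text \<open>The codomain is not recorded: it is \<open>h ` S\<close>, which is again closed.\<close>
definition partial_iso ::
  "('f, 'r) lang \<Rightarrow> ('f, 'r, 'a) struct \<Rightarrow> ('f, 'r, 'b) struct \<Rightarrow> 'a set \<Rightarrow> ('a \<Rightarrow> 'b) \<Rightarrow> bool" where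
  "partial_iso L M N S h \<longleftrightarrow>
     finite S \<and> S \<subseteq> univ M \<and> closed_under L M S \<and> embedding L (M\<lparr>univ := S\<rparr>) N h"

lemma partial_iso_inverse:
  assumes "partial_iso L M N S h"
  shows "partial_iso L N M (h ` S) (inv_into S h)" 
    "embedding L (N\<lparr>univ := h ` S\<rparr>) (M\<lparr>univ := S\<rparr>) (inv_into S h)"
    "x \<in> S \<Longrightarrow> inv_into S h (h x) = x"
proof -
  have em: "embedding L (M\<lparr>univ := S\<rparr>) N h" and cl: "closed_under L M S" and S: "S \<subseteq> univ M" "finite S"
    using assms by (auto simp: partial_iso_def)
  show 1: "embedding L (N\<lparr>univ := h ` S\<rparr>) (M\<lparr>univ := S\<rparr>) (inv_into S h)"
    using embedding_inverse[OF em] cl by simp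
  have "closed_under L N (h ` S)" using embedding_closed_image[OF em] cl by simp
  moreover have "h ` S \<subseteq> univ N" using em by (auto simp: embedding_def)
  moreover have "embedding L (N\<lparr>univ := h ` S\<rparr>) M (inv_into S h)"
    using embedding_comp[OF 1 embedding_inclusion[OF S(1)]] by simp
  ultimately show "partial_iso L N M (h ` S) (inv_into S h)" using S by (simp add: partial_iso_def)
  show "x \<in> S \<Longrightarrow> inv_into S h (h x) = x" using em by (simp add: embedding_def)
qed

lemma embedding_extend_codomain:
  "embedding L A (N\<lparr>univ := T\<rparr>) h \<Longrightarrow> T \<subseteq> univ N \<Longrightarrow> embedding L A N h"
  by (auto simp: embedding_def)

lemma embedding_change_codomain:
  "embedding L A N h \<Longrightarrow> h ` univ A \<subseteq> T \<Longrightarrow> embedding L A (N\<lparr>univ := T\<rparr>) h"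
  by (auto simp: embedding_def)

text \<open>The inverse of \<open>h\<close> embeds \<open>h(S)\<close> into a finite substructure around \<open>a\<close>, and the richness of
  \<open>N\<close> inverts it.\<close>
lemma partial_iso_forth:
  assumes p: "partial_iso L M N S h" and r: "rich L K N" and l: "locally_in L K M" and a: "a \<in> univ M"
  shows "\<exists>S' h'. partial_iso L M N S' h' \<and> S \<subseteq> S' \<and> a \<in> S' \<and> (\<forall>x\<in>S. h' x = h x)"
proof -
  obtain S' where S': "insert a S \<subseteq> S'" "S' \<subseteq> univ M" "finite S'" "closed_under L M S'" "M\<lparr>univ := S'\<rparr> \<in> K"
    by (rule locally_inE[OF l, of "insert a S"]) (use p a in \<open>auto simp: partial_iso_def\<close>)
  note i = partial_iso_inverse[OF p]
  have "embedding L (N\<lparr>univ := h ` S\<rparr>) (M\<lparr>univ := S'\<rparr>) (inv_into S h)"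
  proof -
    have "inv_into S h ` h ` S \<subseteq> S'" using S'(1) i(3) by auto
    moreover have "embedding L (N\<lparr>univ := h ` S\<rparr>) M (inv_into S h)"
      using i(1) by (simp add: partial_iso_def)
    ultimately show ?thesis using embedding_change_codomain[of L "N\<lparr>univ := h ` S\<rparr>" M _ S'] by simp
  qed
  with i(1) obtain g where g: "embedding L (M\<lparr>univ := S'\<rparr>) N g" "\<And>y. y \<in> h ` S \<Longrightarrow> g (inv_into S h y) = y"
    using richE[OF r S'(5), of "h ` S" "inv_into S h"] unfolding partial_iso_def by blast
  have "\<forall>x\<in>S. g x = h x" using g(2) i(3) by force
  then show ?thesis using g(1) S' by (intro exI[of _ S'] exI[of _ g]) (auto simp: partial_iso_def)
qed

text \<open>This is the forth step for the inverse partial isomorphism.\<close>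
lemma partial_iso_back:
  assumes p: "partial_iso L M N S h" and r: "rich L K M" and l: "locally_in L K N" and b: "b \<in> univ N"
  shows "\<exists>S' h'. partial_iso L M N S' h' \<and> S \<subseteq> S' \<and> b \<in> h' ` S' \<and> (\<forall>x\<in>S. h' x = h x)"
proof -
  obtain T g where T: "partial_iso L N M T g" "h ` S \<subseteq> T" "b \<in> T" "\<forall>y\<in>h ` S. g y = inv_into S h y"
    using partial_iso_forth[OF partial_iso_inverse(1)[OF p] r l b] by blast
  note i = partial_iso_inverse[OF p] and j = partial_iso_inverse[OF T(1)]
  have g: "g (h x) = x" if "x \<in> S" for x using that i(3) T(4) by auto
  show ?thesis
  proof (intro exI conjI)
    show "partial_iso L M N (g ` T) (inv_into T g)" by (rule j(1))
    show "S \<subseteq> g ` T" using g T(2) by force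
    show "b \<in> inv_into T g ` g ` T" using j(3) T(3) by force
    show "\<forall>x\<in>S. inv_into T g x = h x" using g T(2) j(3) by (metis imageI subsetD)
  qed
qed

lemma partial_iso_step:
  fixes M N :: "('f, 'r, nat) struct"
  assumes p: "partial_iso L M N S h" and "rich L K M" "rich L K N" "locally_in L K M" "locally_in L K N"
  shows "\<exists>S' h'. partial_iso L M N S' h' \<and> S \<subseteq> S' \<and> (\<forall>x\<in>S. h' x = h x) \<and>
    (n \<in> univ M \<longrightarrow> n \<in> S') \<and> (n \<in> univ N \<longrightarrow> n \<in> h' ` S')"
proof -
  obtain S1 h1 where 1: "partial_iso L M N S1 h1" "S \<subseteq> S1" "\<forall>x\<in>S. h1 x = h x" "n \<in> univ M \<longrightarrow> n \<in> S1"
  proof (cases "n \<in> univ M")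
    case True
    then show ?thesis using partial_iso_forth[OF p assms(3,4) True] that by blast
  next
    case False
    then show ?thesis using p that[of S h] by blast
  qed
  obtain S2 h2 where 2: "partial_iso L M N S2 h2" "S1 \<subseteq> S2" "\<forall>x\<in>S1. h2 x = h1 x" "n \<in> univ N \<longrightarrow> n \<in> h2 ` S2"
  proof (cases "n \<in> univ N")
    case True
    then show ?thesis using partial_iso_back[OF 1(1) assms(2,5) True] that by blast
  next
    case False
    then show ?thesis using 1(1) that[of S1 h1] by blast
  qed
  show ?thesis
    by (rule exI[of _ S2], rule exI[of _ h2]) (use 1 2 in auto)
qed

text \<open>Both universes are sets of natural numbers, so stage \<open>n\<close> of the construction has to put only
  \<open>n\<close> into the domain and into the range.\<close>
theorem back_and_forth:
  fixes M N :: "('f, 'r, nat) struct"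
  assumes p: "partial_iso L M N S h" and r: "rich L K M" "rich L K N" "locally_in L K M" "locally_in L K N"
  obtains g where "isomorphism L M N g" "\<And>x. x \<in> S \<Longrightarrow> g x = h x"
proof -
  define P where "P = (\<lambda>x :: nat set \<times> (nat \<Rightarrow> nat). partial_iso L M N (fst x) (snd x) \<and> S \<subseteq> fst x \<and> (\<forall>s\<in>S. snd x s = h s))"
  define Q where "Q = (\<lambda>n (x :: nat set \<times> (nat \<Rightarrow> nat)) y. fst x \<subseteq> fst y \<and> (\<forall>s\<in>fst x. snd y s = snd x s) \<and>
    (n \<in> univ M \<longrightarrow> n \<in> fst y) \<and> (n \<in> univ N \<longrightarrow> n \<in> snd y ` fst y))"
  have "\<exists>f. \<forall>n. P (f n) \<and> Q n (f n) (f (Suc n))"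
  proof (rule dependent_nat_choice)
    show "\<exists>x. P x" using p by (intro exI[of _ "(S, h)"]) (simp add: P_def)
    fix x n assume x: "P x"
    then obtain S' h' where "partial_iso L M N S' h'" "fst x \<subseteq> S'" "\<forall>s\<in>fst x. h' s = snd x s"
      "n \<in> univ M \<longrightarrow> n \<in> S'" "n \<in> univ N \<longrightarrow> n \<in> h' ` S'"
      using partial_iso_step[OF _ r, of "fst x" "snd x" n] unfolding P_def by blast
    then show "\<exists>y. P y \<and> Q n x y" using x
      by (intro exI[of _ "(S', h')"]) (auto simp: P_def Q_def)
  qed
  then obtain f where f: "\<And>n. P (f n)" "\<And>n. Q n (f n) (f (Suc n))" by blast
  define D where "D n = fst (f n)" for n
  define k where "k n = snd (f n)" for n
  have pi: "partial_iso L M N (D n) (k n)" and k0: "S \<subseteq> D n" "s \<in> S \<Longrightarrow> k n s = h s" for n s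
    using f(1)[of n] by (auto simp: P_def D_def k_def)
  have QS: "D n \<subseteq> D (Suc n)" "s \<in> D n \<Longrightarrow> k (Suc n) s = k n s" for n s
    using f(2)[of n] by (auto simp: Q_def D_def k_def)
  have mono: "D i \<subseteq> D j" if "i \<le> j" for i j by (rule lift_Suc_mono_le[of D i j, OF QS(1) that])
  have kmono: "k j s = k i s" if "i \<le> j" "s \<in> D i" for i j s
    using that(1)
  proof (induction j rule: dec_induct)
    case (step n)
    then show ?case using QS(2)[of s n] mono[of i n] that(2) by auto
  qed simp
  define g where "g x = k (Suc x) x" for x
  have inD: "x \<in> D (Suc x)" if "x \<in> univ M" for x
    using f(2)[of x] that by (auto simp: Q_def D_def)
  have DM: "D n \<subseteq> univ M" for n using pi by (auto simp: partial_iso_def)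
  have gk: "g x = k n x" if "x \<in> D n" for x n
    using kmono[of n "max n (Suc x)" x] kmono[of "Suc x" "max n (Suc x)" x] that inD[of x] DM[of n]
    by (auto simp: g_def)
  have list: "set xs \<subseteq> D (Suc (Max (insert 0 (set xs))))" if "set xs \<subseteq> univ M" for xs
  proof
    fix x assume x: "x \<in> set xs"
    then have "D (Suc x) \<subseteq> D (Suc (Max (insert 0 (set xs))))" by (intro mono) simp
    then show "x \<in> D (Suc (Max (insert 0 (set xs))))" using inD x that by blast
  qed
  have mapk: "map g xs = map (k n) xs" if "set xs \<subseteq> D n" for xs n
    using that gk by (meson map_eq_conv subsetD)
  have em: "embedding L (M\<lparr>univ := D n\<rparr>) N (k n)" and cl: "closed_under L M (D n)" for n
    using pi by (auto simp: partial_iso_def)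
  have "embedding L M N g" unfolding embedding_def
  proof (intro conjI ballI allI impI)
    show "g ` univ M \<subseteq> univ N"
    proof
      fix y assume "y \<in> g ` univ M"
      then obtain x where "x \<in> univ M" "y = k (Suc x) x" by (auto simp: g_def)
      then show "y \<in> univ N" using em[of "Suc x"] inD[of x] by (auto simp: embedding_def)
    qed
    show "inj_on g (univ M)"
    proof (rule inj_onI)
      fix x y assume xy: "x \<in> univ M" "y \<in> univ M" "g x = g y"
      obtain n where n: "x \<in> D n" "y \<in> D n" using list[of "[x, y]"] xy by auto
      then have "k n x = k n y" using xy(3) gk by simp
      then show "x = y" using em[of n] n by (auto simp: embedding_def dest: inj_onD)
    qed
  next
    fix F xs assume F: "F \<in> funs L" "length xs = farity L F \<and> set xs \<subseteq> univ M"
    then obtain n where n: "set xs \<subseteq> D n" using list by blast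
    then have "func M F xs \<in> D n" using cl[of n] F by (auto simp: closed_under_def)
    then show "g (func M F xs) = func N F (map g xs)"
      using em[of n] F n gk mapk[OF n] by (simp add: embedding_def del: map_eq_conv)
  next
    fix r xs assume r: "r \<in> rels L" "length xs = rarity L r \<and> set xs \<subseteq> univ M"
    then obtain n where n: "set xs \<subseteq> D n" using list by blast
    then show "relation M r xs = relation N r (map g xs)"
      using em[of n] r n mapk[OF n] by (simp add: embedding_def del: map_eq_conv)
  qed
  moreover have "univ N \<subseteq> g ` univ M"
  proof
    fix b assume "b \<in> univ N"
    then obtain x where x: "x \<in> D (Suc b)" "b = k (Suc b) x" using f(2)[of b] by (auto simp: Q_def D_def k_def)
    then have "b = g x" using gk by simp
    then show "b \<in> g ` univ M" using x(1) DM by blast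
  qed
  ultimately have "isomorphism L M N g" by (auto simp: isomorphism_def embedding_def)
  moreover have "g x = h x" if "x \<in> S" for x using gk[of x 0] k0(1)[of 0] k0(2)[of x 0] that by auto
  ultimately show ?thesis by (rule that)
qed

text \<open>Induction on the number of points of \<open>B\<close> that are not yet reached. In the language of trees
  not every point can be added alone, hence the hypothesis that closed subsets of members of
  \<open>K\<close> grow by a suitable point.\<close>
lemma rich_of_one_point_extensions:
  assumes fin: "\<And>B. B \<in> K \<Longrightarrow> finite (univ B)"
    and grow: "\<And>B T. B \<in> K \<Longrightarrow> T \<subset> univ B \<Longrightarrow> closed_under L B T \<Longrightarrow>
      \<exists>b\<in>univ B - T. closed_under L B (insert b T) \<and> B\<lparr>univ := insert b T\<rparr> \<in> K"
    and one: "\<And>B S h b. B \<in> K \<Longrightarrow> partial_iso L M B S h \<Longrightarrow> b \<in> univ B \<Longrightarrow> b \<notin> h ` S \<Longrightarrow>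
      univ B = insert b (h ` S) \<Longrightarrow> \<exists>g. embedding L B M g \<and> (\<forall>x\<in>S. g (h x) = x)"
  shows "rich L K M"
proof -
  have "\<exists>g. embedding L B M g \<and> (\<forall>x\<in>S. g (h x) = x)" if B: "B \<in> K" and "partial_iso L M B S h" for B S h
    using that(2)
  proof (induction "card (univ B - h ` S)" arbitrary: S h rule: less_induct)
    case less
    note i = partial_iso_inverse[OF less.prems]
    show ?case
    proof (cases "univ B = h ` S")
      case True
      then have "B = B\<lparr>univ := h ` S\<rparr>" by simp
      then have "embedding L B M (inv_into S h)" using i(1) by (simp add: partial_iso_def)
      then show ?thesis using i(3) by blast
    next
      case False
      then have "h ` S \<subset> univ B" using less.prems by (auto simp: partial_iso_def embedding_def)
      moreover have "closed_under L B (h ` S)" using i(1) by (simp add: partial_iso_def)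
      ultimately obtain b where b: "b \<in> univ B" "b \<notin> h ` S" "closed_under L B (insert b (h ` S))"
        "B\<lparr>univ := insert b (h ` S)\<rparr> \<in> K" using grow[OF B, of "h ` S"] by blast
      let ?T = "insert b (h ` S)"
      let ?B = "B\<lparr>univ := ?T\<rparr>"
      have "embedding L (M\<lparr>univ := S\<rparr>) ?B h"
        using less.prems by (intro embedding_change_codomain) (auto simp: partial_iso_def)
      then have "partial_iso L M ?B S h" using less.prems by (simp add: partial_iso_def)
      then obtain g where g: "embedding L ?B M g" "\<forall>x\<in>S. g (h x) = x"
        using one[OF b(4), of S h b] b(2) by auto
      have T: "?T \<subseteq> univ B" "finite ?T" using i(1) b(1) by (auto simp: partial_iso_def)
      have pg: "partial_iso L B M ?T g" using g(1) b(3) T by (simp add: partial_iso_def)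
      note j = partial_iso_inverse[OF pg]
      have h': "inv_into ?T g ` g ` ?T = ?T"
      proof -
        have "(\<lambda>x. inv_into ?T g (g x)) ` ?T = (\<lambda>x. x) ` ?T" by (rule image_cong[OF refl]) (rule j(3))
        then show ?thesis by (simp only: image_image image_ident)
      qed
      have "card (univ B - ?T) < card (univ B - h ` S)"
        using fin[OF B] b(1,2) by (intro psubset_card_mono) auto
      then have "\<exists>g'. embedding L B M g' \<and> (\<forall>x\<in>g ` ?T. g' (inv_into ?T g x) = x)"
        by (intro less.hyps[OF _ j(1)]) (simp only: h')
      then obtain g' where g': "embedding L B M g'" "\<forall>x\<in>g ` ?T. g' (inv_into ?T g x) = x"
        by blast
      have "g' (h x) = x" if "x \<in> S" for x
      proof -
        have "inv_into ?T g (g (h x)) = h x" using j(3)[of "h x"] that by blast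
        then show ?thesis using g'(2) g(2) that by (metis image_eqI insertI2)
      qed
      then show ?thesis using g'(1) by blast
    qed
  qed
  then show ?thesis unfolding rich_def by (simp add: partial_iso_def)
qed

section \<open>Richness of the models of a model completion\<close>

lemma closed_under_relational: "funs L = {} \<Longrightarrow> closed_under L M S"
  by (simp add: closed_under_def)

lemma model_of_restrict:
  assumes "funs L = {}" "universal_theory L TA" "model_of L M TA" "S \<subseteq> univ M" "S \<noteq> {}"
  shows "model_of L (M\<lparr>univ := S\<rparr>) TA"
  using embedding_model_of_universal[OF embedding_inclusion[OF assms(4)] _ assms(3,2)] assms(1,5)
  by (simp add: is_struct_def closed_under_relational)

lemma locally_in_finite_models:
  assumes "funs L = {}" "universal_theory L TA" "model_of L M TA"
  shows "locally_in L (finite_models L TA) M"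
  unfolding locally_in_def
proof (intro allI impI)
  fix X assume "finite X \<and> X \<noteq> {} \<and> X \<subseteq> univ M"
  then show "\<exists>S. X \<subseteq> S \<and> S \<subseteq> univ M \<and> finite S \<and> closed_under L M S \<and> M\<lparr>univ := S\<rparr> \<in> finite_models L TA"
    using model_of_restrict[OF assms, of X] closed_under_relational[OF assms(1), of M X]
    by (intro exI[of _ X]) (simp add: finite_models_def)
qed

text \<open>Nullary symbols would make the empty partial isomorphism depend on \<open>M\<close> and \<open>N\<close>.\<close>
lemma partial_iso_empty:
  assumes "\<And>f. f \<in> funs L \<Longrightarrow> farity L f > 0" "\<And>r. r \<in> rels L \<Longrightarrow> rarity L r > 0"
  shows "partial_iso L M N {} h"
  using assms by (force simp: partial_iso_def embedding_def closed_under_def)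

lemma finite_atoms:
  fixes L :: "('f, 'r) lang" and k :: nat
  assumes "finite (rels L)"
  shows "finite ({Eq (Var i) (Var j) |i j. i \<le> k \<and> j \<le> k} \<union>
    {Rel r (map Var ms) |r ms. r \<in> rels L \<and> set ms \<subseteq> {..k} \<and> length ms = rarity L r} :: ('f, 'r) fm set)"
proof -
  have "{Eq (Var i) (Var j) |i j. i \<le> k \<and> j \<le> k}
    = ((\<lambda>(i, j). Eq (Var i) (Var j)) ` ({..k} \<times> {..k}) :: ('f, 'r) fm set)"
    by auto
  moreover have "{Rel r (map Var ms) |r ms. r \<in> rels L \<and> set ms \<subseteq> {..k} \<and> length ms = rarity L r}
    = ((\<Union>r\<in>rels L. (\<lambda>ms. Rel r (map Var ms)) ` {ms. set ms \<subseteq> {..k} \<and> length ms = rarity L r}) :: ('f, 'r) fm set)"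
    by auto
  ultimately show ?thesis using assms by (simp add: finite_lists_length_eq)
qed

text \<open>The finite structure \<open>B\<close> embeds into some model \<open>N2\<close> of \<open>T\<close>, so that \<open>N2\<close> satisfies, at the
  image of \<open>S\<close>, the formula saying that there is a point with the atomic type of \<open>b\<close>. By
  completeness of \<open>T\<close> with the diagram of \<open>S\<close>, so does \<open>N\<close>.\<close>
lemma one_point_extension_of_models:
  fixes N B :: "('f, 'r, nat) struct"
  assumes L: "finite_relational L" and u: "universal_theory L TA" and mc: "model_completion L T TA"
    and N: "model_of L N T" and B: "B \<in> finite_models L TA" and p: "partial_iso L N B S h"
    and b: "b \<notin> h ` S" "univ B = insert b (h ` S)" and ne: "S \<noteq> {}"
  shows "\<exists>g. embedding L B N g \<and> (\<forall>x\<in>S. g (h x) = x)"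
proof -
  have fl: "funs L = {}" "finite (rels L)" using L by (auto simp: finite_relational_def)
  have BT: "model_of L B TA" using B by (simp add: finite_models_def)
  have NT: "model_of L N TA" using mc N by (simp add: model_completion_def)
  have S: "S \<subseteq> univ N" "finite S" and h: "embedding L (N\<lparr>univ := S\<rparr>) B h"
    using p by (auto simp: partial_iso_def)
  have A: "model_of L (N\<lparr>univ := S\<rparr>) TA" by (rule model_of_restrict[OF fl(1) u NT S(1) ne])
  have "\<exists>M :: ('f, 'r, nat) struct. model_of L M T \<and> (\<exists>f. embedding L B M f)"
    using mc BT unfolding model_completion_def by blast
  then obtain N2 :: "('f, 'r, nat) struct" and j where N2: "model_of L N2 T" and j: "embedding L B N2 j"
    by blast
  obtain as where as: "set as = S" using finite_list[OF S(2)] by blast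
  define k where "k = length as"
  have k: "k > 0" using as ne by (auto simp: k_def)
  \<comment> \<open>the variables below \<open>k\<close> name the points of \<open>S\<close>, and variable \<open>k\<close> names the new point; the other variables are irrelevant\<close>
  define e where "e i = as ! (if i < k then i else 0)" for i
  have eS: "e i \<in> S" for i using k as by (auto simp: e_def k_def)
  define eB where "eB = (h \<circ> e)(k := b)"
  have eB: "eB i \<in> univ B" for i using b(2) eS by (auto simp: eB_def)
  have eB_surj: "\<exists>i\<le>k. eB i = y" if y: "y \<in> univ B" for y
  proof (cases "y = b")
    case False
    then obtain x where "x \<in> S" "y = h x" using b(2) y by auto
    moreover from this obtain i where "i < k" "as ! i = x" using as by (auto simp: k_def in_set_conv_nth)
    ultimately show ?thesis by (intro exI[of _ i]) (auto simp: eB_def e_def)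
  qed (auto simp: eB_def)
  define atoms :: "('f, 'r) fm set" where "atoms = {Eq (Var i) (Var j) |i j. i \<le> k \<and> j \<le> k} \<union>
    {Rel r (map Var ms) |r ms. r \<in> rels L \<and> set ms \<subseteq> {..k} \<and> length ms = rarity L r}"
  have at: "quantifier_free a" "wf_fm L a" if "a \<in> atoms" for a
    using that by (auto simp: atoms_def list_all_iff)
  have "finite atoms" unfolding atoms_def by (rule finite_atoms[OF fl(2)])
  then obtain al where al: "set al = atoms" using finite_list[of atoms] by blast
  define q where "q = conj_list (map (\<lambda>a. if eval_fm B eB a then a else Neg a) al)"
  have evq: "eval_fm M e' q \<longleftrightarrow> (\<forall>a\<in>atoms. eval_fm M e' a = eval_fm B eB a)" for M :: "('f, 'r, nat) struct" and e'
  proof -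
    have lit: "eval_fm M e' (if c then a else Neg a) \<longleftrightarrow> (eval_fm M e' a = c)" for a c by simp
    show ?thesis by (simp only: q_def eval_conj_list set_map al ball_simps lit)
  qed
  have wfq: "wf_fm L q" using at(2) by (auto simp: q_def al)
  have "eval_fm N2 (j \<circ> eB) q"
    unfolding evq
  proof
    fix c assume "c \<in> atoms"
    then show "eval_fm N2 (j \<circ> eB) c = eval_fm B eB c"
      by (intro embedding_eval_quantifier_free[OF j closed_under_relational[OF fl(1)]]) (simp_all add: at eB)
  qed
  moreover have "j \<circ> eB = ((j \<circ> h) \<circ> e)(k := j b)" by (auto simp: eB_def)
  ultimately have ex2: "eval_fm N2 ((j \<circ> h) \<circ> e) (Ex k q)"
    using j b(2) by (auto simp: embedding_def)
  \<comment> \<open>both models contain \<open>S\<close>, so they agree on the existential formula at the points of \<open>S\<close>\<close>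
  have jh: "embedding L (N\<lparr>univ := S\<rparr>) N2 (j \<circ> h)" by (rule embedding_comp[OF h j])
  have idn: "embedding L (N\<lparr>univ := S\<rparr>) N id" by (rule embedding_inclusion[OF S(1)])
  have "\<forall>p e. wf_fm L p \<and> (\<forall>n. e n \<in> univ (N\<lparr>univ := S\<rparr>)) \<longrightarrow>
           eval_fm N (id \<circ> e) p = eval_fm N2 ((j \<circ> h) \<circ> e) p"
    using mc A N N2 jh idn unfolding model_completion_def by blast
  moreover have "wf_fm L (Ex k q)" "\<forall>n. e n \<in> univ (N\<lparr>univ := S\<rparr>)" using wfq eS by auto
  ultimately have "eval_fm N (id \<circ> e) (Ex k q) = eval_fm N2 ((j \<circ> h) \<circ> e) (Ex k q)" by blast
  with ex2 have "eval_fm N e (Ex k q)" by simp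
  then obtain a where a: "a \<in> univ N" "eval_fm N (e(k := a)) q" by auto
  define e' where "e' = e(k := a)"
  have agree: "eval_fm N e' c = eval_fm B eB c" if "c \<in> atoms" for c
    using a(2) that unfolding evq e'_def by blast
  have eqi: "e' i = e' i' \<longleftrightarrow> eB i = eB i'" if "i \<le> k" "i' \<le> k" for i i'
    using agree[of "Eq (Var i) (Var i')"] that by (auto simp: atoms_def)
  define idx where "idx y = (SOME i. i \<le> k \<and> eB i = y)" for y
  have idx: "idx y \<le> k" "eB (idx y) = y" if "y \<in> univ B" for y
    using someI_ex[OF eB_surj[OF that]] by (auto simp: idx_def)
  define g where "g y = e' (idx y)" for y
  have "embedding L B N g" unfolding embedding_def
  proof (intro conjI ballI allI impI)
    show "g ` univ B \<subseteq> univ N" using a(1) eS S(1) by (auto simp: g_def e'_def)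
    show "inj_on g (univ B)" using eqi idx by (metis g_def inj_onI)
  next
    fix r ys assume r: "r \<in> rels L" "length ys = rarity L r \<and> set ys \<subseteq> univ B"
    have "set (map idx ys) \<subseteq> {..k}" using r idx(1) by auto
    then have "Rel r (map Var (map idx ys)) \<in> atoms" unfolding atoms_def
      using r by (intro UnI2 CollectI exI[of _ r] exI[of _ "map idx ys"]) simp
    note agree[OF this]
    moreover have "map eB (map idx ys) = ys" using r idx(2) by (auto intro!: map_idI)
    moreover have "map e' (map idx ys) = map g ys" by (simp add: g_def)
    ultimately show "relation B r ys = relation N r (map g ys)" by (simp add: comp_def del: map_eq_conv)
  qed (simp add: fl(1))
  moreover have "g (h x) = x" if x: "x \<in> S" for x
  proof -
    obtain i where i: "i < k" "as ! i = x" using as x by (auto simp: k_def in_set_conv_nth)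
    have hx: "h x \<in> univ B" using b(2) x by auto
    have "eB i = h x" "e' i = x" using i by (auto simp: eB_def e'_def e_def)
    then show ?thesis using eqi[of "idx (h x)" i] idx[OF hx] i by (simp add: g_def)
  qed
  ultimately show ?thesis by blast
qed

text \<open>If no point of \<open>N\<close> is given, completeness over a diagram says nothing about \<open>B\<close>, because
  diagrams of structures are never empty. Joint embedding provides a point to start from.\<close>
lemma rich_of_model_completion:
  fixes N :: "('f, 'r, nat) struct"
  assumes L: "finite_relational L" and u: "universal_theory L TA" and mc: "model_completion L T TA"
    and je: "joint_embedding L (finite_models L TA)" and N: "model_of L N T"
  shows "rich L (finite_models L TA) N"
proof (rule rich_of_one_point_extensions)
  have fl: "funs L = {}" using L by (auto simp: finite_relational_def)
  show "finite (univ B)" if "B \<in> finite_models L TA" for B using that by (simp add: finite_models_def)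
  show "\<exists>b\<in>univ B - U. closed_under L B (insert b U) \<and> B\<lparr>univ := insert b U\<rparr> \<in> finite_models L TA"
    if B: "B \<in> finite_models L TA" and U: "U \<subset> univ B" for B :: "('f, 'r, nat) struct" and U
  proof -
    obtain b where b: "b \<in> univ B - U" using U by blast
    have "model_of L (B\<lparr>univ := insert b U\<rparr>) TA"
      by (rule model_of_restrict[OF fl u]) (use B b U in \<open>auto simp: finite_models_def\<close>)
    moreover have "finite (insert b U)" using B U by (auto simp: finite_models_def intro: finite_subset)
    ultimately show ?thesis using b closed_under_relational[OF fl] by (auto simp: finite_models_def)
  qed
  show "\<exists>g. embedding L B N g \<and> (\<forall>x\<in>S. g (h x) = x)"
    if B: "B \<in> finite_models L TA" and p: "partial_iso L N B S h" and b: "b \<in> univ B" "b \<notin> h ` S"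
      "univ B = insert b (h ` S)" for B :: "('f, 'r, nat) struct" and S h b
  proof (cases "S = {}")
    case False
    then show ?thesis using one_point_extension_of_models[OF L u mc N B p b(2,3)] by blast
  next
    case True
    \<comment> \<open>embed \<open>B\<close> and a point of \<open>N\<close> jointly, and use the extension of that point\<close>
    have NT: "model_of L N TA" using mc N by (simp add: model_completion_def)
    then obtain n where n: "n \<in> univ N" by (auto simp: model_of_def is_struct_def)
    have A: "N\<lparr>univ := {n}\<rparr> \<in> finite_models L TA"
      using model_of_restrict[OF fl u NT, of "{n}"] n by (simp add: finite_models_def)
    have "\<exists>D\<in>finite_models L TA. \<exists>f g. embedding L (N\<lparr>univ := {n}\<rparr>) D f \<and> embedding L B D g"
      using je A B unfolding joint_embedding_def by blast
    then obtain D f g where D: "D \<in> finite_models L TA" and f: "embedding L (N\<lparr>univ := {n}\<rparr>) D f"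
      and g: "embedding L B D g" by blast
    have fn: "f n \<in> univ D" "g b \<in> univ D" using f g b by (auto simp: embedding_def)
    let ?D = "D\<lparr>univ := insert (g b) (f ` {n})\<rparr>"
    have D': "?D \<in> finite_models L TA"
      using model_of_restrict[OF fl u, of D "insert (g b) (f ` {n})"] D fn by (auto simp: finite_models_def)
    have f': "embedding L (N\<lparr>univ := {n}\<rparr>) ?D f" by (rule embedding_change_codomain[OF f]) auto
    have g': "embedding L B ?D g" by (rule embedding_change_codomain[OF g]) (use b(3) True in auto)
    have pf: "partial_iso L N ?D {n} f" using f' n closed_under_relational[OF fl] by (auto simp: partial_iso_def)
    have "\<exists>k. embedding L ?D N k"
    proof (cases "g b = f n")
      case eq: True
      then have "?D = ?D\<lparr>univ := f ` {n}\<rparr>" by simp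
      then show ?thesis using partial_iso_inverse(1)[OF pf] by (metis partial_iso_def)
    next
      case False
      then show ?thesis using one_point_extension_of_models[OF L u mc N D' pf, of "g b"] by auto
    qed
    then show ?thesis using embedding_comp[OF g'] True by blast
  qed
qed

text \<open>Some model \<open>N\<close> of \<open>T\<close> exists, and it is isomorphic to \<open>P\<close> because both are countable and
  rich.\<close>
lemma model_of_rich:
  fixes P :: "('f, 'r, nat) struct"
  assumes L: "finite_relational L" and u: "universal_theory L TA" and mc: "model_completion L T TA"
    and je: "joint_embedding L (finite_models L TA)" and P: "model_of L P TA"
    and rP: "rich L (finite_models L TA) P"
  shows "model_of L P T"
proof -
  have fl: "funs L = {}" using L by (auto simp: finite_relational_def)
  have "\<exists>M :: ('f, 'r, nat) struct. model_of L M T \<and> (\<exists>f. embedding L P M f)"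
    using mc P unfolding model_completion_def by blast
  then obtain N :: "('f, 'r, nat) struct" where N: "model_of L N T" by blast
  have NT: "model_of L N TA" using mc N by (simp add: model_completion_def)
  have e: "partial_iso L N P {} id"
    by (rule partial_iso_empty) (use L in \<open>auto simp: finite_relational_def\<close>)
  obtain g where "isomorphism L N P g"
    by (rule back_and_forth[OF e rich_of_model_completion[OF L u mc je N] rP
        locally_in_finite_models[OF fl u NT] locally_in_finite_models[OF fl u P]])
  then show ?thesis using isomorphism_model_of N mc by (auto simp: model_completion_def)
qed

section \<open>Meet-trees with a structure on their open cones\<close>

abbreviation tle :: "(tree_fun, 'r tree_rel, 'a) struct \<Rightarrow> 'a \<Rightarrow> 'a \<Rightarrow> bool" where
  "tle M x y \<equiv> relation M Leq [x, y]"

abbreviation tmeet :: "(tree_fun, 'r tree_rel, 'a) struct \<Rightarrow> 'a \<Rightarrow> 'a \<Rightarrow> 'a" where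
  "tmeet M x y \<equiv> func M Meet [x, y]"

text \<open>The axioms \<open>Tr\<close>, (WD) and (OC) in semantic form; (WD) is stated for lists that are
  equivalent entry by entry.\<close>
locale star_tree =
  fixes L :: "('f, 'r) lang" and M :: "(tree_fun, 'r tree_rel, 'a) struct"
  assumes rarity_pos: "r \<in> rels L \<Longrightarrow> rarity L r > 0"
    and meet_closed: "x \<in> univ M \<Longrightarrow> y \<in> univ M \<Longrightarrow> tmeet M x y \<in> univ M"
    and refl: "x \<in> univ M \<Longrightarrow> tle M x x"
    and antisym: "x \<in> univ M \<Longrightarrow> y \<in> univ M \<Longrightarrow> tle M x y \<Longrightarrow> tle M y x \<Longrightarrow> x = y"
    and trans: "x \<in> univ M \<Longrightarrow> y \<in> univ M \<Longrightarrow> z \<in> univ M \<Longrightarrow> tle M x y \<Longrightarrow> tle M y z \<Longrightarrow> tle M x z"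
    and below_linear: "x \<in> univ M \<Longrightarrow> y \<in> univ M \<Longrightarrow> z \<in> univ M \<Longrightarrow> tle M y x \<Longrightarrow> tle M z x \<Longrightarrow>
      tle M y z \<or> tle M z y"
    and meet_le1: "x \<in> univ M \<Longrightarrow> y \<in> univ M \<Longrightarrow> tle M (tmeet M x y) x"
    and meet_le2: "x \<in> univ M \<Longrightarrow> y \<in> univ M \<Longrightarrow> tle M (tmeet M x y) y"
    and meet_greatest: "x \<in> univ M \<Longrightarrow> y \<in> univ M \<Longrightarrow> z \<in> univ M \<Longrightarrow> tle M z x \<Longrightarrow> tle M z y \<Longrightarrow>
      tle M z (tmeet M x y)"
    and rel_above: "r \<in> rels L \<Longrightarrow> c \<in> univ M \<Longrightarrow> set as \<subseteq> univ M \<Longrightarrow> length as = rarity L r \<Longrightarrow>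
      relation M (Star r) (c # as) \<Longrightarrow> set as \<subseteq> above M c"
    and rel_cone: "r \<in> rels L \<Longrightarrow> c \<in> univ M \<Longrightarrow> length as = rarity L r \<Longrightarrow>
      list_all2 (\<lambda>a b. (a, b) \<in> cone_rel M c) as bs \<Longrightarrow> relation M (Star r) (c # as) \<Longrightarrow>
      relation M (Star r) (c # bs)"
begin

lemma above_univ: "above M c \<subseteq> univ M"
  by (auto simp: above_def)

lemma meet_commute: "x \<in> univ M \<Longrightarrow> y \<in> univ M \<Longrightarrow> tmeet M x y = tmeet M y x"
  by (simp add: antisym meet_closed meet_greatest meet_le1 meet_le2)

lemma le_iff_meet: "x \<in> univ M \<Longrightarrow> y \<in> univ M \<Longrightarrow> tle M x y \<longleftrightarrow> tmeet M x y = x"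
  by (metis antisym meet_closed meet_greatest meet_le1 meet_le2 refl)

lemma above_trans: "c \<in> univ M \<Longrightarrow> a \<in> above M c \<Longrightarrow> b \<in> univ M \<Longrightarrow> tle M a b \<Longrightarrow> b \<in> above M c"
  unfolding above_def by (auto intro: trans antisym)

lemma above_trans': "c \<in> univ M \<Longrightarrow> d \<in> univ M \<Longrightarrow> tle M c d \<Longrightarrow> a \<in> above M d \<Longrightarrow> a \<in> above M c"
  unfolding above_def by (auto intro: trans antisym)

text \<open>The meet of two elements is below both, so that it alone has to be compared with the center.\<close>
lemma cone_rel_iff:
  "c \<in> univ M \<Longrightarrow> (a, b) \<in> cone_rel M c \<longleftrightarrow> a \<in> univ M \<and> b \<in> univ M \<and> tmeet M a b \<in> above M c"
  unfolding cone_rel_def using above_trans[of c "tmeet M a b"] meet_le1[of a b] meet_le2[of a b] above_univ[of c]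
  by auto

lemma equiv_cone_rel:
  assumes c: "c \<in> univ M"
  shows "equiv (above M c) (cone_rel M c)"
proof (rule equivI)
  show "cone_rel M c \<subseteq> above M c \<times> above M c" by (auto simp: cone_rel_def)
  show "refl_on (above M c) (cone_rel M c)"
    using le_iff_meet refl subsetD[OF above_univ] by (simp add: refl_on_def cone_rel_def)
  show "sym (cone_rel M c)"
    using meet_commute above_univ by (fastforce simp: sym_def cone_rel_def)
  show "Relation.trans (cone_rel M c)"
  proof (rule transI)
    fix x y z assume a: "(x, y) \<in> cone_rel M c" "(y, z) \<in> cone_rel M c"
    let ?u = "tmeet M x y" let ?v = "tmeet M y z"
    have U: "x \<in> univ M" "y \<in> univ M" "z \<in> univ M" and uv: "?u \<in> above M c" "?v \<in> above M c"
      using a c by (auto simp: cone_rel_iff)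
    have U2: "?u \<in> univ M" "?v \<in> univ M" using U meet_closed by auto
    consider "tle M ?u ?v" | "tle M ?v ?u"
      using below_linear[of y ?u ?v] U U2 meet_le1 meet_le2 by blast
    then have "tle M ?u (tmeet M x z) \<or> tle M ?v (tmeet M x z)"
    proof cases
      case 1
      then have "tle M ?u z" using trans[of ?u ?v z] U U2 meet_le2 by blast
      then show ?thesis using meet_greatest[of x z ?u] U U2 meet_le1 by blast
    next
      case 2
      then have "tle M ?v x" using trans[of ?v ?u x] U U2 meet_le1 by blast
      then show ?thesis using meet_greatest[of x z ?v] U U2 meet_le2 by blast
    qed
    then have "tmeet M x z \<in> above M c"
      using above_trans[OF c] uv meet_closed[of x z] U by blast
    then show "(x, z) \<in> cone_rel M c" using c U by (simp add: cone_rel_iff)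
  qed
qed

lemma cone_rel_refl: "c \<in> univ M \<Longrightarrow> a \<in> above M c \<Longrightarrow> (a, a) \<in> cone_rel M c"
  using equiv_cone_rel by (meson equiv_def refl_onD)

lemma cone_rel_sym: "c \<in> univ M \<Longrightarrow> (a, b) \<in> cone_rel M c \<Longrightarrow> (b, a) \<in> cone_rel M c"
  using equiv_cone_rel by (meson equiv_def symD)

lemma cone_rel_trans:
  "c \<in> univ M \<Longrightarrow> (a, b) \<in> cone_rel M c \<Longrightarrow> (b, d) \<in> cone_rel M c \<Longrightarrow> (a, d) \<in> cone_rel M c"
  using equiv_cone_rel by (meson equiv_def transD)

text \<open>Both \<open>b\<close> and the meet of \<open>m\<close> and \<open>t\<close> lie below \<open>m\<close>, so they are comparable. This reduces
  meets with a new point to meets of old ones.\<close>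
lemma meet_eq_of_not_le:
  assumes U: "b \<in> univ M" "m \<in> univ M" "t \<in> univ M" and bm: "tle M b m" and bt: "\<not> tle M b t"
  shows "tmeet M b t = tmeet M m t"
proof -
  have U2: "tmeet M b t \<in> univ M" "tmeet M m t \<in> univ M" using U meet_closed by auto
  have "tle M (tmeet M b t) m" using trans[of "tmeet M b t" b m] meet_le1 U U2 bm by blast
  then have 1: "tle M (tmeet M b t) (tmeet M m t)"
    using meet_greatest[of m t] meet_le2[of b t] U U2 by blast
  have "tle M (tmeet M m t) b"
    using below_linear[of m b "tmeet M m t"] trans[of b "tmeet M m t" t] U U2 bm bt meet_le1 meet_le2 by blast
  then have "tle M (tmeet M m t) (tmeet M b t)"
    using meet_greatest[of b t] meet_le2[of m t] U U2 by blast
  then show ?thesis using antisym U2 1 by blast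
qed

lemma rel_cong:
  assumes "r \<in> rels L" "c \<in> univ M" "length xs = rarity L r" "\<And>x. x \<in> set xs \<Longrightarrow> (f x, g x) \<in> cone_rel M c"
  shows "relation M (Star r) (c # map f xs) \<longleftrightarrow> relation M (Star r) (c # map g xs)"
proof -
  have "list_all2 (\<lambda>a b. (a, b) \<in> cone_rel M c) (map f xs) (map g xs)"
    "list_all2 (\<lambda>a b. (a, b) \<in> cone_rel M c) (map g xs) (map f xs)"
    using assms(2,4) cone_rel_sym by (auto simp: list_all2_map1 list_all2_map2 list_all2_same)
  then show ?thesis using rel_cone assms(1,2,3) by (metis length_map)
qed

end

text \<open>A partial transversal of the open cones of center \<open>c\<close>: a cone may be missed.\<close>
definition transversal :: "(tree_fun, 'r tree_rel, 'a) struct \<Rightarrow> 'a \<Rightarrow> 'a set \<Rightarrow> bool" where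
  "transversal M c R \<longleftrightarrow> R \<subseteq> above M c \<and> (\<forall>a\<in>R. \<forall>b\<in>R. (a, b) \<in> cone_rel M c \<longrightarrow> a = b)"

text \<open>The structure \<open>M_c\<close> on representatives of the cones instead of the cones themselves. If \<open>M\<close>
  is a structure on natural numbers, then so is this one, so that it can be compared with
  the finite models of \<open>TA\<close> and with the models of \<open>T\<close>. Function values are arbitrary, since
  the language is relational.\<close>
definition rep :: "(tree_fun, 'r tree_rel, 'a) struct \<Rightarrow> 'a \<Rightarrow> 'a set \<Rightarrow> ('f, 'r, 'a) struct" where
  "rep M c R = \<lparr>univ = R, func = (\<lambda>_ _. undefined), relation = (\<lambda>r xs. relation M (Star r) (c # xs))\<rparr>"

lemma rep_simps [simp]:
  "univ (rep M c R) = R" "relation (rep M c R) r xs = relation M (Star r) (c # xs)"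
  by (simp_all add: rep_def)

lemma rep_update [simp]: "(rep M c R)\<lparr>univ := S\<rparr> = rep M c S"
  by (simp add: rep_def)

lemma star_lang_simps [simp]:
  "funs (star_lang L) = {Meet}" "farity (star_lang L) f = 2"
  "rels (star_lang L) = insert Leq (Star ` rels L)"
  "rarity (star_lang L) Leq = 2" "rarity (star_lang L) (Star r) = Suc (rarity L r)"
  by (simp_all add: star_lang_def)

lemma length_2_iff: "length xs = 2 \<longleftrightarrow> (\<exists>x y. xs = [x, y])"
  by (auto simp: numeral_2_eq_2 length_Suc_conv)

lemma closed_under_star_lang:
  "closed_under (star_lang L) M S \<longleftrightarrow> (\<forall>x\<in>S. \<forall>y\<in>S. tmeet M x y \<in> S)"
  by (auto simp: closed_under_def length_2_iff)

lemma embedding_star_langI: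
  assumes "\<And>x. x \<in> univ A \<Longrightarrow> h x \<in> univ B" "inj_on h (univ A)"
    and "\<And>x y. x \<in> univ A \<Longrightarrow> y \<in> univ A \<Longrightarrow> h (tmeet A x y) = tmeet B (h x) (h y)"
    and "\<And>x y. x \<in> univ A \<Longrightarrow> y \<in> univ A \<Longrightarrow> tle A x y \<longleftrightarrow> tle B (h x) (h y)"
    and "\<And>r x ys. r \<in> rels L \<Longrightarrow> length ys = rarity L r \<Longrightarrow> x \<in> univ A \<Longrightarrow> set ys \<subseteq> univ A \<Longrightarrow>
      relation A (Star r) (x # ys) \<longleftrightarrow> relation B (Star r) (h x # map h ys)"
  shows "embedding (star_lang L) A B h"
  unfolding embedding_def
proof (intro conjI ballI allI impI)
  show "h ` univ A \<subseteq> univ B" using assms(1) by auto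
  show "inj_on h (univ A)" by (rule assms(2))
next
  fix f xs assume "f \<in> funs (star_lang L)" "length xs = farity (star_lang L) f \<and> set xs \<subseteq> univ A"
  then show "h (func A f xs) = func B f (map h xs)" using assms(3) by (auto simp: length_2_iff)
next
  fix R xs assume R: "R \<in> rels (star_lang L)" "length xs = rarity (star_lang L) R \<and> set xs \<subseteq> univ A"
  show "relation A R xs = relation B R (map h xs)"
  proof (cases R)
    case Leq
    then show ?thesis using R assms(4) by (auto simp: length_2_iff)
  next
    case (Star r)
    then obtain x ys where "xs = x # ys" "r \<in> rels L" using R by (cases xs) auto
    then show ?thesis using R assms(5)[of r ys x] Star by auto
  qed
qed

lemma embedding_star_langD:
  assumes h: "embedding (star_lang L) A B h"
  shows "x \<in> univ A \<Longrightarrow> h x \<in> univ B"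
    and "x \<in> univ A \<Longrightarrow> y \<in> univ A \<Longrightarrow> h x = h y \<longleftrightarrow> x = y"
    and "x \<in> univ A \<Longrightarrow> y \<in> univ A \<Longrightarrow> h (tmeet A x y) = tmeet B (h x) (h y)"
    and "x \<in> univ A \<Longrightarrow> y \<in> univ A \<Longrightarrow> tle A x y \<longleftrightarrow> tle B (h x) (h y)"
    and "x \<in> univ A \<Longrightarrow> y \<in> univ A \<Longrightarrow> y \<in> above A x \<longleftrightarrow> h y \<in> above B (h x)"
    and "r \<in> rels L \<Longrightarrow> length ys = rarity L r \<Longrightarrow> x \<in> univ A \<Longrightarrow> set ys \<subseteq> univ A \<Longrightarrow>
      relation A (Star r) (x # ys) \<longleftrightarrow> relation B (Star r) (h x # map h ys)"
proof -
  have im: "h ` univ A \<subseteq> univ B" and inj: "inj_on h (univ A)"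
    and F: "\<And>f xs. f \<in> funs (star_lang L) \<Longrightarrow> length xs = farity (star_lang L) f \<and> set xs \<subseteq> univ A \<Longrightarrow>
      h (func A f xs) = func B f (map h xs)"
    and R: "\<And>r xs. r \<in> rels (star_lang L) \<Longrightarrow> length xs = rarity (star_lang L) r \<and> set xs \<subseteq> univ A \<Longrightarrow>
      relation A r xs = relation B r (map h xs)"
    using h unfolding embedding_def by blast+
  show 1: "x \<in> univ A \<Longrightarrow> h x \<in> univ B" for x using im by auto
  show 2: "x \<in> univ A \<Longrightarrow> y \<in> univ A \<Longrightarrow> h x = h y \<longleftrightarrow> x = y" for x y using inj by (simp add: inj_on_eq_iff)
  show "x \<in> univ A \<Longrightarrow> y \<in> univ A \<Longrightarrow> h (tmeet A x y) = tmeet B (h x) (h y)"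
    using F[of Meet "[x, y]"] by simp
  show 3: "x \<in> univ A \<Longrightarrow> y \<in> univ A \<Longrightarrow> tle A x y \<longleftrightarrow> tle B (h x) (h y)" for x y
    using R[of Leq "[x, y]"] by simp
  show "x \<in> univ A \<Longrightarrow> y \<in> univ A \<Longrightarrow> y \<in> above A x \<longleftrightarrow> h y \<in> above B (h x)"
    using 1 2 3 by (simp add: above_def)
  show "r \<in> rels L \<Longrightarrow> length ys = rarity L r \<Longrightarrow> x \<in> univ A \<Longrightarrow> set ys \<subseteq> univ A \<Longrightarrow>
      relation A (Star r) (x # ys) \<longleftrightarrow> relation B (Star r) (h x # map h ys)"
    using R[of "Star r" "x # ys"] by simp
qed

context star_tree
begin

text \<open>Choose for each cone that meets \<open>W\<close> its element of \<open>R\<close>, if there is one. The choice depends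
  only on the cone, and is therefore idempotent.\<close>
lemma transversal_extend:
  assumes c: "c \<in> univ M" and W: "W \<subseteq> above M c" and R: "transversal M c R" "R \<subseteq> W"
  obtains R' \<rho> where "R \<subseteq> R'" "R' \<subseteq> W" "transversal M c R'"
    "\<forall>a\<in>W. \<rho> a \<in> R' \<and> (\<rho> a, a) \<in> cone_rel M c" "\<forall>a\<in>R'. \<rho> a = a"
proof -
  define \<sigma> where "\<sigma> a = (if \<exists>r\<in>R. (a, r) \<in> cone_rel M c then SOME r. r \<in> R \<and> r \<in> cone_rel M c `` {a}
    else SOME r. r \<in> W \<and> r \<in> cone_rel M c `` {a})" for a
  have s: "(a, \<sigma> a) \<in> cone_rel M c \<and> \<sigma> a \<in> W" if a: "a \<in> W" for a
  proof (cases "\<exists>r\<in>R. (a, r) \<in> cone_rel M c")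
    case True
    then have "\<exists>r. r \<in> R \<and> r \<in> cone_rel M c `` {a}" by blast
    from someI_ex[OF this] show ?thesis using True R(2) by (auto simp: \<sigma>_def)
  next
    case False
    have "\<exists>r. r \<in> W \<and> r \<in> cone_rel M c `` {a}" using cone_rel_refl[OF c, of a] a W by blast
    from someI_ex[OF this] show ?thesis using False by (auto simp: \<sigma>_def)
  qed
  have eq: "\<sigma> a = \<sigma> b" if "(a, b) \<in> cone_rel M c" for a b
  proof -
    have 1: "cone_rel M c `` {a} = cone_rel M c `` {b}" by (rule equiv_class_eq[OF equiv_cone_rel[OF c] that])
    then have "(a, r) \<in> cone_rel M c \<longleftrightarrow> (b, r) \<in> cone_rel M c" for r by blast
    then show ?thesis unfolding \<sigma>_def 1 by simp
  qed
  have sR: "\<sigma> a = a" if a: "a \<in> R" for a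
  proof -
    have 1: "(a, a) \<in> cone_rel M c" using R a cone_rel_refl[OF c] by (auto simp: transversal_def)
    have "r = a" if "r \<in> R \<and> r \<in> cone_rel M c `` {a}" for r
      using R a that unfolding transversal_def by blast
    then have "(SOME r. r \<in> R \<and> r \<in> cone_rel M c `` {a}) = a" using a 1 by (intro some_equality) auto
    then show ?thesis unfolding \<sigma>_def using a 1 by auto
  qed
  have idem: "\<sigma> (\<sigma> a) = \<sigma> a" if "a \<in> W" for a using eq[of a "\<sigma> a"] s[OF that] by simp
  show ?thesis
  proof (rule that[of "\<sigma> ` W" \<sigma>])
    show "R \<subseteq> \<sigma> ` W"
    proof
      fix a assume "a \<in> R"
      then have "\<sigma> a = a" "a \<in> W" using sR R by auto
      then show "a \<in> \<sigma> ` W" by (metis imageI)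
    qed
    show sub: "\<sigma> ` W \<subseteq> W" using s by auto
    show "transversal M c (\<sigma> ` W)" unfolding transversal_def
    proof (intro conjI ballI impI)
      show "\<sigma> ` W \<subseteq> above M c" using sub W by auto
      fix a b assume "a \<in> \<sigma> ` W" "b \<in> \<sigma> ` W" "(a, b) \<in> cone_rel M c"
      then show "a = b" using idem eq[of a b] by auto
    qed
    show "\<forall>a\<in>W. \<sigma> a \<in> \<sigma> ` W \<and> (\<sigma> a, a) \<in> cone_rel M c"
      using s cone_rel_sym[OF c] by auto
    show "\<forall>a\<in>\<sigma> ` W. \<sigma> a = a" using idem by auto
  qed
qed

text \<open>By (WD), a relation of \<open>cone_struct\<close> that holds for some representatives of the cones holds
  for the chosen ones.\<close>
lemma isomorphism_rep_cone_struct: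
  assumes fl: "funs L = {}" and c: "c \<in> univ M" and R: "transversal M c R"
    and full: "\<forall>a\<in>above M c. \<exists>b\<in>R. (b, a) \<in> cone_rel M c"
  shows "isomorphism L (rep M c R) (cone_struct M c) (\<lambda>a. cone_rel M c `` {a})"
proof -
  note e = equiv_cone_rel[OF c]
  have RA: "R \<subseteq> above M c" using R by (simp add: transversal_def)
  have class_eq: "cone_rel M c `` {a} = cone_rel M c `` {b} \<longleftrightarrow> (a, b) \<in> cone_rel M c"
    if "a \<in> above M c" "b \<in> above M c" for a b
    using eq_equiv_class_iff[OF e that] .
  have rel: "relation (rep M c R) r as = relation (cone_struct M c) r (map (\<lambda>a. cone_rel M c `` {a}) as)"
    if r: "r \<in> rels L" "length as = rarity L r" "set as \<subseteq> R" for r as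
  proof
    assume "relation (rep M c R) r as"
    then show "relation (cone_struct M c) r (map (\<lambda>a. cone_rel M c `` {a}) as)"
      using r RA by (auto simp: cone_struct_def)
  next
    assume "relation (cone_struct M c) r (map (\<lambda>a. cone_rel M c `` {a}) as)"
    then obtain bs where bs: "set bs \<subseteq> above M c" "relation M (Star r) (c # bs)"
      "map (\<lambda>a. cone_rel M c `` {a}) as = map (\<lambda>a. cone_rel M c `` {a}) bs"
      by (auto simp: cone_struct_def)
    have len: "length as = length bs" using bs(3) by (metis length_map)
    have "list_all2 (\<lambda>a b. (a, b) \<in> cone_rel M c) bs as"
    proof (rule list_all2_all_nthI)
      fix i assume i: "i < length bs"
      have "cone_rel M c `` {bs ! i} = cone_rel M c `` {as ! i}" using bs(3) i len by (metis nth_map)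
      moreover have "bs ! i \<in> above M c" "as ! i \<in> above M c" using i len bs(1) r(3) RA
        by (auto simp: subset_iff)
      ultimately show "(bs ! i, as ! i) \<in> cone_rel M c" using class_eq by blast
    qed (simp add: len)
    then have "relation M (Star r) (c # as)" using rel_cone[OF r(1) c] bs(2) len r(2) by auto
    then show "relation (rep M c R) r as" by simp
  qed
  have im: "(\<lambda>a. cone_rel M c `` {a}) ` R = above M c // cone_rel M c"
  proof
    show "(\<lambda>a. cone_rel M c `` {a}) ` R \<subseteq> above M c // cone_rel M c" using RA by (auto simp: quotient_def)
    show "above M c // cone_rel M c \<subseteq> (\<lambda>a. cone_rel M c `` {a}) ` R"
    proof
      fix X assume "X \<in> above M c // cone_rel M c"
      then obtain a where a: "a \<in> above M c" "X = cone_rel M c `` {a}" by (auto simp: quotient_def)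
      then obtain b where b: "b \<in> R" "(b, a) \<in> cone_rel M c" using full by blast
      then have "X = cone_rel M c `` {b}" using class_eq[of b a] a RA by blast
      then show "X \<in> (\<lambda>a. cone_rel M c `` {a}) ` R" using b(1) by blast
    qed
  qed
  have "inj_on (\<lambda>a. cone_rel M c `` {a}) R"
    using class_eq RA R unfolding inj_on_def transversal_def by (metis subsetD)
  then show ?thesis unfolding isomorphism_def embedding_def using im rel fl by (simp add: cone_struct_def)
qed

text \<open>Unlike \<open>eval_star\<close>, this allows a valuation whose values are only equivalent to
  representatives, and constrains it only at the free variables. So it also applies at a
  center with no cone above it, with \<open>R\<close> empty.\<close>
lemma eval_star_rep:
  assumes fl: "funs L = {}" and c: "c \<in> univ M" and R: "transversal M c R"
    and q: "quantifier_free q" "wf_fm L q" and ex: "e x = c"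
    and e: "\<And>n. n \<in> free_vars q \<Longrightarrow> \<rho> n \<in> R \<and> (\<rho> n, e n) \<in> cone_rel M c"
  shows "eval_fm M e (star x q) = eval_fm (rep M c R) \<rho> q"
  using q e
proof (induction q)
  case (Eq s t)
  obtain m n where mn: "s = Var m" "t = Var n" using star_tm_Var[OF _ fl] Eq by (metis wf_fm.simps(2))
  have mn': "\<rho> m \<in> R" "\<rho> n \<in> R" "(\<rho> m, e m) \<in> cone_rel M c" "(\<rho> n, e n) \<in> cone_rel M c"
    using Eq.prems(3)[of m] Eq.prems(3)[of n] mn by auto
  have U: "e m \<in> univ M" "e n \<in> univ M" using mn'(3,4) c by (auto simp: cone_rel_iff)
  have "eval_fm M e (star x (Eq s t)) \<longleftrightarrow> tmeet M (e m) (e n) \<in> above M c"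
    using mn ex meet_closed[OF U] by (simp add: star_tm_def above_def)
  also have "\<dots> \<longleftrightarrow> (e m, e n) \<in> cone_rel M c" using U c by (simp add: cone_rel_iff)
  also have "\<dots> \<longleftrightarrow> (\<rho> m, \<rho> n) \<in> cone_rel M c"
    using mn'(3,4) cone_rel_trans[OF c] cone_rel_sym[OF c] by blast
  also have "\<dots> \<longleftrightarrow> \<rho> m = \<rho> n"
    using mn'(1,2) R cone_rel_refl[OF c] unfolding transversal_def by (metis subsetD)
  finally show ?case by (simp add: mn)
next
  case (Rel r ts)
  have "\<forall>t\<in>set ts. \<exists>n. t = Var n" using star_tm_Var[OF _ fl] Rel.prems(2) by (fastforce simp: list_all_iff)
  then obtain ns where ns: "ts = map Var ns" by (metis ex_map_conv)
  have st: "map star_tm ts = map Var ns" by (simp add: ns star_tm_def)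
  have "(e n, \<rho> n) \<in> cone_rel M c" if "n \<in> set ns" for n
    using Rel.prems(3)[of n] that ns cone_rel_sym[OF c] by auto
  then have "relation M (Star r) (c # map e ns) \<longleftrightarrow> relation M (Star r) (c # map \<rho> ns)"
    using Rel.prems(2) ns by (intro rel_cong[OF _ c]) auto
  then show ?case by (simp add: ns star_tm_def ex comp_def)
qed auto

end

section \<open>Semantics of the starred axioms\<close>

text \<open>For evaluating the axioms of \<open>Tr\<close>, which use the variables 0, 1 and 2.\<close>
lemma sat_three_variables:
  fixes M :: "('a, 'b, 'c) struct"
  assumes "free_vars q \<subseteq> {0, 1, 2}"
  shows "sat M q \<longleftrightarrow> (\<forall>x\<in>univ M. \<forall>y\<in>univ M. \<forall>z\<in>univ M.
    eval_fm M (\<lambda>n. if n = 0 then x else if n = 1 then y else z) q)"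
proof
  assume a: "sat M q"
  show "\<forall>x\<in>univ M. \<forall>y\<in>univ M. \<forall>z\<in>univ M. eval_fm M (\<lambda>n. if n = 0 then x else if n = 1 then y else z) q"
  proof (intro ballI)
    fix x y z assume "x \<in> univ M" "y \<in> univ M" "z \<in> univ M"
    then show "eval_fm M (\<lambda>n. if n = 0 then x else if n = 1 then y else z) q"
      using a unfolding sat_def by simp
  qed
next
  assume a: "\<forall>x\<in>univ M. \<forall>y\<in>univ M. \<forall>z\<in>univ M. eval_fm M (\<lambda>n. if n = 0 then x else if n = 1 then y else z) q"
  show "sat M q" unfolding sat_def
  proof (intro allI impI)
    fix e :: "nat \<Rightarrow> 'c" assume e: "\<forall>n. e n \<in> univ M"
    have "eval_fm M (\<lambda>n. if n = 0 then e 0 else if n = 1 then e 1 else e 2) q" using a e by blast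
    moreover have "eval_fm M e q = eval_fm M (\<lambda>n. if n = 0 then e 0 else if n = 1 then e 1 else e 2) q"
      by (rule eval_fm_cong) (use assms in auto)
    ultimately show "eval_fm M e q" by simp
  qed
qed

lemma sat_Tr_iff:
  "(\<forall>p\<in>Tr. sat M p) \<longleftrightarrow>
     (\<forall>x\<in>univ M. tle M x x) \<and>
     (\<forall>x\<in>univ M. \<forall>y\<in>univ M. tle M x y \<and> tle M y x \<longrightarrow> x = y) \<and>
     (\<forall>x\<in>univ M. \<forall>y\<in>univ M. \<forall>z\<in>univ M. tle M x y \<and> tle M y z \<longrightarrow> tle M x z) \<and>
     (\<forall>x\<in>univ M. \<forall>y\<in>univ M. \<forall>z\<in>univ M. tle M y x \<and> tle M z x \<longrightarrow> tle M y z \<or> tle M z y) \<and>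
     (\<forall>x\<in>univ M. \<forall>y\<in>univ M. tle M (tmeet M x y) x \<and> tle M (tmeet M x y) y) \<and>
     (\<forall>x\<in>univ M. \<forall>y\<in>univ M. \<forall>z\<in>univ M. tle M z x \<and> tle M z y \<longrightarrow> tle M z (tmeet M x y))"
proof -
  let ?x = "Var 0 :: tree_fun tm" and ?y = "Var 1 :: tree_fun tm" and ?z = "Var 2 :: tree_fun tm"
  have "sat M (leq ?x ?x) \<longleftrightarrow> (\<forall>x\<in>univ M. tle M x x)"
    by (subst sat_three_variables) auto
  moreover have "sat M (Imp (And (leq ?x ?y) (leq ?y ?x)) (Eq ?x ?y)) \<longleftrightarrow>
      (\<forall>x\<in>univ M. \<forall>y\<in>univ M. tle M x y \<and> tle M y x \<longrightarrow> x = y)"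
    by (subst sat_three_variables) auto
  moreover have "sat M (Imp (And (leq ?x ?y) (leq ?y ?z)) (leq ?x ?z)) \<longleftrightarrow>
      (\<forall>x\<in>univ M. \<forall>y\<in>univ M. \<forall>z\<in>univ M. tle M x y \<and> tle M y z \<longrightarrow> tle M x z)"
    by (subst sat_three_variables) auto
  moreover have "sat M (Imp (And (leq ?y ?x) (leq ?z ?x)) (Or (leq ?y ?z) (leq ?z ?y))) \<longleftrightarrow>
      (\<forall>x\<in>univ M. \<forall>y\<in>univ M. \<forall>z\<in>univ M. tle M y x \<and> tle M z x \<longrightarrow> tle M y z \<or> tle M z y)"
    by (subst sat_three_variables) auto
  moreover have "sat M (And (leq (meet ?x ?y) ?x) (leq (meet ?x ?y) ?y)) \<longleftrightarrow>
      (\<forall>x\<in>univ M. \<forall>y\<in>univ M. tle M (tmeet M x y) x \<and> tle M (tmeet M x y) y)"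
    by (subst sat_three_variables) auto
  moreover have "sat M (Imp (And (leq ?z ?x) (leq ?z ?y)) (leq ?z (meet ?x ?y))) \<longleftrightarrow>
      (\<forall>x\<in>univ M. \<forall>y\<in>univ M. \<forall>z\<in>univ M. tle M z x \<and> tle M z y \<longrightarrow> tle M z (tmeet M x y))"
    by (subst sat_three_variables) auto
  ultimately show ?thesis unfolding Tr_def Let_def by (simp only: ball_simps sat_foralls HOL.simp_thms)
qed

lemma sat_OC_iff:
  fixes M :: "(tree_fun, 'r tree_rel, 'a) struct" and L :: "('f, 'r) lang"
  shows
  "(\<forall>p\<in>OC L. sat M p) \<longleftrightarrow> (\<forall>r\<in>rels L. \<forall>c\<in>univ M. \<forall>as. set as \<subseteq> univ M \<and> length as = rarity L r \<and>
     relation M (Star r) (c # as) \<longrightarrow> (\<forall>a\<in>set as. tle M c a \<and> c \<noteq> a))"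
proof -
  have "sat M (Imp (Rel (Star r) (map Var (0 # [1..<n + 1]))) (conj_list (map (\<lambda>i. lt (Var 0) (Var (1 + i))) [0..<n])))
    \<longleftrightarrow> (\<forall>c\<in>univ M. \<forall>as. set as \<subseteq> univ M \<and> length as = n \<and> relation M (Star r) (c # as) \<longrightarrow> (\<forall>a\<in>set as. tle M c a \<and> c \<noteq> a))"
    (is "?l \<longleftrightarrow> ?r") for r n
  proof
    assume l: ?l
    show ?r
    proof (intro ballI allI impI)
      fix c as a assume c: "c \<in> univ M" and as: "set as \<subseteq> univ M \<and> length as = n \<and> relation M (Star r) (c # as)"
        and a: "a \<in> set as"
      define e where "e i = (if i = 0 \<or> i > n then c else as ! (i - 1))" for i
      have e: "\<forall>i. e i \<in> univ M" using c as by (auto simp: e_def subset_iff)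
      have m: "map e [1..<n + 1] = as" by (rule nth_equalityI) (use as in \<open>auto simp: e_def simp del: upt_Suc\<close>)
      have e0: "e 0 = c" by (simp add: e_def)
      obtain i where i: "i < n" "as ! i = a" using a as by (auto simp: in_set_conv_nth)
      have "eval_fm M e (Imp (Rel (Star r) (map Var (0 # [1..<n + 1]))) (conj_list (map (\<lambda>i. lt (Var 0) (Var (1 + i))) [0..<n])))"
        using l e unfolding sat_def by blast
      then have "\<forall>i<n. tle M (e 0) (e (1 + i)) \<and> e 0 \<noteq> e (1 + i)"
        using as m e0 by (simp add: comp_def del: upt_Suc)
      then show "tle M c a \<and> c \<noteq> a" using i by (auto simp: e_def)
    qed
  next
    assume r: ?r
    show ?l unfolding sat_def
    proof (intro allI impI)
      fix e :: "nat \<Rightarrow> 'a" assume e: "\<forall>n. e n \<in> univ M"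
      have "set (map e [1..<n + 1]) \<subseteq> univ M" "length (map e [1..<n + 1]) = n" using e by auto
      then have "\<forall>a\<in>set (map e [1..<n + 1]). tle M (e 0) a \<and> e 0 \<noteq> a" if "relation M (Star r) (e 0 # map e [1..<n + 1])"
        using r e that by blast
      then have "\<forall>i<n. tle M (e 0) (e (1 + i)) \<and> e 0 \<noteq> e (1 + i)" if "relation M (Star r) (e 0 # map e [1..<n + 1])"
        using that by (simp del: upt_Suc)
      then show "eval_fm M e (Imp (Rel (Star r) (map Var (0 # [1..<n + 1]))) (conj_list (map (\<lambda>i. lt (Var 0) (Var (1 + i))) [0..<n])))"
        by (simp add: comp_def del: upt_Suc)
    qed
  qed
  then show ?thesis by (simp add: OC_def Let_def)
qed

lemma sat_WD_iff:
  fixes M :: "(tree_fun, 'r tree_rel, 'a) struct" and L :: "('f, 'r) lang"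
  shows
  "(\<forall>p\<in>WD L. sat M p) \<longleftrightarrow> (\<forall>r\<in>rels L. \<forall>c\<in>univ M. \<forall>as bs. set as \<subseteq> univ M \<and> set bs \<subseteq> univ M \<and>
     length as = rarity L r \<and> list_all2 (\<lambda>a b. tle M c (tmeet M a b) \<and> c \<noteq> tmeet M a b) as bs \<and>
     relation M (Star r) (c # as) \<longrightarrow> relation M (Star r) (c # bs))"
proof -
  have "sat M (Imp (And (Rel (Star r) (map Var (0 # [1..<n + 1])))
            (conj_list (map (\<lambda>i. lt (Var 0) (meet (Var (1 + i)) (Var (1 + n + i)))) [0..<n])))
       (Rel (Star r) (map Var (0 # [1 + n..<2 * n + 1]))))
    \<longleftrightarrow> (\<forall>c\<in>univ M. \<forall>as bs. set as \<subseteq> univ M \<and> set bs \<subseteq> univ M \<and>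
     length as = n \<and> list_all2 (\<lambda>a b. tle M c (tmeet M a b) \<and> c \<noteq> tmeet M a b) as bs \<and>
     relation M (Star r) (c # as) \<longrightarrow> relation M (Star r) (c # bs))"
    (is "sat M ?p \<longleftrightarrow> ?r") for r n
  proof -
    have ev: "eval_fm M e ?p \<longleftrightarrow> (relation M (Star r) (e 0 # map e [1..<n + 1]) \<and>
      list_all2 (\<lambda>a b. tle M (e 0) (tmeet M a b) \<and> e 0 \<noteq> tmeet M a b) (map e [1..<n + 1]) (map e [1 + n..<2 * n + 1]) \<longrightarrow>
      relation M (Star r) (e 0 # map e [1 + n..<2 * n + 1]))" for e
      by (simp add: comp_def list_all2_conv_all_nth Ball_def del: upt_Suc)
    show ?thesis
    proof
      assume l: "sat M ?p"
      show ?r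
      proof (intro ballI allI impI)
        fix c as bs assume c: "c \<in> univ M" and as: "set as \<subseteq> univ M \<and> set bs \<subseteq> univ M \<and>
          length as = n \<and> list_all2 (\<lambda>a b. tle M c (tmeet M a b) \<and> c \<noteq> tmeet M a b) as bs \<and>
          relation M (Star r) (c # as)"
        define e where "e i = (if i = 0 \<or> i > 2 * n then c else if i \<le> n then as ! (i - 1) else bs ! (i - 1 - n))" for i
        have len: "length as = n" "length bs = n" using as by (auto dest: list_all2_lengthD)
        have e: "\<forall>i. e i \<in> univ M" using c as len by (auto simp: e_def subset_iff)
        have m: "map e [1..<n + 1] = as" "map e [1 + n..<2 * n + 1] = bs"
          by (rule nth_equalityI; use len in \<open>auto simp: e_def simp del: upt_Suc\<close>)+
        have e0: "e 0 = c" by (simp add: e_def)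
        have "eval_fm M e ?p" using l e unfolding sat_def by blast
        then show "relation M (Star r) (c # bs)" using as unfolding ev m e0 by blast
      qed
    next
      assume r: ?r
      show "sat M ?p" unfolding sat_def
      proof (intro allI impI)
        fix e :: "nat \<Rightarrow> 'a" assume e: "\<forall>n. e n \<in> univ M"
        have "set (map e [1..<n + 1]) \<subseteq> univ M" "set (map e [1 + n..<2 * n + 1]) \<subseteq> univ M"
          "length (map e [1..<n + 1]) = n" using e by auto
        then show "eval_fm M e ?p" unfolding ev using r e by blast
      qed
    qed
  qed
  then show ?thesis by (simp only: WD_def Let_def ball_simps sat_foralls)
qed

lemma sat_tree_axioms_iff:
  fixes M :: "(tree_fun, 'r tree_rel, 'a) struct"
  assumes L: "finite_relational L" and cl: "closed_under (star_lang L) M (univ M)"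
  shows "(\<forall>p\<in>Tr \<union> WD L \<union> OC L. sat M p) \<longleftrightarrow> star_tree L M"
proof
  assume a: "\<forall>p\<in>Tr \<union> WD L \<union> OC L. sat M p"
  then have "\<forall>p\<in>Tr. sat M p" "\<forall>p\<in>WD L. sat M p" "\<forall>p\<in>OC L. sat M p" by auto
  note Tr = this(1)[unfolded sat_Tr_iff] and WD = this(2)[unfolded sat_WD_iff] and OC = this(3)[unfolded sat_OC_iff]
  show "star_tree L M"
  proof unfold_locales
    show "rarity L r > 0" if "r \<in> rels L" for r using L that by (auto simp: finite_relational_def)
    show "tmeet M x y \<in> univ M" if "x \<in> univ M" "y \<in> univ M" for x y
      using cl that by (simp add: closed_under_star_lang)
    show "set as \<subseteq> above M c" if "r \<in> rels L" "c \<in> univ M" "set as \<subseteq> univ M" "length as = rarity L r"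
      "relation M (Star r) (c # as)" for r c as
      using OC that unfolding above_def by blast
    show "relation M (Star r) (c # bs)" if r: "r \<in> rels L" "c \<in> univ M" "length as = rarity L r"
      and l: "list_all2 (\<lambda>a b. (a, b) \<in> cone_rel M c) as bs" and "relation M (Star r) (c # as)" for r c as bs
    proof -
      have "list_all2 (\<lambda>a b. tle M c (tmeet M a b) \<and> c \<noteq> tmeet M a b) as bs"
        using l by (rule list_all2_mono) (auto simp: cone_rel_def above_def)
      moreover have "set as \<subseteq> univ M" "set bs \<subseteq> univ M"
        using l by (auto simp: list_all2_conv_all_nth in_set_conv_nth cone_rel_def above_def)
      ultimately show ?thesis using WD[rule_format, of r c as bs] that by blast
    qed
    note T = Tr[THEN conjunct1] Tr[THEN conjunct2, THEN conjunct1]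
      Tr[THEN conjunct2, THEN conjunct2, THEN conjunct1]
      Tr[THEN conjunct2, THEN conjunct2, THEN conjunct2, THEN conjunct1]
      Tr[THEN conjunct2, THEN conjunct2, THEN conjunct2, THEN conjunct2, THEN conjunct1]
      Tr[THEN conjunct2, THEN conjunct2, THEN conjunct2, THEN conjunct2, THEN conjunct2]
    show "tle M x x" if "x \<in> univ M" for x using T(1) that by blast
    show "x = y" if "x \<in> univ M" "y \<in> univ M" "tle M x y" "tle M y x" for x y using T(2) that by blast
    show "tle M x z" if "x \<in> univ M" "y \<in> univ M" "z \<in> univ M" "tle M x y" "tle M y z" for x y z
      using T(3) that by blast
    show "tle M y z \<or> tle M z y" if "x \<in> univ M" "y \<in> univ M" "z \<in> univ M" "tle M y x" "tle M z x" for x y z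
      using T(4) that by blast
    show "tle M (tmeet M x y) x" "tle M (tmeet M x y) y" if "x \<in> univ M" "y \<in> univ M" for x y
      using T(5) that by blast+
    show "tle M z (tmeet M x y)" if "x \<in> univ M" "y \<in> univ M" "z \<in> univ M" "tle M z x" "tle M z y" for x y z
      using T(6) that by blast
  qed
next
  assume "star_tree L M"
  then interpret star_tree L M .
  have "\<forall>p\<in>Tr. sat M p" unfolding sat_Tr_iff
  proof (intro conjI ballI impI; (elim conjE)?)
    show "x = y" if "x \<in> univ M" "y \<in> univ M" "tle M x y" "tle M y x" for x y using antisym that by blast
    show "tle M x z" if "x \<in> univ M" "y \<in> univ M" "z \<in> univ M" "tle M x y" "tle M y z" for x y z
      using trans that by blast
    show "tle M y z \<or> tle M z y" if "x \<in> univ M" "y \<in> univ M" "z \<in> univ M" "tle M y x" "tle M z x" for x y z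
      using below_linear that by blast
  qed (simp_all add: refl meet_le1 meet_le2 meet_greatest)
  moreover have "\<forall>p\<in>OC L. sat M p" unfolding sat_OC_iff
    using rel_above unfolding above_def by blast
  moreover have "\<forall>p\<in>WD L. sat M p" unfolding sat_WD_iff
  proof (intro ballI allI impI)
    fix r c as bs assume r: "r \<in> rels L" "c \<in> univ M"
      and a: "set as \<subseteq> univ M \<and> set bs \<subseteq> univ M \<and> length as = rarity L r \<and>
        list_all2 (\<lambda>a b. tle M c (tmeet M a b) \<and> c \<noteq> tmeet M a b) as bs \<and> relation M (Star r) (c # as)"
    have "list_all2 (\<lambda>a b. (a, b) \<in> cone_rel M c) as bs"
      using a r(2) meet_closed by (auto simp: list_all2_conv_all_nth cone_rel_iff above_def subset_iff)
    then show "relation M (Star r) (c # bs)" using rel_cone r a by blast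
  qed
  ultimately show "\<forall>p\<in>Tr \<union> WD L \<union> OC L. sat M p" by blast
qed

lemma wf_star_tm [simp]: "wf_tm L (star_tm t)"
  by (cases t) (auto simp: star_tm_def)

lemma wf_star: "wf_fm L p \<Longrightarrow> wf_fm (star_lang L) (star x p)"
  by (induction p) (auto simp: list_all_iff)

lemma quantifier_free_star [simp]: "quantifier_free p \<Longrightarrow> quantifier_free (star x p)"
  by (induction p) auto

lemma free_vars_star:
  assumes "funs L = {}" "wf_fm L p"
  shows "free_vars (star x p) \<subseteq> insert x (free_vars p)"
  using assms(2)
proof (induction p)
  case (Eq s t)
  then show ?case using star_tm_Var[OF _ assms(1), of s] star_tm_Var[OF _ assms(1), of t] by auto
next
  case (Rel r ts)
  then show ?case using star_tm_Var[OF _ assms(1)] by (fastforce simp: list_all_iff)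
qed auto

text \<open>For \<open>embedding_model_of_universal\<close> and \<open>model_of_locally_in\<close>: the models pass to
  substructures, and a structure is a model if its finite pieces are.\<close>
lemma universal_T_star_forall:
  assumes L: "finite_relational L" and u: "universal_theory L TA"
  shows "universal_theory (star_lang L) (T_star_forall L TA)"
  unfolding universal_theory_def
proof
  fix p assume p: "p \<in> T_star_forall L TA"
  consider "p \<in> Tr" | "p \<in> WD L" | "p \<in> OC L" | "p \<in> star_axioms L TA"
    using p by (auto simp: T_star_forall_def)
  then show "\<exists>ys q. p = foralls ys q \<and> quantifier_free q \<and> wf_fm (star_lang L) q \<and> free_vars q \<subseteq> set ys"
  proof cases
    case 1
    have I: "\<exists>ys q. p = foralls ys q \<and> quantifier_free q \<and> wf_fm (star_lang L) q \<and> free_vars q \<subseteq> set ys"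
      if "p = foralls ys q" "quantifier_free q" "wf_fm (star_lang L) q" "free_vars q \<subseteq> set ys" for ys q
      using that by blast
    from 1 show ?thesis unfolding Tr_def Let_def by (elim insertE emptyE) (erule I; simp)+
  next
    case 2
    then obtain r where r: "r \<in> rels L" and p: "p = foralls [0..<2 * rarity L r + 1] (Imp
       (And (Rel (Star r) (map Var (0 # [1..<rarity L r + 1])))
            (conj_list (map (\<lambda>i. lt (Var 0) (meet (Var (1 + i)) (Var (1 + rarity L r + i)))) [0..<rarity L r])))
       (Rel (Star r) (map Var (0 # [1 + rarity L r..<2 * rarity L r + 1]))))"
      by (auto simp only: WD_def Let_def image_iff)
    show ?thesis
      by (rule exI, rule exI, rule conjI, rule p) (use r in \<open>auto simp: list_all_iff simp del: upt_Suc\<close>)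
  next
    case 3
    then obtain r where r: "r \<in> rels L" and p: "p = foralls [0..<rarity L r + 1] (Imp
       (Rel (Star r) (map Var (0 # [1..<rarity L r + 1])))
       (conj_list (map (\<lambda>i. lt (Var 0) (Var (1 + i))) [0..<rarity L r])))"
      by (auto simp only: OC_def Let_def image_iff)
    show ?thesis
      by (rule exI, rule exI, rule conjI, rule p) (use r in \<open>auto simp: list_all_iff simp del: upt_Suc\<close>)
  next
    case 4
    then obtain x ys q where p: "p = foralls (x # ys) (Imp (conj_list (map (\<lambda>y. lt (Var x) (Var y)) ys)) (star x q))"
      and q: "foralls ys q \<in> TA" "quantifier_free q" "free_vars q \<subseteq> set ys"
      unfolding star_axioms_def by blast
    have "wf_fm L (foralls ys q)" using u q(1) unfolding universal_theory_def by fastforce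
    then have wf: "wf_fm L q" by simp
    have fl: "funs L = {}" using L by (simp add: finite_relational_def)
    show ?thesis
      by (rule exI, rule exI, rule conjI, rule p) (use q wf wf_star[OF wf] free_vars_star[OF fl wf, of x] in auto)
  qed
qed

text \<open>The model \<open>N\<close> of \<open>TA\<close> matters for the axioms of \<open>TA\<close> without variables: their starred
  versions also constrain centers with no cone above them, and there they hold because they
  hold in \<open>N\<close>.\<close>
lemma model_of_T_star_forall_iff:
  fixes M :: "(tree_fun, 'r tree_rel, 'a) struct" and L :: "('f, 'r) lang"
  assumes L: "finite_relational L" and u: "universal_theory L TA" and K: "model_of L (N :: ('f, 'r, 'b) struct) TA"
  shows "model_of (star_lang L) M (T_star_forall L TA) \<longleftrightarrow>
    univ M \<noteq> {} \<and> star_tree L M \<and> (\<forall>c\<in>univ M. \<forall>R. transversal M c R \<and> R \<noteq> {} \<longrightarrow> model_of L (rep M c R :: ('f, 'r, 'a) struct) TA)"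
    (is "?l \<longleftrightarrow> ?r")
proof
  assume l: ?l
  then have ne: "univ M \<noteq> {}" and tree: "star_tree L M"
    using sat_tree_axioms_iff[OF L] by (auto simp: model_of_def is_struct_def T_star_forall_def)
  interpret star_tree L M by (rule tree)
  have fl: "funs L = {}" using L by (simp add: finite_relational_def)
  have "model_of L (rep M c R :: ('f, 'r, 'a) struct) TA" if c: "c \<in> univ M" and R: "transversal M c R" and Rne: "R \<noteq> {}" for c R
    unfolding model_of_def
  proof (intro conjI ballI)
    show "is_struct L (rep M c R :: ('f, 'r, 'a) struct)" using Rne fl by (simp add: is_struct_def closed_under_def)
    fix p assume p: "p \<in> TA"
    then obtain ys q where q: "p = foralls ys q" "quantifier_free q" "wf_fm L q" "free_vars q \<subseteq> set ys"
      using u unfolding universal_theory_def by blast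
    obtain x where x: "x \<notin> set ys" using ex_new_if_finite[of "set ys"] by auto
    have "foralls (x # ys) (Imp (conj_list (map (\<lambda>y. lt (Var x) (Var y)) ys)) (star x q)) \<in> T_star_forall L TA"
      unfolding T_star_forall_def star_axioms_def using p q x by blast
    then have "sat M (foralls (x # ys) (Imp (conj_list (map (\<lambda>y. lt (Var x) (Var y)) ys)) (star x q)))"
      using l unfolding model_of_def by blast
    then have s: "sat M (Imp (conj_list (map (\<lambda>y. lt (Var x) (Var y)) ys)) (star x q))"
      by (simp only: sat_foralls)
    have RA: "R \<subseteq> above M c" using R by (simp add: transversal_def)
    have "eval_fm (rep M c R :: ('f, 'r, 'a) struct) \<rho> q" if \<rho>: "\<forall>n. \<rho> n \<in> R" for \<rho>
    proof -
      have "\<forall>n. (\<rho>(x := c)) n \<in> univ M" using \<rho> RA above_univ c by auto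
      then have "eval_fm M (\<rho>(x := c)) (Imp (conj_list (map (\<lambda>y. lt (Var x) (Var y)) ys)) (star x q))"
        using s unfolding sat_def by blast
      moreover have "\<forall>y\<in>set ys. tle M c (\<rho> y) \<and> c \<noteq> \<rho> y" using \<rho> RA by (auto simp: above_def)
      ultimately have "eval_fm M (\<rho>(x := c)) (star x q)" using x by (auto split: if_splits)
      moreover have "eval_fm M (\<rho>(x := c)) (star x q) = eval_fm (rep M c R :: ('f, 'r, 'a) struct) \<rho> q"
        by (rule eval_star_rep[OF fl c R q(2,3)]) (use q(4) x \<rho> RA cone_rel_refl[OF c] in auto)
      ultimately show ?thesis by simp
    qed
    then have "sat (rep M c R :: ('f, 'r, 'a) struct) q" by (simp add: sat_def)
    then show "sat (rep M c R :: ('f, 'r, 'a) struct) p" by (simp add: q(1))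
  qed
  then show ?r using ne tree by blast
next
  assume r: ?r
  then interpret star_tree L M by simp
  have fl: "funs L = {}" using L by (simp add: finite_relational_def)
  have cl: "closed_under (star_lang L) M (univ M)" by (simp add: closed_under_star_lang meet_closed)
  have tree: "\<forall>p\<in>Tr \<union> WD L \<union> OC L. sat M p" using sat_tree_axioms_iff[OF L cl] r by blast
  have "sat M p" if "p \<in> star_axioms L TA" for p
  proof -
    obtain x ys q where p: "p = foralls (x # ys) (Imp (conj_list (map (\<lambda>y. lt (Var x) (Var y)) ys)) (star x q))"
      and q: "foralls ys q \<in> TA" "quantifier_free q" "free_vars q \<subseteq> set ys" "x \<notin> set ys"
      using \<open>p \<in> star_axioms L TA\<close> unfolding star_axioms_def by blast
    have "wf_fm L (foralls ys q)" using u q(1) unfolding universal_theory_def by fastforce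
    then have wf: "wf_fm L q" by simp
    have "eval_fm M e (star x q)" if e: "\<forall>n. e n \<in> univ M" and ab: "\<forall>y\<in>set ys. e y \<in> above M (e x)" for e
    proof (cases "ys = []")
      case True
      obtain n where n: "n \<in> univ N" using K by (auto simp: model_of_def is_struct_def)
      have 1: "eval_fm M e (star x q) = eval_fm (rep M (e x) {} :: ('f, 'r, 'a) struct) e q"
        by (rule eval_star_rep[OF fl _ _ q(2) wf]) (use e q(3) True in \<open>auto simp: transversal_def\<close>)
      have "partial_iso L (rep M (e x) {} :: ('f, 'r, 'a) struct) N {} (\<lambda>_. n)"
        by (rule partial_iso_empty) (use L in \<open>auto simp: finite_relational_def\<close>)
      then have "eval_fm N ((\<lambda>_. n) \<circ> e) q = eval_fm (rep M (e x) {} :: ('f, 'r, 'a) struct) e q"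
        by (intro embedding_eval_quantifier_free[OF _ _ q(2) wf])
          (use q(3) True closed_under_relational[OF fl] in \<open>auto simp: partial_iso_def\<close>)
      moreover have "sat N (foralls ys q)" using K q(1) unfolding model_of_def by blast
      then have "sat N q" by simp
      then have "eval_fm N ((\<lambda>_. n) \<circ> e) q" using n by (simp add: sat_def)
      ultimately show ?thesis using 1 by simp
    next
      case False
      have ex: "e x \<in> univ M" using e by blast
      have "transversal M (e x) {}" by (simp add: transversal_def)
      then obtain R \<rho> where R: "transversal M (e x) R" "\<forall>a\<in>above M (e x). \<rho> a \<in> R \<and> (\<rho> a, a) \<in> cone_rel M (e x)"
        by (rule transversal_extend[OF ex order_refl _ empty_subsetI])
      obtain y where y: "y \<in> set ys" using False by (meson last_in_set)
      define \<sigma> where "\<sigma> n = (if n \<in> set ys then \<rho> (e n) else \<rho> (e y))" for n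
      have \<sigma>: "\<sigma> n \<in> R" for n using R(2) ab y by (auto simp: \<sigma>_def)
      then have "model_of L (rep M (e x) R :: ('f, 'r, 'a) struct) TA" using r R(1) ex by blast
      then have "sat (rep M (e x) R :: ('f, 'r, 'a) struct) (foralls ys q)" using q(1) unfolding model_of_def by blast
      then have "sat (rep M (e x) R :: ('f, 'r, 'a) struct) q" by simp
      then have "eval_fm (rep M (e x) R :: ('f, 'r, 'a) struct) \<sigma> q" using \<sigma> by (simp add: sat_def)
      moreover have "eval_fm M e (star x q) = eval_fm (rep M (e x) R :: ('f, 'r, 'a) struct) \<sigma> q"
        by (rule eval_star_rep[OF fl ex R(1) q(2) wf]) (use \<sigma> q(3) R(2) ab in \<open>auto simp: \<sigma>_def\<close>)
      ultimately show ?thesis by simp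
    qed
    then show ?thesis unfolding p sat_foralls by (auto simp: sat_def above_def)
  qed
  then show ?l using tree r cl by (auto simp: model_of_def is_struct_def T_star_forall_def)
qed

section \<open>One-point extensions of trees\<close>

text \<open>The tree \<open>B\<close> has one point \<open>b\<close> more than the closed set \<open>T\<close>, which is already embedded into
  \<open>M\<close>. A place \<open>a\<close> for \<open>b\<close> has to be found.\<close>
locale one_point_extension = B: star_tree L B + M: star_tree L M
  for L :: "('f, 'r) lang" and B :: "(tree_fun, 'r tree_rel, 'b) struct"
    and M :: "(tree_fun, 'r tree_rel, 'a) struct" +
  fixes T :: "'b set" and k :: "'b \<Rightarrow> 'a" and b :: 'b
  assumes T: "finite T" "T \<subseteq> univ B" "closed_under (star_lang L) B T"
    and k: "embedding (star_lang L) (B\<lparr>univ := T\<rparr>) M k"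
    and b: "b \<in> univ B" "b \<notin> T" "univ B = insert b T"
begin

lemma TU: "t \<in> T \<Longrightarrow> t \<in> univ B"
  using T by blast

lemma T_meet: "x \<in> T \<Longrightarrow> y \<in> T \<Longrightarrow> tmeet B x y \<in> T"
  using T by (simp add: closed_under_star_lang)

lemmas k_simps = embedding_star_langD[OF k, simplified]

lemma k_univ: "t \<in> T \<Longrightarrow> k t \<in> univ M"
  by (rule k_simps(1))

lemma k_inj: "x \<in> T \<Longrightarrow> y \<in> T \<Longrightarrow> k x = k y \<longleftrightarrow> x = y"
  by (rule k_simps(2))

lemma k_meet: "x \<in> T \<Longrightarrow> y \<in> T \<Longrightarrow> k (tmeet B x y) = tmeet M (k x) (k y)"
  by (rule k_simps(3))

lemma k_le: "x \<in> T \<Longrightarrow> y \<in> T \<Longrightarrow> tle M (k x) (k y) \<longleftrightarrow> tle B x y"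
  by (rule k_simps(4)[symmetric])

lemma k_rel: "r \<in> rels L \<Longrightarrow> length ys = rarity L r \<Longrightarrow> x \<in> T \<Longrightarrow> set ys \<subseteq> T \<Longrightarrow>
    relation M (Star r) (k x # map k ys) \<longleftrightarrow> relation B (Star r) (x # ys)"
  by (rule k_simps(6)[symmetric])

lemma k_above: "x \<in> T \<Longrightarrow> y \<in> T \<Longrightarrow> k y \<in> above M (k x) \<longleftrightarrow> y \<in> above B x"
  using k_le k_univ TU k_inj by (auto simp: above_def)

lemma k_cone: "c \<in> T \<Longrightarrow> x \<in> T \<Longrightarrow> y \<in> T \<Longrightarrow> (k x, k y) \<in> cone_rel M (k c) \<longleftrightarrow> (x, y) \<in> cone_rel B c"
  using k_above[of c "tmeet B x y"] k_meet[of x y] T_meet[of x y]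
  by (simp add: B.cone_rel_iff M.cone_rel_iff TU k_univ)

text \<open>The order is determined by the meets, and by (OC) a relation can only hold of elements above
  its center.\<close>
lemma embedding_of_point:
  assumes a: "a \<in> univ M" "a \<notin> k ` T"
    and meet: "\<And>t. t \<in> T \<Longrightarrow> (k(b := a)) (tmeet B b t) = tmeet M a (k t)"
    and star: "\<And>x r ys. x \<in> univ B \<Longrightarrow> r \<in> rels L \<Longrightarrow> length ys = rarity L r \<Longrightarrow> set ys \<subseteq> above B x \<Longrightarrow>
      relation B (Star r) (x # ys) \<longleftrightarrow> relation M (Star r) ((k(b := a)) x # map (k(b := a)) ys)"
  shows "embedding (star_lang L) B M (k(b := a))"
proof -
  define g where "g = k(b := a)"
  have gT: "g t = k t" if "t \<in> T" for t using that b(2) by (auto simp: g_def)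
  have gb: "g b = a" by (simp add: g_def)
  have gU: "g x \<in> univ M" if "x \<in> univ B" for x using that b(3) a(1) gT gb k_univ by auto
  have inj: "inj_on g (univ B)"
  proof -
    have "inj_on g T" using gT k_inj by (simp add: inj_on_def)
    moreover have "g ` T = k ` T" using gT by (rule image_cong[OF HOL.refl])
    ultimately show ?thesis using a(2) gb b(2,3) by simp
  qed
  have g_meet: "g (tmeet B x y) = tmeet M (g x) (g y)" if xy: "x \<in> univ B" "y \<in> univ B" for x y
  proof -
    have bT: "g (tmeet B b t) = tmeet M (g b) (g t)" if "t \<in> T" for t
      using meet[OF that] gT[OF that] gb by (simp add: g_def)
    consider "x \<in> T" "y \<in> T" | "x = b" "y = b" | "x = b" "y \<in> T" | "y = b" "x \<in> T"
      using xy b(3) by auto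
    then show ?thesis
    proof cases
      case 1
      then show ?thesis using k_meet T_meet gT by simp
    next
      case 2
      then show ?thesis using B.le_iff_meet[of b b] B.refl b(1) M.le_iff_meet[of a a] M.refl a(1) gb by simp
    next
      case 3
      then show ?thesis using bT by simp
    next
      case 4
      then show ?thesis using bT B.meet_commute[of x y] M.meet_commute[of "g x" "g y"] xy gU by simp
    qed
  qed
  have g_le: "tle B x y \<longleftrightarrow> tle M (g x) (g y)" if xy: "x \<in> univ B" "y \<in> univ B" for x y
  proof -
    have "tle B x y \<longleftrightarrow> tmeet B x y = x" using B.le_iff_meet xy by blast
    also have "\<dots> \<longleftrightarrow> g (tmeet B x y) = g x" using inj_on_eq_iff[OF inj] B.meet_closed xy by blast
    also have "\<dots> \<longleftrightarrow> tle M (g x) (g y)" using g_meet[OF xy] M.le_iff_meet gU xy by simp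
    finally show ?thesis .
  qed
  have g_above: "y \<in> above B x \<longleftrightarrow> g y \<in> above M (g x)" if "x \<in> univ B" "y \<in> univ B" for x y
    using g_le that gU inj_on_eq_iff[OF inj] by (auto simp: above_def)
  have g_star: "relation B (Star r) (x # ys) \<longleftrightarrow> relation M (Star r) (g x # map g ys)"
    if r: "r \<in> rels L" "length ys = rarity L r" "x \<in> univ B" "set ys \<subseteq> univ B" for r x ys
  proof (cases "set ys \<subseteq> above B x")
    case True
    then show ?thesis using star r by (simp add: g_def)
  next
    case False
    then have "\<not> relation B (Star r) (x # ys)" using B.rel_above r by blast
    moreover obtain y where y: "y \<in> set ys" "y \<notin> above B x" using False by blast
    then have "g y \<notin> above M (g x)" "g y \<in> set (map g ys)" using g_above r(3,4) by auto
    then have "\<not> relation M (Star r) (g x # map g ys)"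
      using M.rel_above[of r "g x" "map g ys"] r gU by (metis (no_types, lifting) image_subset_iff length_map list.set_map subset_iff)
    ultimately show ?thesis by blast
  qed
  have "embedding (star_lang L) B M g"
    by (rule embedding_star_langI) (use gU inj g_meet g_le g_star in blast)+
  then show ?thesis by (simp add: g_def)
qed

text \<open>By (WD) the new point can be traded for an old point \<open>m\<close> of the same cone, and \<open>k\<close> already
  respects the relations between old points.\<close>
lemma star_replace:
  assumes x: "x \<in> T" and m: "m \<in> T" and r: "r \<in> rels L" "length ys = rarity L r" and ys: "set ys \<subseteq> above B x"
    and rep: "b \<in> set ys \<Longrightarrow> (b, m) \<in> cone_rel B x \<and> (a, k m) \<in> cone_rel M (k x)"
  shows "relation B (Star r) (x # ys) \<longleftrightarrow> relation M (Star r) ((k(b := a)) x # map (k(b := a)) ys)"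
proof -
  let ?f = "\<lambda>y. if y = b then m else y"
  have ysT: "y \<in> T" if "y \<in> set ys" "y \<noteq> b" for y using that ys b(3) by (auto simp: above_def)
  have "relation B (Star r) (x # map (\<lambda>y. y) ys) \<longleftrightarrow> relation B (Star r) (x # map ?f ys)"
    using rep ys TU[OF x] B.cone_rel_refl by (intro B.rel_cong[OF r(1) _ r(2)]) auto
  also have "\<dots> \<longleftrightarrow> relation M (Star r) (k x # map k (map ?f ys))"
    using ysT m x r by (intro k_rel[symmetric]) auto
  also have "\<dots> \<longleftrightarrow> relation M (Star r) (k x # map (\<lambda>y. k (?f y)) ys)" by (simp add: comp_def)
  also have "\<dots> \<longleftrightarrow> relation M (Star r) (k x # map (k(b := a)) ys)"
  proof (rule M.rel_cong[OF r(1) k_univ[OF x] r(2)])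
    fix y assume y: "y \<in> set ys"
    show "(k (?f y), (k(b := a)) y) \<in> cone_rel M (k x)"
    proof (cases "y = b")
      case True
      then show ?thesis using rep y M.cone_rel_sym[OF k_univ[OF x]] by auto
    next
      case False
      then have "k y \<in> above M (k x)" using k_above[OF x] ysT y ys by blast
      then show ?thesis using False M.cone_rel_refl[OF k_univ[OF x]] by auto
    qed
  qed
  also have "k x = (k(b := a)) x" using x b(2) by auto
  finally show ?thesis by (simp only: list.map_ident)
qed

lemma least_in_meet_closed:
  assumes "finite F" "F \<noteq> {}" "F \<subseteq> W" "W \<subseteq> T" "\<And>x y. x \<in> W \<Longrightarrow> y \<in> W \<Longrightarrow> tmeet B x y \<in> W"
  shows "\<exists>m\<in>W. \<forall>t\<in>F. tle B m t"
  using assms(1,2,3)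
proof (induction F rule: finite_ne_induct)
  case (singleton x)
  then show ?case using B.refl TU assms(4) by blast
next
  case (insert x F)
  then obtain m where m: "m \<in> W" "\<forall>t\<in>F. tle B m t" by auto
  have U: "x \<in> univ B" "m \<in> univ B" "F \<subseteq> univ B" using insert.prems m(1) assms(4) TU by auto
  have "tle B (tmeet B x m) t" if "t \<in> insert x F" for t
    using that m(2) U B.meet_le1[OF U(1,2)] B.meet_le2[OF U(1,2)] B.meet_closed[OF U(1,2)] B.trans[of "tmeet B x m" m t] by blast
  moreover have "tmeet B x m \<in> W" using assms(5) insert.prems m(1) by auto
  ultimately show ?case by blast
qed

lemma greatest_in_chain:
  assumes "finite F" "F \<noteq> {}" "F \<subseteq> T" "\<And>t. t \<in> F \<Longrightarrow> tle B t b"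
  shows "\<exists>c\<in>F. \<forall>t\<in>F. tle B t c"
  using assms
proof (induction F rule: finite_ne_induct)
  case (singleton x)
  then show ?case using B.refl TU by blast
next
  case (insert x F)
  then obtain c where c: "c \<in> F" "\<forall>t\<in>F. tle B t c" by auto
  have U: "x \<in> univ B" "c \<in> univ B" "F \<subseteq> univ B" using insert.prems c(1) TU by auto
  consider "tle B x c" | "tle B c x" using B.below_linear[of b x c] b(1) U insert.prems(2) c(1) by blast
  then show ?case
  proof cases
    case 1
    then show ?thesis using c by blast
  next
    case 2
    then have "\<forall>t\<in>insert x F. tle B t x" using c(2) U B.trans[of _ c x] B.refl by blast
    then show ?thesis by blast
  qed
qed

text \<open>Let \<open>m\<close> be the least old point above \<open>b\<close> and \<open>c\<close> the greatest one below \<open>b\<close>, if there is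
  one. All old points above \<open>b\<close> lie in the cone of \<open>m\<close>, so that the new point is described
  by its position between \<open>c\<close> and \<open>m\<close> and by the type of the one-point structure on this
  cone.\<close>
lemma extend_below:
  fixes K :: "('f, 'r, 'b) struct set"
  assumes t0: "t0 \<in> T" "t0 \<in> above B b"
    and type: "\<And>m. m \<in> above B b \<Longrightarrow> rep B b {m} \<in> K"
    and no_min: "\<And>y. y \<in> univ M \<Longrightarrow> \<exists>x\<in>univ M. y \<in> above M x"
    and insert: "\<And>x y A p. x \<in> univ M \<Longrightarrow> y \<in> above M x \<Longrightarrow> A \<in> K \<Longrightarrow> univ A = {p} \<Longrightarrow>
      \<exists>z\<in>above M x. y \<in> above M z \<and> (\<forall>r\<in>rels L. relation M (Star r) (z # replicate (rarity L r) y)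
        \<longleftrightarrow> relation A r (replicate (rarity L r) p))"
  shows "\<exists>a\<in>univ M. embedding (star_lang L) B M (k(b := a))"
proof -
  let ?W = "T \<inter> above B b"
  have "\<exists>m\<in>?W. \<forall>t\<in>?W. tle B m t"
  proof (rule least_in_meet_closed)
    fix x y assume xy: "x \<in> ?W" "y \<in> ?W"
    then have "tle B b (tmeet B x y)" using B.meet_greatest[of x y b] b(1) by (auto simp: above_def)
    moreover have "tmeet B x y \<in> T" using xy T_meet by auto
    ultimately show "tmeet B x y \<in> ?W" using b(2) TU by (auto simp: above_def)
  qed (use t0 T in auto)
  then obtain m where m: "m \<in> T" "m \<in> above B b" "\<And>t. t \<in> T \<Longrightarrow> t \<in> above B b \<Longrightarrow> tle B m t" by auto
  have le_b: "tle B b t \<longleftrightarrow> t \<in> above B b" if "t \<in> T" for t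
    using that TU b(2) by (auto simp: above_def)
  \<comment> \<open>if no old point is below \<open>b\<close>, then \<open>x\<close> comes from the absence of a minimum\<close>
  have "\<exists>x\<in>univ M. k m \<in> above M x \<and> (\<forall>t\<in>T. tle B t b \<longrightarrow> tle M (k t) x)"
  proof (cases "{t\<in>T. tle B t b} = {}")
    case True
    then show ?thesis using no_min[OF k_univ[OF m(1)]] by blast
  next
    case False
    have "\<exists>c\<in>{t\<in>T. tle B t b}. \<forall>t\<in>{t\<in>T. tle B t b}. tle B t c"
      by (rule greatest_in_chain) (use False T(1) in auto)
    then obtain c where c: "c \<in> T" "tle B c b" "\<forall>t\<in>T. tle B t b \<longrightarrow> tle B t c" by blast
    have "m \<in> above B c" by (rule B.above_trans'[OF TU[OF c(1)] b(1) c(2) m(2)])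
    then have "k m \<in> above M (k c)" using k_above c(1) m(1) by blast
    moreover have "\<forall>t\<in>T. tle B t b \<longrightarrow> tle M (k t) (k c)" using c k_le by blast
    ultimately show ?thesis using k_univ[OF c(1)] by blast
  qed
  then obtain x where x: "x \<in> univ M" "k m \<in> above M x" "\<forall>t\<in>T. tle B t b \<longrightarrow> tle M (k t) x" by blast
  have "univ (rep B b {m} :: ('f, 'r, 'b) struct) = {m}" by simp
  from insert[OF x(1,2) type[OF m(2)] this]
  obtain a where a: "a \<in> above M x" "k m \<in> above M a" "\<forall>r\<in>rels L. relation M (Star r) (a # replicate (rarity L r) (k m))
        \<longleftrightarrow> relation (rep B b {m} :: ('f, 'r, 'b) struct) r (replicate (rarity L r) m)"
    by (elim bexE conjE) (rule that)
  have aU: "a \<in> univ M" using a(1) M.above_univ by blast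
  have lower: "a \<in> above M (k t)" if t: "t \<in> T" "tle B t b" for t
    using M.above_trans'[OF k_univ[OF t(1)] x(1) _ a(1)] x(3) t by blast
  \<comment> \<open>the meet of \<open>t\<close> and \<open>m\<close> is comparable with \<open>b\<close>; if it were below \<open>b\<close>, its image would be below \<open>a\<close>\<close>
  have a_le: "tle M a (k t) \<longleftrightarrow> tle B b t" if t: "t \<in> T" for t
  proof
    assume "tle B b t"
    then have "tle M (k m) (k t)" using k_le m le_b t by blast
    then show "tle M a (k t)" using a(2) M.trans[of a "k m" "k t"] aU k_univ m(1) t by (auto simp: above_def)
  next
    assume at: "tle M a (k t)"
    have "tle M a (k (tmeet B t m))"
      using M.meet_greatest[of "k t" "k m" a] at a(2) aU k_univ m(1) t k_meet by (auto simp: above_def)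
    then have "\<not> tle B (tmeet B t m) b"
      using lower[of "tmeet B t m"] T_meet t m(1) M.antisym[of a "k (tmeet B t m)"] aU k_univ by (auto simp: above_def)
    then have "tle B b (tmeet B t m)"
      using B.below_linear[of m b "tmeet B t m"] B.meet_le2[of t m] TU t m(1,2) b(1) B.meet_closed by (auto simp: above_def)
    then show "tle B b t" using B.trans[of b "tmeet B t m" t] B.meet_le1 TU t m(1) b(1) B.meet_closed by blast
  qed
  have "embedding (star_lang L) B M (k(b := a))"
  proof (rule embedding_of_point[OF aU])
    show "a \<notin> k ` T"
    proof
      assume "a \<in> k ` T"
      then obtain t where t: "t \<in> T" "a = k t" by blast
      then have "tle B b t" using a_le M.refl aU by blast
      then have "tle M (k m) a" using t m le_b k_le by blast
      then show False using a(2) M.antisym[of a "k m"] aU by (auto simp: above_def)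
    qed
  next
    fix t assume t: "t \<in> T"
    show "(k(b := a)) (tmeet B b t) = tmeet M a (k t)"
    proof (cases "tle B b t")
      case True
      then have "tmeet B b t = b" "tmeet M a (k t) = a"
        using B.le_iff_meet M.le_iff_meet a_le b(1) TU k_univ aU t by blast+
      then show ?thesis by simp
    next
      case False
      then have "tmeet B b t = tmeet B m t" "tmeet M a (k t) = tmeet M (k m) (k t)"
        using B.meet_eq_of_not_le[of b m t] M.meet_eq_of_not_le[of a "k m" "k t"] a_le m(1,2) a(2) b(1) TU k_univ aU t
        by (auto simp: above_def)
      moreover have "tmeet B m t \<noteq> b" using T_meet m(1) t b(2) by auto
      ultimately show ?thesis using k_meet m(1) t by simp
    qed
  next
    fix y r ys assume y: "y \<in> univ B" and r: "r \<in> rels L" "length ys = rarity L r" and ys: "set ys \<subseteq> above B y"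
    show "relation B (Star r) (y # ys) \<longleftrightarrow> relation M (Star r) ((k(b := a)) y # map (k(b := a)) ys)"
    proof (cases "y = b")
      case True
      have ysT: "z \<in> T" "tle B m z" "z \<noteq> b" if "z \<in> set ys" for z
        using that ys True b(2,3) m(3) by (auto simp: above_def)
      have "relation B (Star r) (b # map (\<lambda>z. z) ys) \<longleftrightarrow> relation B (Star r) (b # map (\<lambda>_. m) ys)"
      proof (rule B.rel_cong[OF r(1) b(1) r(2)])
        fix z assume z: "z \<in> set ys"
        have "tmeet B m z = m" using B.le_iff_meet[of m z] ysT[OF z] TU m(1) by blast
        then show "(z, m) \<in> cone_rel B b"
          using B.cone_rel_iff[OF b(1)] B.meet_commute[of z m] ysT[OF z] TU m(1,2) by auto
      qed
      also have "\<dots> \<longleftrightarrow> relation M (Star r) (a # map (\<lambda>_. k m) ys)"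
        using a(3) r by (simp add: map_replicate_const)
      also have "\<dots> \<longleftrightarrow> relation M (Star r) (a # map (k(b := a)) ys)"
      proof (rule M.rel_cong[OF r(1) aU r(2)])
        fix z assume z: "z \<in> set ys"
        have "tmeet M (k m) (k z) = k m" using M.le_iff_meet[of "k m" "k z"] ysT[OF z] k_univ m(1) k_le by blast
        then show "(k m, (k(b := a)) z) \<in> cone_rel M a"
          using M.cone_rel_iff[OF aU] ysT[OF z] k_univ m(1) a(2) by auto
      qed
      finally show ?thesis using True by simp
    next
      case False
      then have yT: "y \<in> T" using y b(3) by auto
      show ?thesis
      proof (rule star_replace[OF yT m(1) r ys])
        assume "b \<in> set ys"
        then have by': "b \<in> above B y" using ys by blast
        have "tmeet B b m = b" using B.le_iff_meet[of b m] m(1,2) b(1) TU by (auto simp: above_def)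
        moreover have "tmeet M a (k m) = a" using M.le_iff_meet[of a "k m"] a(2) aU by (auto simp: above_def)
        moreover have "a \<in> above M (k y)" using lower[OF yT] by' by (auto simp: above_def)
        ultimately show "(b, m) \<in> cone_rel B y \<and> (a, k m) \<in> cone_rel M (k y)"
          using by' B.cone_rel_iff M.cone_rel_iff TU yT m(1) b(1) aU k_univ by auto
      qed
    qed
  qed
  then show ?thesis using aU by blast
qed

end

context one_point_extension
begin

text \<open>Let \<open>c\<close> be the greatest old point below \<open>b\<close>. No old point is above \<open>b\<close>, so that every old
  point meets \<open>b\<close> where it meets \<open>c\<close>, and \<open>b\<close> is in a cone of center \<open>c\<close> without old points.
  Hence only the structure of cones of center \<open>c\<close> is extended, by one point.\<close>
lemma extend_above:
  fixes K :: "('f, 'r, 'b) struct set"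
  assumes ne: "T \<noteq> {}" and fl: "funs L = {}" and max: "\<And>t. t \<in> T \<Longrightarrow> t \<notin> above B b"
    and type: "\<And>c R. c \<in> univ B \<Longrightarrow> transversal B c R \<Longrightarrow> R \<noteq> {} \<Longrightarrow> rep B c R \<in> K"
    and cone: "\<And>c A V f. c \<in> univ M \<Longrightarrow> A \<in> K \<Longrightarrow> finite V \<Longrightarrow> V \<subseteq> univ A \<Longrightarrow> transversal M c (f ` V) \<Longrightarrow>
      embedding L (A\<lparr>univ := V\<rparr>) (rep M c (f ` V)) f \<Longrightarrow>
      \<exists>g. transversal M c (g ` univ A) \<and> embedding L A (rep M c (g ` univ A)) g \<and> (\<forall>v\<in>V. g v = f v)"
  shows "\<exists>a\<in>univ M. embedding (star_lang L) B M (k(b := a))"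
proof -
  have meet_T: "tmeet B b t \<in> T" if t: "t \<in> T" for t
  proof -
    have "tmeet B b t \<noteq> b"
    proof
      assume "tmeet B b t = b"
      then have "t \<in> above B b" using B.le_iff_meet[of b t] b(1,2) TU t by (auto simp: above_def)
      then show False using max t by blast
    qed
    then show ?thesis using B.meet_closed[of b t] b TU t by auto
  qed
  have "\<exists>c\<in>{t\<in>T. tle B t b}. \<forall>t\<in>{t\<in>T. tle B t b}. tle B t c"
  proof (rule greatest_in_chain)
    obtain t where t: "t \<in> T" using ne by blast
    have "tmeet B b t \<in> {t\<in>T. tle B t b}" using meet_T B.meet_le1 b(1) t TU by blast
    then show "{t\<in>T. tle B t b} \<noteq> {}" by blast
  qed (use T(1) in auto)
  then obtain c where c: "c \<in> T" "tle B c b" "\<forall>t\<in>T. tle B t b \<longrightarrow> tle B t c" by blast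
  have cU: "c \<in> univ B" "k c \<in> univ M" using TU k_univ c(1) by auto
  have bc: "b \<in> above B c" using c b by (auto simp: above_def)
  have meet_bc: "tmeet B b t = tmeet B c t" if t: "t \<in> T" for t
  proof (cases "tle B c t")
    case True
    have "tle B (tmeet B b t) c" using c(3) meet_T[OF t] B.meet_le1[OF b(1) TU[OF t]] by blast
    moreover have "tle B c (tmeet B b t)" using B.meet_greatest[OF b(1) TU[OF t] cU(1) c(2) True] .
    ultimately have "tmeet B b t = c" using B.antisym TU meet_T[OF t] cU(1) by blast
    then show ?thesis using B.le_iff_meet[OF cU(1) TU[OF t]] True by simp
  next
    case False
    then show ?thesis using B.meet_eq_of_not_le[OF cU(1) b(1) TU[OF t] c(2)] by simp
  qed
  let ?W = "T \<inter> above B c"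
  have "transversal B c {}" by (simp add: transversal_def)
  then obtain R \<rho> where R: "R \<subseteq> ?W" "transversal B c R" "\<forall>t\<in>?W. \<rho> t \<in> R \<and> (\<rho> t, t) \<in> cone_rel B c"
    by (rule B.transversal_extend[OF cU(1) Int_lower2 _ empty_subsetI])
  have finR: "finite R" using R(1) T(1) finite_subset by blast
  \<comment> \<open>the meet of \<open>b\<close> with an old point is its meet with \<open>c\<close>, which is not above \<open>c\<close>\<close>
  have new: "(b, t) \<notin> cone_rel B c" if t: "t \<in> T" for t
  proof
    assume "(b, t) \<in> cone_rel B c"
    then have "tmeet B c t \<in> above B c" using B.cone_rel_iff[OF cU(1)] meet_bc[OF t] by simp
    then show False using B.meet_le1[OF cU(1) TU[OF t]] B.antisym[of c "tmeet B c t"] cU(1) by (auto simp: above_def)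
  qed
  have Rb: "transversal B c (insert b R)" unfolding transversal_def
  proof (intro conjI ballI impI)
    show "insert b R \<subseteq> above B c" using R(1) bc by blast
    fix x y assume "x \<in> insert b R" "y \<in> insert b R" "(x, y) \<in> cone_rel B c"
    then show "x = y" using new R(1,2) B.cone_rel_sym[OF cU(1)] unfolding transversal_def by blast
  qed
  let ?A = "rep B c (insert b R) :: ('f, 'r, 'b) struct"
  have A: "?A \<in> K" by (rule type[OF cU(1) Rb]) simp
  have kR: "transversal M (k c) (k ` R)"
    unfolding transversal_def
  proof (intro conjI ballI impI)
    show "k ` R \<subseteq> above M (k c)" using R(1) k_above[OF c(1)] by auto
    fix u v assume "u \<in> k ` R" "v \<in> k ` R" and uv: "(u, v) \<in> cone_rel M (k c)"
    then obtain x y where xy: "x \<in> R" "u = k x" "y \<in> R" "v = k y" by blast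
    then have "(x, y) \<in> cone_rel B c" using uv k_cone[OF c(1), of x y] R(1) by auto
    then show "u = v" using R(2) xy unfolding transversal_def by blast
  qed
  have "embedding L (?A\<lparr>univ := R\<rparr>) (rep M (k c) (k ` R)) k"
    unfolding embedding_def
  proof (intro conjI ballI allI impI)
    show "inj_on k (univ (?A\<lparr>univ := R\<rparr>))" using k_inj R(1) by (auto simp: inj_on_def)
    fix r xs assume "r \<in> rels L" "length xs = rarity L r \<and> set xs \<subseteq> univ (?A\<lparr>univ := R\<rparr>)"
    then show "relation (?A\<lparr>univ := R\<rparr>) r xs = relation (rep M (k c) (k ` R)) r (map k xs)"
      using k_rel[of r xs c] c(1) R(1) by auto
  qed (use fl in auto)
  moreover have "R \<subseteq> univ ?A" by auto
  ultimately have "\<exists>g. transversal M (k c) (g ` univ ?A) \<and> embedding L ?A (rep M (k c) (g ` univ ?A)) g \<and> (\<forall>v\<in>R. g v = k v)"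
    by (intro cone[OF cU(2) A finR _ kR])
  then obtain g where g: "transversal M (k c) (g ` insert b R)" "embedding L ?A (rep M (k c) (g ` insert b R)) g"
      "\<forall>v\<in>R. g v = k v"
    unfolding rep_simps(1) by (elim exE conjE) (rule that)
  define a where "a = g b"
  have a_above: "a \<in> above M (k c)" using g(1) by (auto simp: transversal_def a_def)
  have aU: "a \<in> univ M" using a_above M.above_univ by blast
  have g_inj: "inj_on g (insert b R)" using g(2) by (auto simp: embedding_def)
  have new_M: "(a, k t) \<notin> cone_rel M (k c)" if t: "t \<in> T" for t
  proof
    assume e: "(a, k t) \<in> cone_rel M (k c)"
    then have "k t \<in> above M (k c)" by (simp add: cone_rel_def)
    then have "t \<in> ?W" using k_above c(1) t by blast
    then have \<rho>: "\<rho> t \<in> R" "(\<rho> t, t) \<in> cone_rel B c" using R(3) by auto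
    then have "(k (\<rho> t), k t) \<in> cone_rel M (k c)" using k_cone[OF c(1)] R(1) t by blast
    then have "(g b, g (\<rho> t)) \<in> cone_rel M (k c)"
      using e \<rho>(1) g(3) M.cone_rel_trans[OF cU(2)] M.cone_rel_sym[OF cU(2)] unfolding a_def by metis
    then have "g b = g (\<rho> t)" using g(1) \<rho>(1) unfolding transversal_def by blast
    then show False using g_inj \<rho>(1) R(1) b(2) by (auto dest: inj_onD)
  qed
  have "embedding (star_lang L) B M (k(b := a))"
  proof (rule embedding_of_point[OF aU])
    show "a \<notin> k ` T" using new_M M.cone_rel_refl[OF cU(2) a_above] by blast
  next
    fix t assume t: "t \<in> T"
    have "tmeet B c t \<noteq> b" using T_meet c(1) t b(2) by metis
    then have "(k(b := a)) (tmeet B b t) = tmeet M (k c) (k t)"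
      using meet_bc[OF t] k_meet[OF c(1) t] by simp
    also have "\<dots> = tmeet M a (k t)"
    proof (cases "tle M (k c) (k t)")
      case True
      have "tle M (k c) (tmeet M a (k t))"
        using M.meet_greatest[OF aU k_univ[OF t] cU(2) _ True] a_above by (auto simp: above_def)
      moreover have "tmeet M a (k t) \<notin> above M (k c)"
        using new_M[OF t] M.cone_rel_iff[OF cU(2)] aU k_univ t by blast
      ultimately have "tmeet M a (k t) = k c" using M.meet_closed[OF aU k_univ[OF t]] by (auto simp: above_def)
      then show ?thesis using True M.le_iff_meet[OF cU(2) k_univ[OF t]] by simp
    next
      case False
      then show ?thesis using M.meet_eq_of_not_le[OF cU(2) aU k_univ[OF t]] a_above by (auto simp: above_def)
    qed
    finally show "(k(b := a)) (tmeet B b t) = tmeet M a (k t)" .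
  next
    fix x r ys assume x: "x \<in> univ B" and r: "r \<in> rels L" "length ys = rarity L r" and ys: "set ys \<subseteq> above B x"
    show "relation B (Star r) (x # ys) \<longleftrightarrow> relation M (Star r) ((k(b := a)) x # map (k(b := a)) ys)"
    proof (cases "x = b")
      case True
      have "above B b \<subseteq> T" using b(3) by (auto simp: above_def)
      then have "ys = []" using ys max True by (cases ys) auto
      then show ?thesis using B.rarity_pos[OF r(1)] r(2) by simp
    next
      case False
      then have xT: "x \<in> T" using x b(3) by auto
      show ?thesis
      proof (cases "x = c")
        case xc: False
        show ?thesis
        proof (rule star_replace[OF xT c(1) r ys])
          assume "b \<in> set ys"
          then have "tle B x c" using ys c(3) xT by (auto simp: above_def)
          then have "c \<in> above B x" using xc cU by (auto simp: above_def)
          moreover have "tmeet B b c = c" using B.meet_commute B.le_iff_meet c(2) b(1) cU(1) by metis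
          moreover have "tmeet M a (k c) = k c"
            using M.meet_commute[OF aU cU(2)] M.le_iff_meet[OF cU(2) aU] a_above by (auto simp: above_def)
          ultimately show "(b, c) \<in> cone_rel B x \<and> (a, k c) \<in> cone_rel M (k x)"
            using B.cone_rel_iff[OF x] M.cone_rel_iff[OF k_univ[OF xT]] b(1) cU aU k_above[OF xT c(1)] by simp
        qed
      next
        case True
        let ?f = "\<lambda>y. if y = b then b else \<rho> y"
        have W: "y \<in> ?W" if "y \<in> set ys" "y \<noteq> b" for y using that ys True b(3) by (auto simp: above_def)
        have fR: "set (map ?f ys) \<subseteq> insert b R" using W R(3) by auto
        have "relation B (Star r) (c # map (\<lambda>y. y) ys) \<longleftrightarrow> relation B (Star r) (c # map ?f ys)"
        proof (rule B.rel_cong[OF r(1) cU(1) r(2)])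
          fix y assume "y \<in> set ys"
          then show "(y, ?f y) \<in> cone_rel B c"
            using W R(3) B.cone_rel_sym[OF cU(1)] B.cone_rel_refl[OF cU(1) bc] by auto
        qed
        also have "\<dots> \<longleftrightarrow> relation M (Star r) (k c # map g (map ?f ys))"
          using g(2) r fR unfolding embedding_def by (simp del: map_map)
        also have "\<dots> \<longleftrightarrow> relation M (Star r) (k c # map (\<lambda>y. g (?f y)) ys)" by (simp add: comp_def)
        also have "\<dots> \<longleftrightarrow> relation M (Star r) (k c # map (k(b := a)) ys)"
        proof (rule M.rel_cong[OF r(1) cU(2) r(2)])
          fix y assume y: "y \<in> set ys"
          show "(g (?f y), (k(b := a)) y) \<in> cone_rel M (k c)"
          proof (cases "y = b")
            case True
            then show ?thesis using M.cone_rel_refl[OF cU(2) a_above] by (simp add: a_def)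
          next
            case False
            then have "\<rho> y \<in> R" "(\<rho> y, y) \<in> cone_rel B c" "y \<in> T" using W[OF y] R(3) by auto
            then have "(k (\<rho> y), k y) \<in> cone_rel M (k c)" using k_cone[OF c(1)] R(1) by blast
            then show ?thesis using False g(3) \<open>\<rho> y \<in> R\<close> by simp
          qed
        qed
        also have "k c = (k(b := a)) c" using c(1) b(2) by auto
        finally show ?thesis using True by (simp only: list.map_ident)
      qed
    qed
  qed
  then show ?thesis using aU by blast
qed

text \<open>A single point has nothing above it, so by (OC) it carries no structure.\<close>
lemma extend_empty:
  assumes "T = {}" "a \<in> univ M"
  shows "embedding (star_lang L) B M (k(b := a))"
proof (rule embedding_of_point[OF assms(2)])
  fix x r ys assume x: "x \<in> univ B" and r: "r \<in> rels L" "length ys = rarity L r" and ys: "set ys \<subseteq> above B x"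
  have "above B x = {}" using x b(3) assms(1) by (auto simp: above_def)
  then have "ys = []" using ys by simp
  then show "relation B (Star r) (x # ys) \<longleftrightarrow> relation M (Star r) ((k(b := a)) x # map (k(b := a)) ys)"
    using B.rarity_pos[OF r(1)] r(2) by simp
qed (use assms in auto)

end

section \<open>Countable models of the axioms as Fraisse limits\<close>

context star_tree
begin

text \<open>The meets of pairs of elements of \<open>X\<close> are already closed: if the meet of two such meets is
  not one of them, then \<open>meet_eq_of_not_le\<close> lets each of them be replaced by an element of
  \<open>X\<close>.\<close>
lemma meet_closure:
  assumes X: "finite X" "X \<subseteq> univ M"
  obtains S where "X \<subseteq> S" "S \<subseteq> univ M" "finite S" "closed_under (star_lang L) M S"
proof (rule that)
  let ?S = "(\<lambda>(x, y). tmeet M x y) ` (X \<times> X)"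
  show "X \<subseteq> ?S"
  proof
    fix x assume x: "x \<in> X"
    then have "x = tmeet M x x" using le_iff_meet[of x x] refl[of x] X(2) by auto
    then show "x \<in> ?S" using x by force
  qed
  show S: "?S \<subseteq> univ M" using meet_closed X(2) by auto
  show "finite ?S" using X(1) by simp
  show "closed_under (star_lang L) M ?S" unfolding closed_under_star_lang
  proof (intro ballI)
    fix a b assume ab: "a \<in> ?S" "b \<in> ?S"
    then obtain x y z w where x: "x \<in> X" "y \<in> X" "a = tmeet M x y" and z: "z \<in> X" "w \<in> X" "b = tmeet M z w"
      by auto
    have U: "x \<in> univ M" "y \<in> univ M" "z \<in> univ M" "w \<in> univ M" "a \<in> univ M" "b \<in> univ M"
      using x z X(2) ab S by auto
    have ax: "tle M a x" and bz: "tle M b z" using meet_le1 U x z by auto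
    show "tmeet M a b \<in> ?S"
    proof (cases "tle M a b")
      case True
      then show ?thesis using le_iff_meet[of a b] U ab by simp
    next
      case False
      then have 1: "tmeet M a b = tmeet M b x"
        using meet_eq_of_not_le[of a x b] meet_commute[of x b] U ax by simp
      show ?thesis
      proof (cases "tle M b x")
        case True
        then show ?thesis using 1 le_iff_meet[of b x] U ab by simp
      next
        case False
        then have "tmeet M a b = tmeet M z x" using 1 meet_eq_of_not_le[of b z x] U bz by simp
        then show ?thesis using x z by force
      qed
    qed
  qed
qed

text \<open>The valuation of \<open>eval_star\<close> must take its values above the center except at \<open>x\<close>. Since \<open>p\<close>
  is a sentence, any element above the center can be used.\<close>
lemma sat_star_iff:
  assumes fl: "funs L = {}" and p: "sentence L p" and x: "x \<notin> all_vars p"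
    and ne: "\<And>c. c \<in> univ M \<Longrightarrow> above M c \<noteq> {}"
  shows "sat M (star x p) \<longleftrightarrow> (\<forall>c\<in>univ M. sat (cone_struct M c :: ('f, 'r, 'a set) struct) p)"
proof -
  have wf: "wf_fm L p" and fv: "free_vars p = {}" using p by (auto simp: sentence_def)
  have key: "eval_fm M e (star x p) \<longleftrightarrow> sat (cone_struct M c :: ('f, 'r, 'a set) struct) p"
    if c: "c \<in> univ M" and e: "e x = c" for e c
  proof -
    obtain a where a: "a \<in> above M c" using ne[OF c] by blast
    let ?e = "\<lambda>n. if n = x then c else a"
    let ?N = "cone_struct M c :: ('f, 'r, 'a set) struct"
    have "eval_fm M e (star x p) = eval_fm M ?e (star x p)"
      by (rule eval_fm_cong) (use free_vars_star[OF fl wf, of x] fv e in auto)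
    also have "\<dots> = eval_fm ?N (\<lambda>n. cone_rel M c `` {?e n}) p"
    proof (rule eval_star[OF fl c equiv_cone_rel[OF c] _ _ wf x])
      show "func M Meet [a, b] \<in> univ M" if "a \<in> above M c" "b \<in> above M c" for a b
        using that above_univ meet_closed by blast
      show "relation M (Star r) (c # bs)" if "r \<in> rels L" "length as = rarity L r" "length bs = rarity L r"
        "relation M (Star r) (c # as)" "\<forall>i<length as. (as ! i, bs ! i) \<in> cone_rel M c" for r as bs
        using rel_cone[OF that(1) c that(2)] that by (simp add: list_all2_conv_all_nth)
    qed (use a in auto)
    also have "\<dots> = eval_fm ?N (\<lambda>_. cone_rel M c `` {a}) p"
      by (rule eval_fm_cong) (use fv in auto)
    also have "\<dots> = sat ?N p"
      by (rule sat_sentence_iff[OF fv, symmetric]) (use a in \<open>auto simp: cone_struct_def quotient_def\<close>)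
    finally show ?thesis .
  qed
  show ?thesis
  proof
    assume s: "sat M (star x p)"
    show "\<forall>c\<in>univ M. sat (cone_struct M c :: ('f, 'r, 'a set) struct) p"
    proof
      fix c assume c: "c \<in> univ M"
      then have "eval_fm M (\<lambda>_. c) (star x p)" using s by (simp add: sat_def)
      then show "sat (cone_struct M c :: ('f, 'r, 'a set) struct) p" using key[OF c, of "\<lambda>_. c"] by simp
    qed
  next
    assume "\<forall>c\<in>univ M. sat (cone_struct M c :: ('f, 'r, 'a set) struct) p"
    then show "sat M (star x p)" using key unfolding sat_def by blast
  qed
qed

lemma is_struct_cone_struct:
  "funs L = {} \<Longrightarrow> above M c \<noteq> {} \<Longrightarrow> is_struct L (cone_struct M c :: ('f, 'r, 'a set) struct)"
  by (auto simp: is_struct_def closed_under_def cone_struct_def quotient_def)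

end

lemma satD: "sat M p \<Longrightarrow> (\<And>n. e n \<in> univ M) \<Longrightarrow> eval_fm M e p"
  by (simp add: sat_def)

lemma eval_cone_type:
  "eval_fm M e (cone_type L rs A z y) \<longleftrightarrow> (\<forall>r\<in>set rs.
    relation M (Star r) (e z # replicate (rarity L r) (e y)) \<longleftrightarrow>
    (\<exists>a\<in>univ A. relation A r (replicate (rarity L r) a)))"
proof -
  have "eval_fm M e (if P then p else Neg p) \<longleftrightarrow> (eval_fm M e p \<longleftrightarrow> P)" for P and p :: "(tree_fun, 'a tree_rel) fm"
    by simp
  then show ?thesis
    unfolding cone_type_def Let_def eval_conj_list set_map ball_simps by simp
qed

locale fraisse_setting =
  fixes L :: "('f, 'r) lang" and TA T :: "('f, 'r) fm set"
  assumes L: "finite_relational L"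
    and u: "universal_theory L TA"
    and fraisse: "fraisse_class L (finite_models L TA)"
    and strong: "strong_amalgamation L (finite_models L TA)"
    and mc: "model_completion L T TA"
begin

abbreviation K where "K \<equiv> finite_models L TA"
abbreviation KS where "KS \<equiv> finite_models (star_lang L) (T_star_forall L TA)"
abbreviation axioms where "axioms \<equiv> DT \<union> T_oc L T \<union> T_zero L TA"

lemma fl: "funs L = {}" and fin_rels: "finite (rels L)"
  using L by (auto simp: finite_relational_def)

lemma je: "joint_embedding L K"
  using fraisse by (simp add: fraisse_class_def)

lemma T_sentence: "p \<in> T \<Longrightarrow> sentence L p"
  using mc by (simp add: model_completion_def)

lemma T_models: "model_of L (N :: ('f, 'r, nat) struct) T \<Longrightarrow> model_of L N TA"
  using mc by (simp add: model_completion_def)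

text \<open>The class of finite models of \<open>TA\<close> is nonempty, which discharges the hypothesis on \<open>N\<close>.\<close>
lemma model_of_T_star_forall:
  fixes M :: "(tree_fun, 'r tree_rel, 'a) struct"
  shows "model_of (star_lang L) M (T_star_forall L TA) \<longleftrightarrow>
    univ M \<noteq> {} \<and> star_tree L M \<and> (\<forall>c\<in>univ M. \<forall>R. transversal M c R \<and> R \<noteq> {} \<longrightarrow> model_of L (rep M c R :: ('f, 'r, 'a) struct) TA)"
proof -
  obtain N where "N \<in> K" using fraisse by (auto simp: fraisse_class_def)
  then show ?thesis using model_of_T_star_forall_iff[OF L u, of N M] by (simp add: finite_models_def)
qed

lemma KS_iff:
  "B \<in> KS \<longleftrightarrow> finite (univ B) \<and> univ B \<noteq> {} \<and> star_tree L B \<and>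
    (\<forall>c\<in>univ B. \<forall>R. transversal B c R \<and> R \<noteq> {} \<longrightarrow> rep B c R \<in> K)"
proof -
  have "finite R" if "finite (univ B)" "transversal B c R" for c R
    using that by (auto simp: transversal_def above_def intro: finite_subset)
  then show ?thesis using model_of_T_star_forall[of B] by (auto simp: finite_models_def)
qed

lemma is_struct_of_axioms: "model_of (star_lang L) M axioms \<Longrightarrow> is_struct (star_lang L) M"
  by (simp add: model_of_def)

lemma star_tree_of_axioms:
  assumes "model_of (star_lang L) M axioms"
  shows "star_tree L M"
proof -
  have "\<forall>p\<in>Tr \<union> WD L \<union> OC L. sat M p" using assms by (auto simp: model_of_def DT_def T_oc_def)
  then show ?thesis using sat_tree_axioms_iff[OF L] assms by (auto simp: model_of_def is_struct_def)
qed

lemma above_nonempty_of_axioms: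
  assumes M: "model_of (star_lang L) M axioms" and c: "c \<in> univ M"
  shows "above M c \<noteq> {}"
proof -
  have "many_cones 1 \<in> DT" by (simp add: DT_def)
  then have "sat M (many_cones 1)" using M by (auto simp: model_of_def)
  then have "eval_fm M (\<lambda>_. c) (many_cones 1)" by (rule satD) (rule c)
  then show ?thesis using c by (auto simp: many_cones_def above_def)
qed

lemma no_minimum_of_axioms:
  assumes M: "model_of (star_lang L) M axioms" and y: "y \<in> univ M"
  shows "\<exists>x\<in>univ M. y \<in> above M x"
proof -
  have "sat M (foralls [0, 1] (Imp (leq (Var 1) (Var 0)) (Ex 2 (And (leq (Var 2) (Var 0)) (lt (Var 2) (Var 1))))))"
    using M by (simp add: model_of_def DT_def Let_def del: foralls_simps)
  then have "eval_fm M (\<lambda>_. y) (Imp (leq (Var 1) (Var 0)) (Ex 2 (And (leq (Var 2) (Var 0)) (lt (Var 2) (Var 1)))))"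
    using y unfolding sat_foralls by (rule satD)
  moreover have "tle M y y" using star_tree_of_axioms[OF M] y by (simp add: star_tree.refl)
  ultimately show ?thesis using y by (auto simp: above_def)
qed

lemma insert_point_of_axioms:
  assumes M: "model_of (star_lang L) M axioms" and x: "x \<in> univ M" and y: "y \<in> above M x"
    and A: "A \<in> K" "univ A = {p}"
  shows "\<exists>z\<in>above M x. y \<in> above M z \<and> (\<forall>r\<in>rels L. relation M (Star r) (z # replicate (rarity L r) y)
        \<longleftrightarrow> relation A r (replicate (rarity L r) p))"
proof -
  obtain rs where rs: "set rs = rels L" "distinct rs" using finite_distinct_list[OF fin_rels] by blast
  let ?q = "Imp (lt (Var 0) (Var 1))
        (Ex 2 (And (And (lt (Var 0) (Var 2)) (lt (Var 2) (Var 1))) (cone_type L rs A 2 1)))"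
  have "foralls [0, 1] ?q \<in> T_zero L TA"
    unfolding T_zero_def using rs A
    by (intro CollectI exI[of _ rs] exI[of _ A]) (simp add: finite_models_def)
  then have "sat M (foralls [0, 1] ?q)" using M unfolding model_of_def by blast
  then have "sat M ?q" by (simp only: sat_foralls)
  then have "eval_fm M (\<lambda>n. if n = 0 then x else y) ?q"
    by (rule satD) (use x y in \<open>auto simp: above_def\<close>)
  then show ?thesis using x y A(2) rs(1) by (auto simp: eval_cone_type above_def)
qed

lemma cone_struct_of_axioms:
  assumes M: "model_of (star_lang L) M axioms" and c: "c \<in> univ M"
  shows "model_of L (cone_struct M c) T"
proof -
  interpret star_tree L M by (rule star_tree_of_axioms[OF M])
  have "sat (cone_struct M c) p" if p: "p \<in> T" for p
  proof -
    obtain x where x: "x \<notin> all_vars p" using ex_new_if_finite[OF infinite_UNIV_nat finite_all_vars[of p]] by auto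
    then have "All x (star x p) \<in> axioms" using p by (auto simp: T_oc_def)
    then have "sat M (star x p)" using M unfolding model_of_def by (metis sat_All)
    then show ?thesis using sat_star_iff[OF fl T_sentence[OF p] x above_nonempty_of_axioms[OF M]] c by blast
  qed
  then show ?thesis using is_struct_cone_struct[OF fl above_nonempty_of_axioms[OF M c]] by (simp add: model_of_def)
qed

text \<open>Representatives of all cones give a copy of \<open>M_c\<close>.\<close>
lemma full_rep_of_axioms:
  assumes M: "model_of (star_lang L) M axioms" and c: "c \<in> univ M" and R: "transversal M c R"
    and full: "\<forall>a\<in>above M c. \<exists>b\<in>R. (b, a) \<in> cone_rel M c"
  shows "model_of L (rep M c R) T"
proof -
  interpret star_tree L M by (rule star_tree_of_axioms[OF M])
  have iso: "isomorphism L (rep M c R :: ('f, 'r, 'a) struct) (cone_struct M c) (\<lambda>a. cone_rel M c `` {a})"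
    by (rule isomorphism_rep_cone_struct[OF fl c R full])
  have "R \<noteq> {}" using full above_nonempty_of_axioms[OF M c] by blast
  then have "is_struct L (rep M c R :: ('f, 'r, 'a) struct)"
    by (simp add: is_struct_def closed_under_relational[OF fl])
  then show ?thesis
    using isomorphism_sat[OF iso] cone_struct_of_axioms[OF M c] T_sentence by (simp add: model_of_def)
qed

text \<open>The structure on a full transversal that contains the image of \<open>V\<close> is a countable model of
  \<open>T\<close>, hence rich.\<close>
lemma cone_extension_of_axioms:
  fixes M :: "(tree_fun, 'r tree_rel, nat) struct"
  assumes M: "model_of (star_lang L) M axioms" and c: "c \<in> univ M" and A: "A \<in> K"
    and V: "finite V" "V \<subseteq> univ A" and fV: "transversal M c (f ` V)"
    and f: "embedding L (A\<lparr>univ := V\<rparr>) (rep M c (f ` V)) f"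
  shows "\<exists>g. transversal M c (g ` univ A) \<and> embedding L A (rep M c (g ` univ A)) g \<and> (\<forall>v\<in>V. g v = f v)"
proof -
  interpret star_tree L M by (rule star_tree_of_axioms[OF M])
  have sub: "f ` V \<subseteq> above M c" using fV by (simp add: transversal_def)
  obtain R \<rho> where R: "f ` V \<subseteq> R" "transversal M c R" "\<forall>a\<in>above M c. \<rho> a \<in> R \<and> (\<rho> a, a) \<in> cone_rel M c"
    by (rule transversal_extend[OF c order_refl fV sub])
  let ?N = "rep M c R :: ('f, 'r, nat) struct"
  have N: "model_of L ?N T" using full_rep_of_axioms[OF M c R(2)] R(3) by blast
  have "embedding L (A\<lparr>univ := V\<rparr>) ?N f"
    by (rule embedding_extend_codomain[where T = "f ` V"]) (use f R(1) in simp_all)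
  then have p: "partial_iso L A ?N V f" using V closed_under_relational[OF fl] by (simp add: partial_iso_def)
  note i = partial_iso_inverse[OF p]
  have r: "rich L K ?N" by (rule rich_of_model_completion[OF L u mc je N])
  have i': "finite (f ` V)" "f ` V \<subseteq> univ ?N" "closed_under L ?N (f ` V)"
    "embedding L (?N\<lparr>univ := f ` V\<rparr>) A (inv_into V f)"
    using i(1) unfolding partial_iso_def by blast+
  obtain g where g: "embedding L A ?N g" "\<And>y. y \<in> f ` V \<Longrightarrow> g (inv_into V f y) = y"
    by (rule richE[OF r A i']) (rule that)
  have gR: "g ` univ A \<subseteq> R" using g(1) by (simp add: embedding_def)
  have "embedding L A (?N\<lparr>univ := g ` univ A\<rparr>) g" by (rule embedding_change_codomain[OF g(1)]) simp
  moreover have "transversal M c (g ` univ A)" using R(2) gR unfolding transversal_def by blast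
  moreover have "\<forall>v\<in>V. g v = f v" using g(2) i(3) by fastforce
  ultimately show ?thesis by auto
qed

lemma model_of_T_star_forall_of_axioms:
  fixes M :: "(tree_fun, 'r tree_rel, nat) struct"
  assumes M: "model_of (star_lang L) M axioms"
  shows "model_of (star_lang L) M (T_star_forall L TA)"
  unfolding model_of_T_star_forall
proof (intro conjI ballI allI impI)
  interpret star_tree L M by (rule star_tree_of_axioms[OF M])
  show "univ M \<noteq> {}" using is_struct_of_axioms[OF M] by (simp add: is_struct_def)
  show "star_tree L M" by (rule star_tree_of_axioms[OF M])
  fix c R assume c: "c \<in> univ M" and R: "transversal M c R \<and> R \<noteq> {}"
  have sub: "R \<subseteq> above M c" using R by (simp add: transversal_def)
  obtain R' \<rho> where R': "R \<subseteq> R'" "transversal M c R'" "\<forall>a\<in>above M c. \<rho> a \<in> R' \<and> (\<rho> a, a) \<in> cone_rel M c"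
    by (rule transversal_extend[OF c order_refl conjunct1[OF R] sub])
  have "model_of L (rep M c R' :: ('f, 'r, nat) struct) TA"
    using full_rep_of_axioms[OF M c R'(2)] R'(3) T_models by blast
  then have "model_of L ((rep M c R')\<lparr>univ := R\<rparr> :: ('f, 'r, nat) struct) TA"
    by (rule model_of_restrict[OF fl u]) (use R R'(1) in simp_all)
  then show "model_of L (rep M c R :: ('f, 'r, nat) struct) TA" by simp
qed

lemma KS_restrict:
  assumes B: "B \<in> KS" and S: "S \<subseteq> univ B" "S \<noteq> {}" "closed_under (star_lang L) B S"
  shows "B\<lparr>univ := S\<rparr> \<in> KS"
proof -
  have "is_struct (star_lang L) (B\<lparr>univ := S\<rparr>)" using S by (simp add: is_struct_def)
  then have "model_of (star_lang L) (B\<lparr>univ := S\<rparr>) (T_star_forall L TA)"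
    by (rule embedding_model_of_universal[OF embedding_inclusion[OF S(1)] _ _ universal_T_star_forall[OF L u]])
      (use B in \<open>simp add: finite_models_def\<close>)
  then show ?thesis using B S(1) by (auto simp: finite_models_def intro: finite_subset)
qed

text \<open>A minimal new point can be added alone, because its meets are either itself or below it, and
  hence old.\<close>
lemma KS_grow:
  assumes B: "B \<in> KS" and U: "U \<subset> univ B" "closed_under (star_lang L) B U"
  shows "\<exists>b\<in>univ B - U. closed_under (star_lang L) B (insert b U) \<and> B\<lparr>univ := insert b U\<rparr> \<in> KS"
proof -
  interpret star_tree L B using B KS_iff by blast
  have fin: "finite (univ B)" using B KS_iff by blast
  obtain b0 where "b0 \<in> univ B - U" using U by blast
  then obtain b where b: "b \<in> univ B - U"
    and min: "\<forall>y. y \<in> univ B - U \<longrightarrow> card {z\<in>univ B. tle B z b} \<le> card {z\<in>univ B. tle B z y}"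
    using ex_has_least_nat[of "\<lambda>y. y \<in> univ B - U" b0 "\<lambda>y. card {z\<in>univ B. tle B z y}"] by blast
  have low: "y \<in> U" if y: "y \<in> univ B" "tle B y b" "y \<noteq> b" for y
  proof (rule ccontr)
    assume "y \<notin> U"
    have "{z\<in>univ B. tle B z y} \<subseteq> {z\<in>univ B. tle B z b}" using trans[of _ y b] y b by blast
    moreover have "b \<in> {z\<in>univ B. tle B z b} - {z\<in>univ B. tle B z y}" using b refl antisym y by blast
    ultimately have "card {z\<in>univ B. tle B z y} < card {z\<in>univ B. tle B z b}"
      using fin by (intro psubset_card_mono) auto
    moreover have "card {z\<in>univ B. tle B z b} \<le> card {z\<in>univ B. tle B z y}"
      by (rule min[rule_format]) (use y(1) \<open>y \<notin> U\<close> in blast)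
    ultimately show False by linarith
  qed
  have bm: "tmeet B b y \<in> insert b U" if "y \<in> univ B" for y
    using low[of "tmeet B b y"] meet_le1[of b y] meet_closed[of b y] b that by blast
  have "closed_under (star_lang L) B (insert b U)" unfolding closed_under_star_lang
  proof (intro ballI)
    fix x y assume xy: "x \<in> insert b U" "y \<in> insert b U"
    have xyU: "x \<in> univ B" "y \<in> univ B" using xy U b by auto
    show "tmeet B x y \<in> insert b U"
    proof (cases "x \<in> U \<and> y \<in> U")
      case True
      then show ?thesis using U(2) by (simp add: closed_under_star_lang)
    next
      case False
      then have "x = b \<or> y = b" using xy by blast
      then show ?thesis using bm[OF xyU(1)] bm[OF xyU(2)] meet_commute[OF xyU] by auto
    qed
  qed
  moreover have "insert b U \<subseteq> univ B" using b U by auto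
  ultimately show ?thesis using KS_restrict[OF B] b by blast
qed

text \<open>The three cases are that \<open>b\<close> is the only point, that \<open>b\<close> has an old point above it, and that
  \<open>b\<close> is maximal.\<close>
lemma rich_of_axioms:
  fixes M :: "(tree_fun, 'r tree_rel, nat) struct"
  assumes M: "model_of (star_lang L) M axioms"
  shows "rich (star_lang L) KS M"
proof (rule rich_of_one_point_extensions)
  show "finite (univ B)" if "B \<in> KS" for B using that by (simp add: finite_models_def)
  show "\<exists>b\<in>univ B - U. closed_under (star_lang L) B (insert b U) \<and> B\<lparr>univ := insert b U\<rparr> \<in> KS"
    if "B \<in> KS" "U \<subset> univ B" "closed_under (star_lang L) B U" for B U
    by (rule KS_grow[OF that])
  fix B :: "(tree_fun, 'r tree_rel, nat) struct" and S h b
  assume B: "B \<in> KS" and p: "partial_iso (star_lang L) M B S h" and b: "b \<in> univ B" "b \<notin> h ` S" "univ B = insert b (h ` S)"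
  \<comment> \<open>the inverse of the partial isomorphism embeds the known part of \<open>B\<close> into \<open>M\<close>\<close>
  note i = partial_iso_inverse[OF p]
  define k where "k = inv_into S h"
  interpret one_point_extension L B M "h ` S" k b
    unfolding one_point_extension_def one_point_extension_axioms_def
    using B KS_iff star_tree_of_axioms[OF M] i(1) b unfolding partial_iso_def k_def by blast
  have "\<exists>a\<in>univ M. embedding (star_lang L) B M (k(b := a))"
  proof (cases "h ` S = {}")
    case True
    obtain a where "a \<in> univ M" using is_struct_of_axioms[OF M] by (auto simp: is_struct_def)
    then show ?thesis using extend_empty[OF True] by blast
  next
    case ne: False
    show ?thesis
    proof (cases "\<exists>t\<in>h ` S. t \<in> above B b")
      case True
      then obtain t where t: "t \<in> h ` S" "t \<in> above B b" by blast
      show ?thesis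
      proof (rule extend_below[OF t, of K])
        show "rep B b {m} \<in> K" if "m \<in> above B b" for m
          using B KS_iff b(1) that by (auto simp: transversal_def)
      qed (use no_minimum_of_axioms[OF M] insert_point_of_axioms[OF M] in blast)+
    next
      case False
      show ?thesis
      proof (rule extend_above[OF ne fl, of K])
        show "rep B c R \<in> K" if "c \<in> univ B" "transversal B c R" "R \<noteq> {}" for c R
          using B KS_iff that by auto
      qed (use False cone_extension_of_axioms[OF M] in blast)+
    qed
  qed
  then obtain a where a: "embedding (star_lang L) B M (k(b := a))" by blast
  have "\<forall>x\<in>S. (k(b := a)) (h x) = x" using i(3) b(2) by (auto simp: k_def)
  then show "\<exists>g. embedding (star_lang L) B M g \<and> (\<forall>x\<in>S. g (h x) = x)" using a by blast
qed

text \<open>A finite set of generators has a finite closure under meets.\<close>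
lemma finite_of_fin_generated:
  assumes A: "star_tree L A" "fin_generated (star_lang L) A"
  shows "finite (univ A)"
proof -
  interpret star_tree L A by (rule A)
  obtain X where X: "finite X" "X \<subseteq> univ A"
    "\<forall>S. X \<subseteq> S \<and> S \<subseteq> univ A \<and> closed_under (star_lang L) A S \<longrightarrow> S = univ A"
    using A(2) unfolding fin_generated_def by blast
  obtain S where "X \<subseteq> S" "S \<subseteq> univ A" "finite S" "closed_under (star_lang L) A S"
    by (rule meet_closure[OF X(1,2)])
  then show ?thesis using X(3) by blast
qed

lemma fraisse_limit_of_axioms:
  fixes M :: "(tree_fun, 'r tree_rel, nat) struct"
  assumes M: "model_of (star_lang L) M axioms"
  shows "fraisse_limit (star_lang L) KS M"
proof -
  interpret star_tree L M by (rule star_tree_of_axioms[OF M])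
  note MT = model_of_T_star_forall_of_axioms[OF M] and rM = rich_of_axioms[OF M]
  have sub: "A \<in> KS" if A: "is_struct (star_lang L) A" "fin_generated (star_lang L) A" "embedding (star_lang L) A M h"
    for A :: "(tree_fun, 'r tree_rel, nat) struct" and h
  proof -
    have "model_of (star_lang L) A (T_star_forall L TA)"
      by (rule embedding_model_of_universal[OF A(3,1) MT universal_T_star_forall[OF L u]])
    then show ?thesis using finite_of_fin_generated[OF _ A(2)] model_of_T_star_forall[of A] by (auto simp: finite_models_def)
  qed
  have lM: "locally_in (star_lang L) KS M" unfolding locally_in_def
  proof (intro allI impI)
    fix X assume X: "finite X \<and> X \<noteq> {} \<and> X \<subseteq> univ M"
    then have X': "finite X" "X \<subseteq> univ M" by auto
    obtain S where S: "X \<subseteq> S" "S \<subseteq> univ M" "finite S" "closed_under (star_lang L) M S"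
      by (rule meet_closure[OF X'])
    then have "is_struct (star_lang L) (M\<lparr>univ := S\<rparr>)" using X by (auto simp: is_struct_def)
    then have "model_of (star_lang L) (M\<lparr>univ := S\<rparr>) (T_star_forall L TA)"
      by (rule embedding_model_of_universal[OF embedding_inclusion[OF S(2)] _ MT universal_T_star_forall[OF L u]])
    then show "\<exists>S. X \<subseteq> S \<and> S \<subseteq> univ M \<and> finite S \<and> closed_under (star_lang L) M S \<and> M\<lparr>univ := S\<rparr> \<in> KS"
      using S by (intro exI[of _ S]) (simp add: finite_models_def)
  qed
  have "age (star_lang L) M = KS"
  proof
    show "age (star_lang L) M \<subseteq> KS" using sub by (auto simp: age_def)
    show "KS \<subseteq> age (star_lang L) M"
    proof
      fix A assume A: "A \<in> KS"
      have "partial_iso (star_lang L) M A {} id" by (rule partial_iso_empty) (auto simp: rarity_pos)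
      then obtain g where "embedding (star_lang L) A M g"
        using rM A unfolding rich_def partial_iso_def by blast
      moreover have "fin_generated (star_lang L) A" unfolding fin_generated_def
        by (rule exI[of _ "univ A"]) (use A in \<open>auto simp: finite_models_def\<close>)
      ultimately show "A \<in> age (star_lang L) M" using A by (auto simp: age_def finite_models_def model_of_def)
    qed
  qed
  moreover have "homogeneous (star_lang L) M" unfolding homogeneous_def
  proof (intro allI impI)
    fix S S' h assume h: "S \<subseteq> univ M \<and> S' \<subseteq> univ M \<and>
        is_struct (star_lang L) (M\<lparr>univ := S\<rparr>) \<and> is_struct (star_lang L) (M\<lparr>univ := S'\<rparr>) \<and>
        fin_generated (star_lang L) (M\<lparr>univ := S\<rparr>) \<and>
        isomorphism (star_lang L) (M\<lparr>univ := S\<rparr>) (M\<lparr>univ := S'\<rparr>) h"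
    then have "M\<lparr>univ := S\<rparr> \<in> KS" using sub embedding_inclusion[of S M] by blast
    then have "finite S" by (simp add: finite_models_def)
    moreover have "embedding (star_lang L) (M\<lparr>univ := S\<rparr>) M h"
      using h embedding_extend_codomain by (auto simp: isomorphism_def)
    ultimately have "partial_iso (star_lang L) M M S h" using h by (auto simp: partial_iso_def is_struct_def)
    then obtain g where "isomorphism (star_lang L) M M g" "\<And>x. x \<in> S \<Longrightarrow> g x = h x"
      by (rule back_and_forth[OF _ rM rM lM lM]) (rule that)
    then show "\<exists>g. isomorphism (star_lang L) M M g \<and> (\<forall>x\<in>S. g x = h x)" by blast
  qed
  ultimately show ?thesis using is_struct_of_axioms[OF M] by (simp add: fraisse_limit_def)
qed

end

section \<open>Richness of Fraisse limits\<close>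

text \<open>The intersection of all closed sets containing \<open>X\<close>. In an arbitrary language it need not be
  finite.\<close>
lemma generated_substructure:
  assumes cl: "closed_under L M (univ M)" and X: "finite X" "X \<subseteq> univ M"
  obtains S where "X \<subseteq> S" "S \<subseteq> univ M" "closed_under L M S" "fin_generated L (M\<lparr>univ := S\<rparr>)"
proof -
  define S where "S = \<Inter> {S. X \<subseteq> S \<and> S \<subseteq> univ M \<and> closed_under L M S}"
  have 1: "X \<subseteq> S" "S \<subseteq> univ M" using cl X by (auto simp: S_def)
  have 2: "closed_under L M S" unfolding closed_under_def
  proof (intro ballI allI impI)
    fix f xs assume f: "f \<in> funs L" "length xs = farity L f \<and> set xs \<subseteq> S"
    have "func M f xs \<in> S'" if "X \<subseteq> S' \<and> S' \<subseteq> univ M \<and> closed_under L M S'" for S'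
    proof -
      have "set xs \<subseteq> S'" using f(2) that unfolding S_def by blast
      then show ?thesis using f that unfolding closed_under_def by blast
    qed
    then show "func M f xs \<in> S" unfolding S_def by blast
  qed
  have "fin_generated L (M\<lparr>univ := S\<rparr>)" unfolding fin_generated_def
  proof (intro exI[of _ X] conjI allI impI)
    fix S' assume S': "X \<subseteq> S' \<and> S' \<subseteq> univ (M\<lparr>univ := S\<rparr>) \<and> closed_under L (M\<lparr>univ := S\<rparr>) S'"
    then have "S \<subseteq> S'" using 1(2) unfolding S_def by auto
    then show "S' = univ (M\<lparr>univ := S\<rparr>)" using S' by auto
  qed (use X 1 in auto)
  then show ?thesis by (rule that[OF 1 2])
qed

text \<open>A universal sentence is refuted by finitely many elements, and these lie in a member of \<open>K\<close>.\<close>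
lemma model_of_locally_in:
  assumes st: "is_struct L M" and l: "locally_in L K M" and K: "\<And>A. A \<in> K \<Longrightarrow> model_of L A U"
    and u: "universal_theory L U"
  shows "model_of L M U"
proof -
  have "sat M p" if p: "p \<in> U" for p
  proof -
    obtain ys q where q: "p = foralls ys q" "quantifier_free q" "wf_fm L q"
      using u p unfolding universal_theory_def by blast
    have "eval_fm M e q" if e: "\<forall>n. e n \<in> univ M" for e
    proof -
      obtain S where S: "e ` insert 0 (free_vars q) \<subseteq> S" "S \<subseteq> univ M" "finite S" "closed_under L M S" "M\<lparr>univ := S\<rparr> \<in> K"
        by (rule locally_inE[OF l, of "e ` insert 0 (free_vars q)"]) (use e finite_free_vars[of q] in auto)
      define e' where "e' n = (if n \<in> free_vars q then e n else e 0)" for n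
      have e': "e' n \<in> S" for n using S(1) by (auto simp: e'_def)
      have "sat (M\<lparr>univ := S\<rparr>) p" using K[OF S(5)] p by (simp add: model_of_def)
      then have "sat (M\<lparr>univ := S\<rparr>) q" by (simp add: q(1))
      then have "eval_fm (M\<lparr>univ := S\<rparr>) e' q" by (rule satD) (simp add: e')
      then have "eval_fm M (id \<circ> e') q"
        using embedding_eval_quantifier_free[OF embedding_inclusion[OF S(2)] _ q(2,3), of e'] S(4) e' by simp
      moreover have "eval_fm M (id \<circ> e') q = eval_fm M e q" by (rule eval_fm_cong) (simp add: e'_def)
      ultimately show ?thesis by simp
    qed
    then have "sat M q" by (simp add: sat_def)
    then show ?thesis by (simp add: q(1))
  qed
  then show ?thesis using st by (simp add: model_of_def)
qed

lemma locally_in_fraisse_limit: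
  assumes F: "fraisse_limit L K F" and fin: "\<And>A. A \<in> K \<Longrightarrow> finite (univ A)"
  shows "locally_in L K F"
  unfolding locally_in_def
proof (intro allI impI)
  fix X assume X: "finite X \<and> X \<noteq> {} \<and> X \<subseteq> univ F"
  have cl: "closed_under L F (univ F)" using F by (simp add: fraisse_limit_def is_struct_def)
  obtain S where S: "X \<subseteq> S" "S \<subseteq> univ F" "closed_under L F S" "fin_generated L (F\<lparr>univ := S\<rparr>)"
    by (rule generated_substructure[OF cl]) (use X in auto)
  have "is_struct L (F\<lparr>univ := S\<rparr>)" using S X by (auto simp: is_struct_def)
  then have "F\<lparr>univ := S\<rparr> \<in> age L F" using S embedding_inclusion[OF S(2)] by (auto simp: age_def)
  then have "F\<lparr>univ := S\<rparr> \<in> K" using F by (simp add: fraisse_limit_def)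
  then show "\<exists>S. X \<subseteq> S \<and> S \<subseteq> univ F \<and> finite S \<and> closed_under L F S \<and> F\<lparr>univ := S\<rparr> \<in> K"
    using S fin[of "F\<lparr>univ := S\<rparr>"] by auto
qed

text \<open>A member \<open>B\<close> of the age embeds somewhere, and homogeneity moves this embedding to the
  prescribed position of \<open>S\<close>.\<close>
lemma rich_fraisse_limit:
  assumes F: "fraisse_limit L K F"
  shows "rich L K F"
  unfolding rich_def
proof (intro ballI allI impI)
  fix B S h assume B: "B \<in> K" and S: "finite S \<and> S \<subseteq> univ F \<and> closed_under L F S \<and> embedding L (F\<lparr>univ := S\<rparr>) B h"
  have "B \<in> age L F" using B F by (simp add: fraisse_limit_def)
  then obtain k where k: "embedding L B F k" by (auto simp: age_def)
  show "\<exists>g. embedding L B F g \<and> (\<forall>x\<in>S. g (h x) = x)"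
  proof (cases "S = {}")
    case True
    then show ?thesis using k by blast
  next
    case False
    let ?f = "k \<circ> h"
    have f: "embedding L (F\<lparr>univ := S\<rparr>) F ?f" using embedding_comp S k by blast
    have "isomorphism L (F\<lparr>univ := S\<rparr>) (F\<lparr>univ := ?f ` S\<rparr>) ?f"
      using embedding_change_codomain[OF f, of "?f ` S"] by (simp add: isomorphism_def)
    moreover have "closed_under L F (?f ` S)" using embedding_closed_image[OF f] S by simp
    moreover have "?f ` S \<subseteq> univ F" using f by (simp add: embedding_def)
    moreover have "fin_generated L (F\<lparr>univ := S\<rparr>)"
      unfolding fin_generated_def by (rule exI[of _ S]) (use S in auto)
    moreover have hom: "homogeneous L F" using F by (simp add: fraisse_limit_def)
    ultimately have "\<exists>g. isomorphism L F F g \<and> (\<forall>x\<in>S. g x = ?f x)"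
      by (intro hom[unfolded homogeneous_def, rule_format, of S "?f ` S" ?f])
        (use S False in \<open>simp add: is_struct_def\<close>)
    then obtain g where g: "isomorphism L F F g" "\<forall>x\<in>S. g x = ?f x" by blast
    have gi: "inj_on g (univ F)" "g ` univ F = univ F" and ge: "embedding L F F g"
      using g(1) by (auto simp: isomorphism_def embedding_def)
    have "closed_under L F (univ F)" using F by (simp add: fraisse_limit_def is_struct_def)
    then have "embedding L (F\<lparr>univ := g ` univ F\<rparr>) F (inv_into (univ F) g)" by (rule embedding_inverse[OF ge])
    then have "embedding L F F (inv_into (univ F) g)" by (simp add: gi(2))
    then have "embedding L B F (inv_into (univ F) g \<circ> k)" by (rule embedding_comp[OF k])
    moreover have "(inv_into (univ F) g \<circ> k) (h x) = x" if "x \<in> S" for x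
      using g(2) that gi(1) S by (metis comp_apply inv_into_f_f subsetD)
    ultimately show ?thesis by blast
  qed
qed

section \<open>Chains and fans as finite trees\<close>

text \<open>The chain of the numbers below \<open>n\<close>. There is a single open cone of each center \<open>i\<close>, except
  for the greatest one, and \<open>\<tau> i r\<close> tells whether \<open>r\<close> holds of this cone.\<close>
definition chain_tree :: "(nat \<Rightarrow> 'r \<Rightarrow> bool) \<Rightarrow> nat \<Rightarrow> (tree_fun, 'r tree_rel, nat) struct" where
  "chain_tree \<tau> n = \<lparr>univ = {..<n}, func = (\<lambda>_ xs. min (xs ! 0) (xs ! 1)),
     relation = (\<lambda>R xs. case R of Leq \<Rightarrow> xs ! 0 \<le> xs ! 1
       | Star r \<Rightarrow> (\<forall>y\<in>set (tl xs). hd xs < y) \<and> \<tau> (hd xs) r)\<rparr>"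

lemma chain_tree_simps [simp]:
  "univ (chain_tree \<tau> n) = {..<n}" "tmeet (chain_tree \<tau> n) i j = min i j"
  "tle (chain_tree \<tau> n) i j \<longleftrightarrow> i \<le> j"
  "relation (chain_tree \<tau> n) (Star r) (i # js) \<longleftrightarrow> (\<forall>j\<in>set js. i < j) \<and> \<tau> i r"
  by (simp_all add: chain_tree_def)

lemma above_chain_tree [simp]: "above (chain_tree \<tau> n) i = {i<..<n}"
  by (auto simp: above_def)

lemma cone_rel_chain_tree [simp]: "cone_rel (chain_tree \<tau> n) i = {i<..<n} \<times> {i<..<n}"
  by (auto simp: cone_rel_def)

text \<open>The center 0 and one leaf \<open>Suc a\<close> for each element \<open>a\<close> of \<open>A\<close>; the open cones of center 0
  form a copy of \<open>A\<close>.\<close>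
definition fan_tree :: "('f, 'r, nat) struct \<Rightarrow> (tree_fun, 'r tree_rel, nat) struct" where
  "fan_tree A = \<lparr>univ = insert 0 (Suc ` univ A), func = (\<lambda>_ xs. if xs ! 0 = xs ! 1 then xs ! 0 else 0),
     relation = (\<lambda>R xs. case R of Leq \<Rightarrow> xs ! 0 = xs ! 1 \<or> xs ! 0 = 0
       | Star r \<Rightarrow> hd xs = 0 \<and> 0 \<notin> set (tl xs) \<and> relation A r (map (\<lambda>y. y - 1) (tl xs)))\<rparr>"

lemma fan_tree_simps [simp]:
  "univ (fan_tree A) = insert 0 (Suc ` univ A)" "tmeet (fan_tree A) x y = (if x = y then x else 0)"
  "tle (fan_tree A) x y \<longleftrightarrow> x = y \<or> x = 0"
  "relation (fan_tree A) (Star r) (x # xs) \<longleftrightarrow> x = 0 \<and> 0 \<notin> set xs \<and> relation A r (map (\<lambda>y. y - 1) xs)"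
  by (simp_all add: fan_tree_def)

lemma above_fan_tree [simp]: "above (fan_tree A) x = (if x = 0 then Suc ` univ A else {})"
  by (auto simp: above_def)

lemma cone_rel_fan_tree [simp]: "cone_rel (fan_tree A) x = (if x = 0 then Id_on (Suc ` univ A) else {})"
  by (auto simp: cone_rel_def Id_on_def split: if_splits)

context fraisse_setting
begin

lemma chain_tree_KS:
  assumes n: "n > 0"
    and \<tau>: "\<And>i. \<exists>A\<in>K. \<exists>p. univ A = {p} \<and> (\<forall>r\<in>rels L. \<tau> i r \<longleftrightarrow> relation A r (replicate (rarity L r) p))"
  shows "chain_tree \<tau> n \<in> KS"
  unfolding KS_iff
proof (intro conjI ballI allI impI)
  show "star_tree L (chain_tree \<tau> n)"
  proof unfold_locales
    show "relation (chain_tree \<tau> n) (Star r) (c # bs)"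
      if "list_all2 (\<lambda>a b. (a, b) \<in> cone_rel (chain_tree \<tau> n) c) as bs" "relation (chain_tree \<tau> n) (Star r) (c # as)"
      for r c as bs
    proof -
      have "\<forall>b\<in>set bs. c < b" using that(1) by (auto simp: list_all2_conv_all_nth in_set_conv_nth)
      then show ?thesis using that(2) by simp
    qed
  qed (use L in \<open>auto simp: finite_relational_def subset_iff\<close>)
  fix c R assume R: "transversal (chain_tree \<tau> n) c R \<and> R \<noteq> {}"
  then obtain j where "j \<in> R" by blast
  have sub: "R \<subseteq> {c<..<n}" using R by (simp add: transversal_def)
  have "R \<subseteq> {j}" using R sub \<open>j \<in> R\<close> unfolding transversal_def cone_rel_chain_tree by blast
  moreover have "c < j" using \<open>j \<in> R\<close> sub by auto
  ultimately have j: "R = {j}" "c < j" using \<open>j \<in> R\<close> by blast+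
  obtain A p where A: "A \<in> K" "univ A = {p}" "\<forall>r\<in>rels L. \<tau> c r \<longleftrightarrow> relation A r (replicate (rarity L r) p)"
    using \<tau> by blast
  let ?N = "rep (chain_tree \<tau> n) c R :: ('f, 'r, nat) struct"
  have "embedding L ?N A (\<lambda>_. p)" unfolding embedding_def
  proof (intro conjI ballI allI impI)
    fix r xs assume r: "r \<in> rels L" "length xs = rarity L r \<and> set xs \<subseteq> univ ?N"
    then have "map (\<lambda>_. p) xs = replicate (rarity L r) p" by (simp add: map_replicate_const)
    then show "relation ?N r xs = relation A r (map (\<lambda>_. p) xs)" using A(3) r j by auto
  qed (use j A(2) fl in auto)
  moreover have "is_struct L ?N" using R by (simp add: is_struct_def closed_under_relational[OF fl])
  ultimately have "model_of L ?N TA"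
    using A(1) embedding_model_of_universal[OF _ _ _ u] by (auto simp: finite_models_def)
  then show "?N \<in> K" using j by (simp add: finite_models_def)
qed (use n in auto)

lemma fan_tree_KS:
  assumes A: "A \<in> K"
  shows "fan_tree A \<in> KS"
  unfolding KS_iff
proof (intro conjI ballI allI impI)
  show "finite (univ (fan_tree A))" using A by (simp add: finite_models_def)
  show "star_tree L (fan_tree A)"
  proof unfold_locales
    show "set as \<subseteq> above (fan_tree A) c" if "set as \<subseteq> univ (fan_tree A)" "relation (fan_tree A) (Star r) (c # as)" for r c as
      using that by auto
    show "relation (fan_tree A) (Star r) (c # bs)"
      if "list_all2 (\<lambda>a b. (a, b) \<in> cone_rel (fan_tree A) c) as bs" "relation (fan_tree A) (Star r) (c # as)"
      for r c as bs
    proof -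
      have "list_all2 (=) as bs" using that(1) by (rule list_all2_mono) (auto split: if_splits)
      then show ?thesis using that(2) by (simp add: list.rel_eq)
    qed
  qed (use L in \<open>auto simp: finite_relational_def split: if_splits\<close>)
  fix c R assume R: "transversal (fan_tree A) c R \<and> R \<noteq> {}"
  then have c: "c = 0" "R \<subseteq> Suc ` univ A" by (auto simp: transversal_def split: if_splits)
  let ?N = "rep (fan_tree A) c R :: ('f, 'r, nat) struct"
  have "inj_on (\<lambda>y. y - 1) (Suc ` univ A)" by (auto simp: inj_on_def)
  then have "inj_on (\<lambda>y. y - 1) R" using c(2) by (rule inj_on_subset)
  then have "embedding L ?N A (\<lambda>y. y - 1)" unfolding embedding_def
    using c fl by auto
  moreover have "is_struct L ?N" using R by (simp add: is_struct_def closed_under_relational[OF fl])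
  ultimately have "model_of L ?N TA"
    using A embedding_model_of_universal[OF _ _ _ u] by (auto simp: finite_models_def)
  moreover have "finite R" using c(2) A finite_subset by (auto simp: finite_models_def)
  ultimately show "?N \<in> K" by (simp add: finite_models_def)
qed simp

lemma one_point_model: "\<exists>A\<in>K. \<exists>p. univ A = {p}"
proof -
  obtain A where A: "A \<in> K" using fraisse by (auto simp: fraisse_class_def)
  then obtain p where "p \<in> univ A" by (auto simp: finite_models_def model_of_def is_struct_def)
  then have "A\<lparr>univ := {p}\<rparr> \<in> K" using A model_of_restrict[OF fl u, of A "{p}"] by (simp add: finite_models_def)
  then show ?thesis by (intro bexI[of _ "A\<lparr>univ := {p}\<rparr>"]) auto
qed

text \<open>Disjoint joint embedding with a point adds at least one element.\<close>
lemma large_models: "\<exists>A\<in>K. n \<le> card (univ A)"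
proof (induction n)
  case 0
  then show ?case using one_point_model by blast
next
  case (Suc n)
  then obtain A where A: "A \<in> K" "n \<le> card (univ A)" by blast
  obtain B p where B: "B \<in> K" "univ B = {p}" using one_point_model by blast
  have "\<exists>D\<in>K. \<exists>f g. embedding L A D f \<and> embedding L B D g \<and> f ` univ A \<inter> g ` univ B = {}"
    using strong A(1) B(1) unfolding strong_amalgamation_def by blast
  then obtain D f g where D: "D \<in> K" "embedding L A D f" "embedding L B D g" "f ` univ A \<inter> g ` univ B = {}" by blast
  have fin: "finite (univ D)" "finite (univ A)" using D(1) A(1) by (auto simp: finite_models_def)
  have "insert (g p) (f ` univ A) \<subseteq> univ D" "g p \<notin> f ` univ A" using D(2-4) B(2) by (auto simp: embedding_def)
  moreover have "card (f ` univ A) = card (univ A)" using D(2) by (auto simp: embedding_def intro: card_image)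
  ultimately have "Suc (card (univ A)) \<le> card (univ D)" using fin card_mono[of "univ D" "insert (g p) (f ` univ A)"] by simp
  then show ?case using D(1) A(2) by (intro bexI[of _ D]) auto
qed

end

section \<open>The axioms in a Fraisse limit of the finite trees\<close>

lemma transversal_subset: "transversal M c R \<Longrightarrow> S \<subseteq> R \<Longrightarrow> transversal M c S"
  unfolding transversal_def by (meson subsetD subset_trans)

locale fraisse_limit_setting = fraisse_setting L TA T
  for L :: "('f, 'r) lang" and TA T :: "('f, 'r) fm set" +
  fixes F :: "(tree_fun, 'r tree_rel, nat) struct"
  assumes F: "fraisse_limit (star_lang L) KS F"
begin

lemma rich_F: "rich (star_lang L) KS F"
  by (rule rich_fraisse_limit[OF F])

lemma model_F: "model_of (star_lang L) F (T_star_forall L TA)"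
proof (rule model_of_locally_in)
  show "is_struct (star_lang L) F" using F by (simp add: fraisse_limit_def)
  show "locally_in (star_lang L) KS F"
    by (rule locally_in_fraisse_limit[OF F]) (simp add: finite_models_def)
  show "universal_theory (star_lang L) (T_star_forall L TA)" by (rule universal_T_star_forall[OF L u])
  show "model_of (star_lang L) A (T_star_forall L TA)" if "A \<in> KS" for A
    using that by (simp add: finite_models_def)
qed

sublocale star_tree L F
  using iffD1[OF model_of_T_star_forall model_F] by (elim conjE)

lemma rep_models: "c \<in> univ F \<Longrightarrow> transversal F c R \<Longrightarrow> R \<noteq> {} \<Longrightarrow> model_of L (rep F c R :: ('f, 'r, nat) struct) TA"
  using iffD1[OF model_of_T_star_forall model_F] by simp

lemma extend_F:
  assumes "B \<in> KS" "finite S" "S \<subseteq> univ F" "closed_under (star_lang L) F S"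
    "embedding (star_lang L) (F\<lparr>univ := S\<rparr>) B h"
  obtains g where "embedding (star_lang L) B F g" "\<forall>x\<in>S. g (h x) = x"
  using rich_F assms unfolding rich_def by blast

text \<open>Embed \<open>x\<close> and \<open>y\<close> as 0 and 2 into the chain of three elements, with the given cone type at
  1. By richness the embedding is inverted, and the new point is the image of 1.\<close>
lemma insert_point_F:
  assumes x: "x \<in> univ F" and y: "y \<in> above F x" and A: "A \<in> K" "univ A = {p}"
  shows "\<exists>z\<in>above F x. y \<in> above F z \<and> (\<forall>r\<in>rels L. relation F (Star r) (z # replicate (rarity L r) y)
        \<longleftrightarrow> relation A r (replicate (rarity L r) p))"
proof -
  have yU: "y \<in> univ F" and xy: "x \<noteq> y" "tle F x y" using y by (auto simp: above_def)
  define \<tau> where "\<tau> i r = (if i = (0 :: nat) then relation F (Star r) (x # replicate (rarity L r) y)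
    else relation A r (replicate (rarity L r) p))" for i r
  let ?B = "chain_tree \<tau> 3"
  have B: "?B \<in> KS"
  proof (rule chain_tree_KS)
    fix i
    have "transversal F x {y}" using y by (auto simp: transversal_def)
    then have "rep F x {y} \<in> K" using rep_models[OF x] by (simp add: finite_models_def)
    then show "\<exists>A\<in>K. \<exists>p. univ A = {p} \<and> (\<forall>r\<in>rels L. \<tau> i r \<longleftrightarrow> relation A r (replicate (rarity L r) p))"
    proof (cases "i = 0")
      case True
      then show ?thesis using \<open>rep F x {y} \<in> K\<close> by (intro bexI[of _ "rep F x {y}"] exI[of _ y]) (auto simp: \<tau>_def)
    next
      case False
      then show ?thesis using A by (intro bexI[of _ A] exI[of _ p]) (auto simp: \<tau>_def)
    qed
  qed simp
  define h where "h v = (if v = x then 0 else 2 :: nat)" for v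
  have m: "tmeet F x x = x" "tmeet F y y = y" "tmeet F x y = x" "tmeet F y x = x"
    using le_iff_meet[of x x] le_iff_meet[of y y] le_iff_meet[of x y] meet_commute[of x y] refl x yU xy by auto
  have yx: "\<not> tle F y x" using antisym[of x y] x yU xy by blast
  have "embedding (star_lang L) (F\<lparr>univ := {x, y}\<rparr>) ?B h"
  proof (rule embedding_star_langI)
    show "h (tmeet (F\<lparr>univ := {x, y}\<rparr>) v w) = tmeet ?B (h v) (h w)"
      if "v \<in> univ (F\<lparr>univ := {x, y}\<rparr>)" "w \<in> univ (F\<lparr>univ := {x, y}\<rparr>)" for v w
      using that m xy(1) by (auto simp: h_def)
    show "tle (F\<lparr>univ := {x, y}\<rparr>) v w \<longleftrightarrow> tle ?B (h v) (h w)"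
      if "v \<in> univ (F\<lparr>univ := {x, y}\<rparr>)" "w \<in> univ (F\<lparr>univ := {x, y}\<rparr>)" for v w
      using that xy yx refl x yU by (auto simp: h_def)
    show "relation (F\<lparr>univ := {x, y}\<rparr>) (Star r) (v # vs) \<longleftrightarrow> relation ?B (Star r) (h v # map h vs)"
      if r: "r \<in> rels L" "length vs = rarity L r" and v: "v \<in> univ (F\<lparr>univ := {x, y}\<rparr>)" "set vs \<subseteq> univ (F\<lparr>univ := {x, y}\<rparr>)" for r v vs
    proof (cases "v = x \<and> set vs \<subseteq> {y}")
      case True
      then have "vs = replicate (rarity L r) y" using r(2) by (intro replicate_eqI) auto
      then show ?thesis using True xy(1) by (auto simp: h_def \<tau>_def)
    next
      case False
      obtain w where w: "w \<in> set vs" "v = y \<or> w = x"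
        using False v rarity_pos[OF r(1)] r(2) by (cases vs) auto
      have vw: "v \<in> {x, y}" "w \<in> {x, y}" using v w by auto
      have "\<not> h v < h w" using w(2) vw by (auto simp: h_def)
      then have "\<not> relation ?B (Star r) (h v # map h vs)" using w(1) by auto
      moreover have "w \<notin> above F v" using w(2) vw yx xy(1) antisym x yU by (auto simp: above_def)
      then have "\<not> relation F (Star r) (v # vs)" using rel_above[OF r(1) _ _ r(2), of v] w(1) v x yU by auto
      ultimately show ?thesis by simp
    qed
  qed (use xy in \<open>auto simp: h_def inj_on_def\<close>)
  moreover have "closed_under (star_lang L) F {x, y}" using m by (simp add: closed_under_star_lang)
  ultimately obtain g where g: "embedding (star_lang L) ?B F g" "\<forall>v\<in>{x, y}. g (h v) = v"
    using extend_F[OF B, of "{x, y}" h] x yU by auto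
  have gx: "g 0 = x" "g 2 = y" using g(2) xy(1) by (auto simp: h_def)
  have "g 1 \<in> above F (g 0)" "g 2 \<in> above F (g 1)"
    using embedding_star_langD(5)[OF g(1), of 0 1] embedding_star_langD(5)[OF g(1), of 1 2] by auto
  moreover have "relation F (Star r) (g 1 # replicate (rarity L r) y) \<longleftrightarrow> relation A r (replicate (rarity L r) p)"
    if "r \<in> rels L" for r
  proof -
    have "set (replicate (rarity L r) 2) \<subseteq> univ ?B" by (simp add: set_replicate_conv_if)
    then show ?thesis
      using embedding_star_langD(6)[OF g(1) that, of "replicate (rarity L r) 2" 1] gx by (auto simp: \<tau>_def)
  qed
  ultimately show ?thesis using gx by auto
qed

text \<open>The point \<open>y\<close> becomes the upper one of a chain with two elements.\<close>
lemma no_minimum_F: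
  assumes y: "y \<in> univ F"
  shows "\<exists>x\<in>univ F. y \<in> above F x"
proof -
  obtain A p where A: "A \<in> K" "univ A = {p}" using one_point_model by blast
  define \<tau> where "\<tau> i r = relation A r (replicate (rarity L r) p)" for i :: nat and r
  let ?B = "chain_tree \<tau> 2"
  have B: "?B \<in> KS"
    by (rule chain_tree_KS) (use A in \<open>auto simp: \<tau>_def intro!: bexI[of _ A]\<close>)
  have "tmeet F y y = y" using le_iff_meet[of y y] refl y by blast
  have "embedding (star_lang L) (F\<lparr>univ := {y}\<rparr>) ?B (\<lambda>_. 1)"
  proof (rule embedding_star_langI)
    show "relation (F\<lparr>univ := {y}\<rparr>) (Star r) (v # vs) \<longleftrightarrow> relation ?B (Star r) (1 # map (\<lambda>_. 1) vs)"
      if r: "r \<in> rels L" "length vs = rarity L r" and v: "v \<in> univ (F\<lparr>univ := {y}\<rparr>)" "set vs \<subseteq> univ (F\<lparr>univ := {y}\<rparr>)" for r v vs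
    proof -
      have "v = y" "y \<in> set vs" using v rarity_pos[OF r(1)] r(2) by (cases vs; auto)+
      moreover have "y \<notin> above F y" by (simp add: above_def)
      ultimately have "\<not> relation F (Star r) (v # vs)" using rel_above[OF r(1) y _ r(2)] v(2) y by auto
      then show ?thesis using \<open>y \<in> set vs\<close> by auto
    qed
  qed (use refl y in auto)
  moreover have "closed_under (star_lang L) F {y}" using \<open>tmeet F y y = y\<close> by (simp add: closed_under_star_lang)
  ultimately obtain g where g: "embedding (star_lang L) ?B F g" "\<forall>v\<in>{y}. g 1 = v"
    using extend_F[OF B, of "{y}" "\<lambda>_. 1"] y by auto
  have "g 1 \<in> above F (g 0)" using embedding_star_langD(5)[OF g(1), of 0 1] by auto
  moreover have "g 0 \<in> univ F" using embedding_star_langD(1)[OF g(1), of 0] by simp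
  ultimately show ?thesis using g(2) by auto
qed

text \<open>Embed \<open>c\<close> and \<open>V\<close> into the fan over \<open>A\<close>, with \<open>c\<close> as its center, and use richness.\<close>
lemma cone_extension_F:
  assumes c: "c \<in> univ F" and A: "A \<in> K" and V: "finite V" "transversal F c V"
    and f: "embedding L (rep F c V) A f"
  shows "\<exists>g. transversal F c (g ` univ A) \<and> embedding L A (rep F c (g ` univ A)) g \<and> (\<forall>v\<in>V. g (f v) = v)"
proof -
  let ?B = "fan_tree A" and ?S = "insert c V"
  define h where "h x = (if x = c then 0 else Suc (f x))" for x
  have Vc: "v \<in> univ F" "v \<noteq> c" "tle F c v" if "v \<in> V" for v using V(2) that by (auto simp: transversal_def above_def)
  have fV: "f v \<in> univ A" if "v \<in> V" for v using f that by (auto simp: embedding_def)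
  have finj: "f v = f w \<longleftrightarrow> v = w" if "v \<in> V" "w \<in> V" for v w using f that by (auto simp: embedding_def dest: inj_onD)
  have mV: "tmeet F v w = (if v = w then v else c)" if v: "v \<in> V" "w \<in> V" for v w
  proof (cases "v = w")
    case True
    then show ?thesis using le_iff_meet[of v v] refl Vc v by auto
  next
    case False
    then have "(v, w) \<notin> cone_rel F c" using V(2) v unfolding transversal_def by blast
    then have "tmeet F v w \<notin> above F c" using cone_rel_iff[OF c] Vc v by blast
    moreover have "tle F c (tmeet F v w)" using meet_greatest c Vc v by blast
    ultimately show ?thesis using False meet_closed Vc v by (auto simp: above_def)
  qed
  have mc: "tmeet F c v = c" "tmeet F v c = c" if "v \<in> ?S" for v
    using that le_iff_meet[of c v] meet_commute[of c v] c Vc refl by auto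
  have m: "tmeet F v w = (if v = w then v else c)" if "v \<in> ?S" "w \<in> ?S" for v w
    using that mV mc by auto
  have SU: "v \<in> univ F" if "v \<in> ?S" for v using that c Vc by auto
  have le: "tle F v w \<longleftrightarrow> v = w \<or> v = c" if "v \<in> ?S" "w \<in> ?S" for v w
    using le_iff_meet[of v w] SU that m[OF that] by auto
  have hS: "h v = h w \<longleftrightarrow> v = w" if "v \<in> ?S" "w \<in> ?S" for v w using that finj by (auto simp: h_def)
  have "embedding (star_lang L) (F\<lparr>univ := ?S\<rparr>) ?B h"
  proof (rule embedding_star_langI)
    show "h v \<in> univ ?B" if "v \<in> univ (F\<lparr>univ := ?S\<rparr>)" for v using that fV by (auto simp: h_def)
    show "inj_on h (univ (F\<lparr>univ := ?S\<rparr>))" unfolding inj_on_def using hS by simp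
    show "h (tmeet (F\<lparr>univ := ?S\<rparr>) v w) = tmeet ?B (h v) (h w)"
      if "v \<in> univ (F\<lparr>univ := ?S\<rparr>)" "w \<in> univ (F\<lparr>univ := ?S\<rparr>)" for v w
    proof -
      have "v \<in> ?S" "w \<in> ?S" using that by simp_all
      then have "tmeet F v w = (if v = w then v else c)" "h v = h w \<longleftrightarrow> v = w" by (rule m, rule hS)
      then show ?thesis by (simp add: h_def)
    qed
    show "tle (F\<lparr>univ := ?S\<rparr>) v w \<longleftrightarrow> tle ?B (h v) (h w)"
      if "v \<in> univ (F\<lparr>univ := ?S\<rparr>)" "w \<in> univ (F\<lparr>univ := ?S\<rparr>)" for v w
    proof -
      have "v \<in> ?S" "w \<in> ?S" using that by simp_all
      then have "tle F v w \<longleftrightarrow> v = w \<or> v = c" "h v = h w \<longleftrightarrow> v = w" by (rule le, rule hS)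
      moreover have "h v = 0 \<longleftrightarrow> v = c" by (simp add: h_def)
      ultimately show ?thesis by simp
    qed
    show "relation (F\<lparr>univ := ?S\<rparr>) (Star r) (v # vs) \<longleftrightarrow> relation ?B (Star r) (h v # map h vs)"
      if r: "r \<in> rels L" "length vs = rarity L r" and v: "v \<in> univ (F\<lparr>univ := ?S\<rparr>)" "set vs \<subseteq> univ (F\<lparr>univ := ?S\<rparr>)" for r v vs
    proof (cases "v = c \<and> set vs \<subseteq> V")
      case True
      then have cvs: "c \<notin> set vs" using Vc by blast
      then have map: "map h vs = map (\<lambda>x. Suc (f x)) vs" by (auto simp: h_def)
      have "relation F (Star r) (c # vs) \<longleftrightarrow> relation A r (map f vs)"
        using f r True by (auto simp: embedding_def)
      then show ?thesis using True unfolding map by (auto simp: h_def comp_def)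
    next
      case False
      have "vs \<noteq> []" using rarity_pos[OF r(1)] r(2) by auto
      then have "hd vs \<in> set vs" by simp
      then have "\<exists>w\<in>set vs. v \<in> V \<or> w = c" using False v by (cases "v = c") auto
      then obtain w where w: "w \<in> set vs" "v \<in> V \<or> w = c" by blast
      have vw: "v \<in> ?S" "w \<in> ?S" using v w(1) by auto
      have "w \<notin> above F v" using w(2) le[OF vw] vw Vc by (auto simp: above_def)
      then have "\<not> relation F (Star r) (v # vs)" using rel_above[OF r(1) _ _ r(2), of v] w(1) v SU by auto
      moreover have "\<not> relation ?B (Star r) (h v # map h vs)"
      proof
        assume "relation ?B (Star r) (h v # map h vs)"
        then have "h v = 0" "h w \<noteq> 0" using w(1) by auto
        then show False using w(2) Vc by (auto simp: h_def split: if_splits)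
      qed
      ultimately show ?thesis by simp
    qed
  qed
  moreover have "closed_under (star_lang L) F ?S" using m by (simp add: closed_under_star_lang)
  moreover have "finite ?S" "?S \<subseteq> univ F" using V(1) SU by auto
  ultimately obtain g where g: "embedding (star_lang L) ?B F g" "\<forall>x\<in>?S. g (h x) = x"
    using extend_F[OF fan_tree_KS[OF A], of ?S h] by blast
  note gD = embedding_star_langD[OF g(1)]
  have g0: "g 0 = c" using g(2) by (simp add: h_def)
  define k where "k a = g (Suc a)" for a
  have k_above: "k a \<in> above F c" if "a \<in> univ A" for a
    using gD(5)[of 0 "Suc a"] that g0 by (simp add: k_def)
  have k_new: "a = b" if "a \<in> univ A" "b \<in> univ A" "(k a, k b) \<in> cone_rel F c" for a b
  proof (rule ccontr)
    assume "a \<noteq> b"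
    then have "tmeet F (k a) (k b) = c" using gD(3)[of "Suc a" "Suc b"] that g0 by (simp add: k_def)
    then show False using that(3) cone_rel_iff[OF c] by (simp add: above_def)
  qed
  have k_inj: "inj_on k (univ A)"
  proof (rule inj_onI)
    fix a b assume "a \<in> univ A" "b \<in> univ A" "k a = k b"
    then show "a = b" using gD(2)[of "Suc a" "Suc b"] by (simp add: k_def)
  qed
  show ?thesis
  proof (intro exI[of _ k] conjI ballI)
    show "transversal F c (k ` univ A)" unfolding transversal_def using k_above k_new by auto
    show "embedding L A (rep F c (k ` univ A)) k" unfolding embedding_def
    proof (intro conjI ballI allI impI)
      fix r xs assume r: "r \<in> rels L" "length xs = rarity L r \<and> set xs \<subseteq> univ A"
      have "relation ?B (Star r) (0 # map Suc xs) \<longleftrightarrow> relation F (Star r) (g 0 # map g (map Suc xs))"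
        by (rule gD(6)) (use r in auto)
      moreover have "map k xs = map g (map Suc xs)" by (simp add: k_def)
      moreover have "relation ?B (Star r) (0 # map Suc xs) \<longleftrightarrow> relation A r xs" by (auto simp: comp_def)
      ultimately show "relation A r xs = relation (rep F c (k ` univ A)) r (map k xs)"
        by (simp only: g0 rep_simps)
    qed (use fl k_inj in auto)
    fix v assume v: "v \<in> V"
    then show "k (f v) = v" using g(2) Vc by (auto simp: k_def h_def)
  qed
qed

lemma many_cones_F:
  assumes c: "c \<in> univ F"
  shows "\<exists>X. finite X \<and> card X = n \<and> transversal F c X"
proof -
  obtain A where A: "A \<in> K" "n \<le> card (univ A)" using large_models by blast
  have "transversal F c {}" by (simp add: transversal_def)
  moreover have "embedding L (rep F c {}) A (\<lambda>_. undefined)"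
    using L by (force simp: embedding_def finite_relational_def)
  ultimately obtain g where g: "transversal F c (g ` univ A)" "embedding L A (rep F c (g ` univ A)) g"
    using cone_extension_F[OF c A(1), of "{}"] by blast
  have "card (g ` univ A) = card (univ A)" using g(2) by (auto simp: embedding_def intro: card_image)
  then have "n \<le> card (g ` univ A)" using A(2) by simp
  then obtain X where "X \<subseteq> g ` univ A" "card X = n" "finite X"
    by (rule obtain_subset_with_card_n)
  moreover have "transversal F c X" by (rule transversal_subset[OF g(1) \<open>X \<subseteq> g ` univ A\<close>])
  ultimately show ?thesis by blast
qed

lemma above_nonempty_F:
  assumes "c \<in> univ F"
  shows "above F c \<noteq> {}"
proof -
  obtain X where X: "card X = 1" "transversal F c X" using many_cones_F[OF assms] by blast
  then have "X \<noteq> {}" by auto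
  then show ?thesis using X(2) by (auto simp: transversal_def)
qed

text \<open>A full transversal carries a countable structure that is rich for the finite models of \<open>TA\<close>
  by \<open>cone_extension_F\<close>, after moving the new points into the transversal. So it is a model
  of \<open>T\<close>.\<close>
lemma cone_struct_F:
  assumes c: "c \<in> univ F"
  shows "model_of L (cone_struct F c :: ('f, 'r, nat set) struct) T"
proof -
  have "transversal F c {}" by (simp add: transversal_def)
  then obtain R \<rho> where R: "transversal F c R" "\<forall>a\<in>above F c. \<rho> a \<in> R \<and> (\<rho> a, a) \<in> cone_rel F c" "\<forall>a\<in>R. \<rho> a = a"
    by (rule transversal_extend[OF c order_refl _ empty_subsetI])
  let ?P = "rep F c R :: ('f, 'r, nat) struct"
  have "R \<noteq> {}" using R(2) above_nonempty_F[OF c] by blast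
  then have PT: "model_of L ?P TA" by (rule rep_models[OF c R(1)])
  have "rich L K ?P" unfolding rich_def
  proof (intro ballI allI impI)
    fix A S h assume A: "A \<in> K" and S: "finite S \<and> S \<subseteq> univ ?P \<and> closed_under L ?P S \<and> embedding L (?P\<lparr>univ := S\<rparr>) A h"
    have "transversal F c S" using S R(1) unfolding transversal_def by auto
    then obtain g where g: "transversal F c (g ` univ A)" "embedding L A (rep F c (g ` univ A)) g" "\<forall>v\<in>S. g (h v) = v"
      using cone_extension_F[OF c A, of S h] S by auto
    have g_above: "g a \<in> above F c" if "a \<in> univ A" for a using g(1) that by (auto simp: transversal_def)
    have g_inj: "inj_on g (univ A)" using g(2) by (simp add: embedding_def)
    have "embedding L A ?P (\<rho> \<circ> g)" unfolding embedding_def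
    proof (intro conjI ballI allI impI)
      show "(\<rho> \<circ> g) ` univ A \<subseteq> univ ?P" using g_above R(2) by auto
      show "inj_on (\<rho> \<circ> g) (univ A)"
      proof (rule inj_onI)
        fix a b assume ab: "a \<in> univ A" "b \<in> univ A" "(\<rho> \<circ> g) a = (\<rho> \<circ> g) b"
        then have "(g a, g b) \<in> cone_rel F c"
          using R(2) g_above cone_rel_sym[OF c] cone_rel_trans[OF c] by (metis comp_apply)
        then have "g a = g b" using g(1) ab(1,2) unfolding transversal_def by blast
        then show "a = b" using g_inj ab(1,2) by (simp add: inj_on_eq_iff)
      qed
      fix r xs assume r: "r \<in> rels L" "length xs = rarity L r \<and> set xs \<subseteq> univ A"
      then have "relation A r xs \<longleftrightarrow> relation F (Star r) (c # map g xs)" using g(2) by (auto simp: embedding_def)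
      also have "\<dots> \<longleftrightarrow> relation F (Star r) (c # map (\<rho> \<circ> g) xs)"
      proof (rule rel_cong[OF r(1) c])
        fix x assume "x \<in> set xs"
        then have "g x \<in> above F c" using g_above r(2) by auto
        then show "(g x, (\<rho> \<circ> g) x) \<in> cone_rel F c" using R(2) cone_rel_sym[OF c] by simp
      qed (use r in simp)
      finally show "relation A r xs \<longleftrightarrow> relation ?P r (map (\<rho> \<circ> g) xs)" by simp
    qed (use fl in auto)
    moreover have "\<forall>x\<in>S. (\<rho> \<circ> g) (h x) = x" using g(3) R(3) S by auto
    ultimately show "\<exists>g. embedding L A ?P g \<and> (\<forall>x\<in>S. g (h x) = x)" by blast
  qed
  then have "model_of L ?P T" by (rule model_of_rich[OF L u mc je PT])
  moreover have "isomorphism L ?P (cone_struct F c) (\<lambda>a. cone_rel F c `` {a})"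
    by (rule isomorphism_rep_cone_struct[OF fl c R(1)]) (use R(2) in blast)
  ultimately show ?thesis using isomorphism_model_of T_sentence by blast
qed

lemma sat_many_cones_F: "sat F (many_cones n)"
  unfolding many_cones_def sat_All
  unfolding sat_def
proof (intro allI impI)
  fix e :: "nat \<Rightarrow> nat" assume e: "\<forall>i. e i \<in> univ F"
  obtain X where X: "finite X" "card X = n" "transversal F (e 0) X" using many_cones_F e by blast
  obtain xs where xs: "set xs = X" "distinct xs" using finite_distinct_list[OF X(1)] by blast
  have len: "length xs = n" using X(2) xs distinct_card by fastforce
  \<comment> \<open>the variables of the cones start at 1, the list at 0\<close>
  define e' where "e' i = (if i \<in> set [1..<n + 1] then xs ! (i - 1) else e i)" for i
  have e'X: "e' i \<in> X" if "1 \<le> i" "i < n + 1" for i using that len xs(1) by (auto simp: e'_def)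
  have above: "e' i \<in> above F (e 0)" if "1 \<le> i" "i < n + 1" for i using e'X[OF that] X(3) by (auto simp: transversal_def)
  have new: "tmeet F (e' i) (e' j) \<notin> above F (e 0)" if ij: "1 \<le> i" "i < n + 1" "1 \<le> j" "j < i" for i j
  proof
    assume a: "tmeet F (e' i) (e' j) \<in> above F (e 0)"
    have "j < n + 1" using ij by simp
    have U: "e' i \<in> univ F" "e' j \<in> univ F" using above[OF ij(1,2)] above[OF ij(3) \<open>j < n + 1\<close>] above_univ by blast+
    then have "(e' i, e' j) \<in> cone_rel F (e 0)" using a cone_rel_iff e by blast
    then have "e' i = e' j" using X(3) e'X[OF ij(1,2)] e'X[OF ij(3) \<open>j < n + 1\<close>] unfolding transversal_def by blast
    moreover have "i \<in> set [1..<n + 1]" "j \<in> set [1..<n + 1]" using ij by auto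
    ultimately have "xs ! (i - 1) = xs ! (j - 1)" unfolding e'_def by (simp only: if_True)
    then show False using xs(2) len ij by (simp add: nth_eq_iff_index_eq)
  qed
  show "eval_fm F e (exs [1..<n + 1] (conj_list
     (map (\<lambda>i. lt (Var 0) (Var i)) [1..<n + 1] @
      [Neg (lt (Var 0) (meet (Var i) (Var j))). i \<leftarrow> [1..<n + 1], j \<leftarrow> [1..<i]])))"
  proof (rule eval_exsI[of _ e'])
    show "e' i = e i" if "i \<notin> set [1..<n + 1]" for i using that unfolding e'_def by (rule if_not_P)
    show "e' i \<in> univ F" if "i \<in> set [1..<n + 1]" for i
      using above[of i] that subsetD[OF above_univ] by auto
    have e0: "e' 0 = e 0" by (simp add: e'_def)
    have "eval_fm F e' p" if "p \<in> set (map (\<lambda>i. lt (Var 0) (Var i)) [1..<n + 1])" for p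
    proof -
      obtain i where i: "p = lt (Var 0) (Var i)" "1 \<le> i" "i < n + 1" using \<open>p \<in> _\<close> by auto
      then show ?thesis using above[OF i(2,3)] e0 by (simp add: above_def)
    qed
    moreover have "eval_fm F e' p"
      if "p \<in> set [Neg (lt (Var 0) (meet (Var i) (Var j))). i \<leftarrow> [1..<n + 1], j \<leftarrow> [1..<i]]" for p
    proof -
      obtain i j where p: "p = Neg (lt (Var 0) (meet (Var i) (Var j)))" and ij: "1 \<le> i" "i < n + 1" "1 \<le> j" "j < i"
        using \<open>p \<in> _\<close> by auto
      have "j < n + 1" using ij by simp
      then have "tmeet F (e' i) (e' j) \<in> univ F"
        using above[OF ij(1,2)] above[OF ij(3)] above_univ meet_closed by blast
      then show ?thesis using new[OF ij] e0 unfolding p by (auto simp: above_def)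
    qed
    ultimately show "eval_fm F e' (conj_list
     (map (\<lambda>i. lt (Var 0) (Var i)) [1..<n + 1] @
      [Neg (lt (Var 0) (meet (Var i) (Var j))). i \<leftarrow> [1..<n + 1], j \<leftarrow> [1..<i]]))"
      unfolding eval_conj_list set_append by blast
  qed
qed

lemma limit_satisfies_axioms: "model_of (star_lang L) F axioms"
proof -
  have tree: "sat F p" if "p \<in> Tr \<union> WD L \<union> OC L" for p
    using that model_F by (auto simp: model_of_def T_star_forall_def)
  have above_iff: "y \<in> above F x \<longleftrightarrow> y \<in> univ F \<and> tle F x y \<and> x \<noteq> y" for x y by (simp add: above_def)
  have dense: "sat F (Imp (And (And (leq (Var 1) (Var 0)) (leq (Var 2) (Var 0))) (lt (Var 1) (Var 2)))
       (Ex 3 (And (leq (Var 3) (Var 0)) (And (lt (Var 1) (Var 3)) (lt (Var 3) (Var 2))))))" (is "sat F ?p")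
    unfolding sat_def
  proof (intro allI impI)
    fix e :: "nat \<Rightarrow> nat" assume e: "\<forall>n. e n \<in> univ F"
    have "\<exists>a\<in>univ F. tle F a (e 0) \<and> (tle F (e 1) a \<and> e 1 \<noteq> a) \<and> (tle F a (e 2) \<and> a \<noteq> e 2)"
      if "tle F (e 2) (e 0)" "tle F (e 1) (e 2)" "e 1 \<noteq> e 2"
    proof -
      obtain A p where A: "A \<in> K" "univ A = {p}" using one_point_model by blast
      have U: "e 0 \<in> univ F" "e 1 \<in> univ F" "e 2 \<in> univ F" using e by auto
      then have "e 2 \<in> above F (e 1)" using that by (simp add: above_def)
      from insert_point_F[OF U(2) this A] obtain z where "z \<in> above F (e 1)" "e 2 \<in> above F z" by blast
      then show ?thesis using trans[of z "e 2" "e 0"] U that(1) by (intro bexI[of _ z]) (auto simp: above_iff)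
    qed
    then show "eval_fm F e ?p" by auto
  qed
  have max: "sat F (Ex 1 (And (leq (Var 1) (Var 0)) (All 2 (Imp (leq (Var 2) (Var 0)) (leq (Var 2) (Var 1))))))" (is "sat F ?p")
    unfolding sat_def
  proof (intro allI impI)
    fix e :: "nat \<Rightarrow> nat" assume e: "\<forall>n. e n \<in> univ F"
    have "tle F (e 0) (e 0)" using refl e by blast
    then show "eval_fm F e ?p" using e by (auto intro!: bexI[of _ "e 0"])
  qed
  have no_min: "sat F (Imp (leq (Var 1) (Var 0)) (Ex 2 (And (leq (Var 2) (Var 0)) (lt (Var 2) (Var 1)))))" (is "sat F ?p")
    unfolding sat_def
  proof (intro allI impI)
    fix e :: "nat \<Rightarrow> nat" assume e: "\<forall>n. e n \<in> univ F"
    then obtain z where z: "z \<in> univ F" "e 1 \<in> above F z" using no_minimum_F by blast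
    have "tle F z (e 0)" if "tle F (e 1) (e 0)" using trans[of z "e 1" "e 0"] that z e by (auto simp: above_iff)
    then show "eval_fm F e ?p" using z by (auto simp: above_iff intro!: bexI[of _ z])
  qed
  have DT: "sat F p" if "p \<in> DT" for p
  proof -
    consider "p \<in> Tr"
      | "p = foralls [0, 1, 2] (Imp (And (And (leq (Var 1) (Var 0)) (leq (Var 2) (Var 0))) (lt (Var 1) (Var 2)))
       (Ex 3 (And (leq (Var 3) (Var 0)) (And (lt (Var 1) (Var 3)) (lt (Var 3) (Var 2))))))"
      | "p = All 0 (Ex 1 (And (leq (Var 1) (Var 0)) (All 2 (Imp (leq (Var 2) (Var 0)) (leq (Var 2) (Var 1))))))"
      | "p = foralls [0, 1] (Imp (leq (Var 1) (Var 0)) (Ex 2 (And (leq (Var 2) (Var 0)) (lt (Var 2) (Var 1)))))"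
      | n where "p = many_cones n"
      using \<open>p \<in> DT\<close> unfolding DT_def Let_def by blast
    then show ?thesis
    proof cases
      case 1
      then show ?thesis using tree by blast
    next
      case 2
      show ?thesis unfolding 2 sat_foralls by (rule dense)
    next
      case 3
      show ?thesis unfolding 3 sat_All by (rule max)
    next
      case 4
      show ?thesis unfolding 4 sat_foralls by (rule no_min)
    next
      case 5
      show ?thesis unfolding 5 by (rule sat_many_cones_F)
    qed
  qed
  have T_oc: "sat F p" if "p \<in> T_oc L T" for p
  proof -
    consider "p \<in> WD L \<union> OC L" | x q where "p = All x (star x q)" "q \<in> T" "x \<notin> all_vars q"
      using \<open>p \<in> T_oc L T\<close> unfolding T_oc_def by blast
    then show ?thesis
    proof cases
      case 1
      then show ?thesis using tree by blast
    next
      case 2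
      have "sat F (star x q)"
        using sat_star_iff[OF fl T_sentence[OF 2(2)] 2(3) above_nonempty_F] cone_struct_F 2(2)
        unfolding model_of_def by blast
      then show ?thesis by (simp add: 2(1))
    qed
  qed
  have T_zero: "sat F p" if "p \<in> T_zero L TA" for p
  proof -
    obtain rs A where p: "p = foralls [0, 1] (Imp (lt (Var 0) (Var 1))
        (Ex 2 (And (And (lt (Var 0) (Var 2)) (lt (Var 2) (Var 1))) (cone_type L rs A 2 1))))"
      and rs: "set rs = rels L" and A: "model_of L A TA" "card (univ A) = 1"
      using \<open>p \<in> T_zero L TA\<close> unfolding T_zero_def by blast
    obtain a where a: "univ A = {a}" using A(2) card_1_singletonE by blast
    have AK: "A \<in> K" using A(1) a by (simp add: finite_models_def)
    show ?thesis unfolding p sat_foralls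
      unfolding sat_def
    proof (intro allI impI)
      fix e :: "nat \<Rightarrow> nat" assume e: "\<forall>n. e n \<in> univ F"
      show "eval_fm F e (Imp (lt (Var 0) (Var 1))
        (Ex 2 (And (And (lt (Var 0) (Var 2)) (lt (Var 2) (Var 1))) (cone_type L rs A 2 1))))"
      proof (cases "e 1 \<in> above F (e 0)")
        case True
        have "e 0 \<in> univ F" using e by blast
        from insert_point_F[OF this True AK a] obtain z where z: "z \<in> above F (e 0)" "e 1 \<in> above F z"
          "\<forall>r\<in>rels L. relation F (Star r) (z # replicate (rarity L r) (e 1)) \<longleftrightarrow> relation A r (replicate (rarity L r) a)"
          by blast
        then show ?thesis using rs a by (auto simp: eval_cone_type above_iff intro!: bexI[of _ z])
      next
        case False
        then show ?thesis using e by (simp add: above_iff)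
      qed
    qed
  qed
  have "is_struct (star_lang L) F" using F by (simp add: fraisse_limit_def)
  then show ?thesis using DT T_oc T_zero by (auto simp: model_of_def)
qed

end

section \<open>Equality of the two theories\<close>

lemma sentence_of_universal: "universal_theory L U \<Longrightarrow> p \<in> U \<Longrightarrow> sentence L p"
  unfolding universal_theory_def sentence_def by fastforce

lemma sentence_many_cones:
  fixes L :: "('f, 'r) lang"
  shows "sentence (star_lang L) (many_cones n)"
proof -
  let ?ps = "map (\<lambda>i. lt (Var 0) (Var i)) [1..<n + 1] @
      [Neg (lt (Var 0) (meet (Var i) (Var j))). i \<leftarrow> [1..<n + 1], j \<leftarrow> [1..<i]] :: (tree_fun, 'r tree_rel) fm list"
  have "\<forall>p\<in>set ?ps. wf_fm (star_lang L) p" by auto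
  moreover have "\<forall>p\<in>set ?ps. free_vars p \<subseteq> {..n}" by auto
  ultimately show ?thesis
    unfolding sentence_def many_cones_def by (fastforce simp del: upt_Suc)
qed

context fraisse_setting
begin

lemma sentence_axioms:
  assumes p: "p \<in> axioms"
  shows "sentence (star_lang L) p"
proof -
  consider "p \<in> T_star_forall L TA"
    | "p = foralls [0, 1, 2] (Imp (And (And (leq (Var 1) (Var 0)) (leq (Var 2) (Var 0))) (lt (Var 1) (Var 2)))
       (Ex 3 (And (leq (Var 3) (Var 0)) (And (lt (Var 1) (Var 3)) (lt (Var 3) (Var 2))))))"
    | "p = All 0 (Ex 1 (And (leq (Var 1) (Var 0)) (All 2 (Imp (leq (Var 2) (Var 0)) (leq (Var 2) (Var 1))))))"
    | "p = foralls [0, 1] (Imp (leq (Var 1) (Var 0)) (Ex 2 (And (leq (Var 2) (Var 0)) (lt (Var 2) (Var 1)))))"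
    | n where "p = many_cones n"
    | x q where "p = All x (star x q)" "q \<in> T"
    | "p \<in> T_zero L TA"
    using p unfolding DT_def T_oc_def T_star_forall_def Let_def by blast
  then show ?thesis
  proof cases
    case 1
    then show ?thesis by (rule sentence_of_universal[OF universal_T_star_forall[OF L u]])
  next
    case 5
    show ?thesis unfolding 5 by (rule sentence_many_cones)
  next
    case (6 x q)
    then show ?thesis using T_sentence[OF 6(2)] free_vars_star[OF fl, of q x] by (auto simp: sentence_def wf_star)
  next
    case 7
    then obtain rs A where "p = foralls [0, 1] (Imp (lt (Var 0) (Var 1))
        (Ex 2 (And (And (lt (Var 0) (Var 2)) (lt (Var 2) (Var 1))) (cone_type L rs A 2 1))))" "set rs = rels L"
      unfolding T_zero_def by blast
    then show ?thesis
      by (auto simp: sentence_def cone_type_def Let_def list_all_iff split: if_splits)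
  qed (auto simp: sentence_def)
qed

lemma axioms_subset_T_star: "axioms \<subseteq> T_star L TA"
proof
  fix p assume p: "p \<in> axioms"
  have "sat F p" if "fraisse_limit (star_lang L) KS F" for F
  proof -
    interpret fraisse_limit_setting L TA T F by unfold_locales (rule that)
    show ?thesis using limit_satisfies_axioms p unfolding model_of_def by blast
  qed
  then show "p \<in> T_star L TA" using sentence_axioms[OF p] by (simp add: T_star_def fraisse_limit_theory_def)
qed

text \<open>For the harder direction, a countable elementary substructure of \<open>M\<close> is a Fraisse limit, in
  which \<open>T*\<close> holds by definition.\<close>
lemma model_of_T_star_iff:
  fixes M :: "(tree_fun, 'r tree_rel, 'a) struct"
  shows "model_of (star_lang L) M (T_star L TA) \<longleftrightarrow> model_of (star_lang L) M axioms"
proof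
  assume "model_of (star_lang L) M (T_star L TA)"
  then show "model_of (star_lang L) M axioms" using axioms_subset_T_star unfolding model_of_def by blast
next
  assume M: "model_of (star_lang L) M axioms"
  have st: "is_struct (star_lang L) M" using M by (simp add: model_of_def)
  have c: "countable (funs (star_lang L))" "countable (rels (star_lang L))"
    using fin_rels by (auto intro: countable_finite)
  obtain N :: "(tree_fun, 'r tree_rel, nat) struct"
    where N: "is_struct (star_lang L) N" "\<And>p. sentence (star_lang L) p \<Longrightarrow> sat N p = sat M p"
    by (rule downward_Loewenheim_Skolem[OF st c]) (rule that)
  have "model_of (star_lang L) N axioms" using N M sentence_axioms unfolding model_of_def by blast
  then have "fraisse_limit (star_lang L) KS N" by (rule fraisse_limit_of_axioms)
  then have "sat M p" if "p \<in> T_star L TA" for p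
    using that N(2)[of p] by (simp add: T_star_def fraisse_limit_theory_def)
  then show "model_of (star_lang L) M (T_star L TA)" using st by (simp add: model_of_def)
qed

end

theorem proposition4p13:
  fixes L :: "('f, 'r) lang"
    and TA T :: "('f, 'r) fm set"
  assumes "finite_relational L"
    and "universal_theory L TA"
    and "fraisse_class L (finite_models L TA)"
    and "strong_amalgamation L (finite_models L TA)"
    and "model_completion L T TA"
  shows "(\<forall>M :: (tree_fun, 'r tree_rel, 'a) struct. model_of (star_lang L) M (T_star L TA) \<longrightarrow>
            (\<forall>c\<in>univ M. model_of L (cone_struct M c) T)) \<and>
         deductive_closure TYPE('a) (star_lang L) (T_star L TA) =
         deductive_closure TYPE('a) (star_lang L) (DT \<union> T_oc L T \<union> T_zero L TA)"
proof -
  interpret fraisse_setting L TA T by unfold_locales (fact assms)+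
  show ?thesis
    by (auto simp: deductive_closure_def model_of_T_star_iff cone_struct_of_axioms)
qed

end
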